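(* Let $\Theta$ be either $\Theta_{\mathcal T}$ (with data from the tournament model) or $\Theta_{\mathcal G}$ (with data from the graph model), and let $\Theta^{(k)}\subseteq\Theta$ be the corresponding class of $k\times k$ block matrices. There exists a universal constant $C<\infty$ such that for every integer $n\ge2$, every $k\in[n]$ and every $p\in[0,1]$ with $p\ge\frac{2\log n}{n}$, $$\sup_{\theta^*\in\Theta^{(k)}}\frac1{n^2}\,\mathbb E\|\hat\theta-\theta^*\|^2\le C\Big[\frac{\min(k,\sqrt{np})\log n}{np}+\frac{(\log n)^2}{np}\Big].$$
   Context: Notation: $[n]=\{1,\dots,n\}$; $S_n$ is the set of permutations of $[n]$; for an $n\times n$ matrix $\theta$ and $\pi\in S_n$, $(\theta\circ\pi)_{ij}=\theta_{\pi(i),\pi(j)}$; $\|\cdot\|$ is the Frobenius norm; $\log$ is the natural logarithm. Parameter spaces: $\mathcal T$ is the set of $\theta\in[0,1]^{n\times n}$ such that $\theta_{ij}\le\theta_{ik}$ whenever $i\ne k$, $i\ne j$, $k<j$; $\theta_{ji}=1-\theta_{ij}$ for all $i\neq j$; $\theta_{ii}=0$ for all $i$; and $\theta_{ij}\le\frac12$ for all $i<j$. $\mathcal G$ is the set of $\theta\in[0,1]^{n\times n}$ such that $\theta_{ij}\le\theta_{ik}$ whenever $i\ne k$, $i\ne j$, $j<k$; $\theta_{ji}=\theta_{ij}$ for all $i\ne j$; and $\theta_{ii}=0$ for all $i$. Set $\Theta_{\mathcal T}=\{\theta\circ\pi:\theta\in\mathcal T,\pi\in S_n\}$ and $\Theta_{\mathcal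 G}=\{\theta\circ\pi:\theta\in\mathcal G,\pi\in S_n\}$. Block matrices: for $k\in[n]$, $\Theta^{(k)}\subseteq\Theta$ is the subset of all $k\times k$ block matrices with equal sized blocks, up to an unknown permutation; i.e. the set of $\theta\in\Theta$ for which there are a $k\times k$ matrix $B$ and $\pi\in S_n$ with $(\theta\circ\pi)_{ij}=B\big(\lceil ki/n\rceil,\lceil kj/n\rceil\big)$ for all $i\ne j$. Data with true parameter $\theta^*$ and observation probability $p$: for $i<j$ there are independent outcomes with law $\mathrm{Bern}(\theta^*_{ij})$; each above-diagonal entry is observed with probability $p$, independently over entries and independently of the outcomes. For $i<j$ set $y_{ij}$ equal to the outcome if it is observed and $y_{ij}=\frac12$ if it is missing. The lower triangle is $y_{ji}=1-y_{ij}$ in the tournament model and $y_{ji}=y_{ij}$ in the graph model ($i<j$), and $y_{ii}=0$. Let $\hat p$ be the number of observed above-diagonal entries divided by $\binom n2$. Estimator: let $r_i=\sum_{j=1}^n y_{ij}$ and let $\hat\sigma$ be a permutation with $r_{\hat\sigma(1)}\le\dots\le r_{\hat\sigma(n)}$, ties being broken uniformly at random. Let $J$ be the $n\times n$ matrix with $J_{ij}=1$ for $i\ne j$ and $J_{ii}=0$. Let $\mathrm{Proj}$ be the Euclidean (Frobenius) projection onto the closed convex set $\mathcal T$ in the tournament model, and onto $\mathcal G$ in the graph model. Then $$\hat\theta=\mathrm{Proj}\Big(\big(\tfrac{y-J/2}{\hat p}+\tfrac J2\big)\circ\hat\sigma\Big)\circ\hat\sigma^{-1}\ \text{ if }\hat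 p\ge\tfrac1n,\qquad \hat\theta=\tfrac J2\ \text{ otherwise}.$$ *)

theory Defs
  imports "HOL-Probability.Probability" "HOL-Combinatorics.Permutations"
begin

text \<open>
  The dimension \<open>n\<close> is quantified below the universal constant, so an \<open>n \<times> n\<close> matrix is a function
  indexed by \<open>{1..n}\<close> in each argument. All matrices used here vanish outside
  \<open>{1..n} \<times> {1..n}\<close>, so that equality of matrices is equality of functions.
\<close>

type_synonym rmat = "nat \<Rightarrow> nat \<Rightarrow> real"

definition mat_perm :: "rmat \<Rightarrow> (nat \<Rightarrow> nat) \<Rightarrow> rmat"  (infixl \<open>\<odot>\<close> 75) where
  "\<theta> \<odot> \<pi> = (\<lambda>i j. \<theta> (\<pi> i) (\<pi> j))"

definition frob_norm :: "nat \<Rightarrow> rmat \<Rightarrow> real" where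
  "frob_norm n A = L2_set (\<lambda>(i, j). A i j) ({1..n} \<times> {1..n})"

definition unit_matrices :: "nat \<Rightarrow> rmat set" where
  "unit_matrices n =
     {\<theta>. (\<forall>i\<in>{1..n}. \<forall>j\<in>{1..n}. 0 \<le> \<theta> i j \<and> \<theta> i j \<le> 1) \<and>
         (\<forall>i j. i \<notin> {1..n} \<or> j \<notin> {1..n} \<longrightarrow> \<theta> i j = 0)}"

definition tournament_matrices :: "nat \<Rightarrow> rmat set" where
  "tournament_matrices n =
     {\<theta> \<in> unit_matrices n.
        (\<forall>i\<in>{1..n}. \<forall>j\<in>{1..n}. \<forall>k\<in>{1..n}. i \<noteq> k \<and> i \<noteq> j \<and> k < j \<longrightarrow> \<theta> i j \<le> \<theta> i k) \<and>
        (\<forall>i\<in>{1..n}. \<forall>j\<in>{1..n}. i \<noteq> j \<longrightarrow> \<theta> j i = 1 - \<theta> i j) \<and>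
        (\<forall>i\<in>{1..n}. \<theta> i i = 0) \<and>
        (\<forall>i\<in>{1..n}. \<forall>j\<in>{1..n}. i < j \<longrightarrow> \<theta> i j \<le> 1/2)}"

definition graph_matrices :: "nat \<Rightarrow> rmat set" where
  "graph_matrices n =
     {\<theta> \<in> unit_matrices n.
        (\<forall>i\<in>{1..n}. \<forall>j\<in>{1..n}. \<forall>k\<in>{1..n}. i \<noteq> k \<and> i \<noteq> j \<and> j < k \<longrightarrow> \<theta> i j \<le> \<theta> i k) \<and>
        (\<forall>i\<in>{1..n}. \<forall>j\<in>{1..n}. i \<noteq> j \<longrightarrow> \<theta> j i = \<theta> i j) \<and>
        (\<forall>i\<in>{1..n}. \<theta> i i = 0)}"

datatype model = Tournament | Graph

fun ordered_matrices :: "model \<Rightarrow> nat \<Rightarrow> rmat set" where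
  "ordered_matrices Tournament n = tournament_matrices n"
| "ordered_matrices Graph n = graph_matrices n"

definition Theta :: "model \<Rightarrow> nat \<Rightarrow> rmat set" where
  "Theta m n = {\<theta> \<odot> \<pi> | \<theta> \<pi>. \<theta> \<in> ordered_matrices m n \<and> \<pi> permutes {1..n}}"

text \<open>Only the values of \<open>B\<close> on \<open>{1..k} \<times> {1..k}\<close> matter, as the ceilings lie in \<open>{1..k}\<close>.\<close>

definition block_Theta :: "model \<Rightarrow> nat \<Rightarrow> nat \<Rightarrow> rmat set" where
  "block_Theta m n k =
     {\<theta> \<in> Theta m n. \<exists>(B :: rmat) \<pi>. \<pi> permutes {1..n} \<and>
        (\<forall>i\<in>{1..n}. \<forall>j\<in>{1..n}. i \<noteq> j \<longrightarrow>
           (\<theta> \<odot> \<pi>) i j =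
             B (nat \<lceil>real k * real i / real n\<rceil>) (nat \<lceil>real k * real j / real n\<rceil>))}"

text \<open>
  A sample assigns to each above-diagonal pair \<open>(i, j)\<close> the outcome (first component) and
  the indicator that this outcome is observed (second component).
\<close>

type_synonym sample = "nat \<times> nat \<Rightarrow> bool \<times> bool"

definition upper_pairs :: "nat \<Rightarrow> (nat \<times> nat) set" where
  "upper_pairs n = {(i, j). 1 \<le> i \<and> i < j \<and> j \<le> n}"

definition sample_pmf :: "nat \<Rightarrow> rmat \<Rightarrow> real \<Rightarrow> sample pmf" where
  "sample_pmf n \<theta> p =
     Pi_pmf (upper_pairs n) (False, False)
       (\<lambda>(i, j). pair_pmf (bernoulli_pmf (\<theta> i j)) (bernoulli_pmf p))"

definition upper_entry :: "sample \<Rightarrow> nat \<Rightarrow> nat \<Rightarrow> real" where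
  "upper_entry \<omega> i j = (if snd (\<omega> (i, j)) then of_bool (fst (\<omega> (i, j))) else 1/2)"

fun reflect_entry :: "model \<Rightarrow> real \<Rightarrow> real" where
  "reflect_entry Tournament x = 1 - x"
| "reflect_entry Graph x = x"

definition data_matrix :: "model \<Rightarrow> nat \<Rightarrow> sample \<Rightarrow> rmat" where
  "data_matrix m n \<omega> =
     (\<lambda>i j. if i \<notin> {1..n} \<or> j \<notin> {1..n} \<or> i = j then 0
            else if i < j then upper_entry \<omega> i j
            else reflect_entry m (upper_entry \<omega> j i))"

definition p_hat :: "nat \<Rightarrow> sample \<Rightarrow> real" where
  "p_hat n \<omega> = real (card {e \<in> upper_pairs n. snd (\<omega> e)}) / real (n choose 2)"

definition row_sum :: "nat \<Rightarrow> rmat \<Rightarrow> nat \<Rightarrow> real" where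
  "row_sum n y i = (\<Sum>j=1..n. y i j)"

definition sorting_perms :: "nat \<Rightarrow> rmat \<Rightarrow> (nat \<Rightarrow> nat) set" where
  "sorting_perms n y = {\<sigma>. \<sigma> permutes {1..n} \<and> mono_on {1..n} (\<lambda>i. row_sum n y (\<sigma> i))}"

definition J_mat :: "nat \<Rightarrow> rmat" where
  "J_mat n = (\<lambda>i j. if i \<in> {1..n} \<and> j \<in> {1..n} \<and> i \<noteq> j then 1 else 0)"

text \<open>
  The library constant \<^const>\<open>closest_point\<close> needs a Euclidean type, hence a fixed dimension.
  The sets \<open>ordered_matrices m n\<close> are nonempty, compact and convex, and their elements vanish
  outside \<open>{1..n} \<times> {1..n}\<close>, so the minimiser exists and is unique.
\<close>

definition proj :: "nat \<Rightarrow> rmat set \<Rightarrow> rmat \<Rightarrow> rmat" where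
  "proj n K A = arg_min_on (\<lambda>M. frob_norm n (\<lambda>i j. A i j - M i j)) K"

definition theta_hat :: "model \<Rightarrow> nat \<Rightarrow> sample \<Rightarrow> (nat \<Rightarrow> nat) \<Rightarrow> rmat" where
  "theta_hat m n \<omega> \<sigma> =
     (if p_hat n \<omega> \<ge> 1 / real n then
        proj n (ordered_matrices m n)
          ((\<lambda>i j. (data_matrix m n \<omega> i j - J_mat n i j / 2) / p_hat n \<omega> + J_mat n i j / 2) \<odot> \<sigma>)
        \<odot> inv \<sigma>
      else (\<lambda>i j. J_mat n i j / 2))"

text \<open>
  Ties are broken uniformly at random: given the data, the sorting permutation is uniform on the
  (finite, nonempty) set of all permutations that sort the row sums.
\<close>

definition estimator_pmf :: "model \<Rightarrow> nat \<Rightarrow> rmat \<Rightarrow> real \<Rightarrow> rmat pmf" where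
  "estimator_pmf m n \<theta> p =
     bind_pmf (sample_pmf n \<theta> p) (\<lambda>\<omega>.
       map_pmf (theta_hat m n \<omega>) (pmf_of_set (sorting_perms n (data_matrix m n \<omega>))))"

definition risk :: "model \<Rightarrow> nat \<Rightarrow> rmat \<Rightarrow> real \<Rightarrow> real" where
  "risk m n \<theta> p =
     measure_pmf.expectation (estimator_pmf m n \<theta> p)
       (\<lambda>\<theta>'. (frob_norm n (\<lambda>i j. \<theta>' i j - \<theta> i j))\<^sup>2)"

end

theory Submission
  imports Defs
begin

text \<open>
  Write \<open>\<theta> = \<theta>\<^sub>0 \<odot> \<pi>\<close> with \<open>\<theta>\<^sub>0\<close> ordered. Minimality of the projection \<open>P\<close> of the rescaled, sorted data
  \<open>Y\<close>, tested against \<open>\<theta>\<^sub>0\<close>, gives \<open>norm (P - \<theta>\<^sub>0)^2 \<le> 2 * inner (Y - \<theta>\<^sub>0) (P - \<theta>\<^sub>0)\<close>. Here \<open>Y - \<theta>\<^sub>0\<close>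
  consists of the noise, the fluctuation of \<open>p_hat\<close> and the sorting error \<open>\<theta> \<odot> \<sigma> - \<theta>\<^sub>0\<close>.

  Sorting error: the row sums fluctuate by \<open>x = O(sqrt (n p ln n))\<close>, so the rows of \<open>\<theta>\<close> that \<open>\<sigma>\<close> and
  \<open>inv \<pi>\<close> put in the same place are comparable and have sums differing by at most \<open>2 x / p\<close>. Their
  difference has constant sign, and for block matrices it is constant on sets of size about \<open>n / k\<close>;
  its \<open>L1\<close> norm thus controls its \<open>L2\<close> norm.

  Noise: choose a centre \<open>A'\<close> near \<open>\<theta>\<^sub>0\<close>, and decompose \<open>M - A'\<close> for ordered \<open>M\<close> into its level sets. On
  each cell where \<open>A'\<close> is constant they are staircases, so there are only
  \<open>exp (O(n * min k (sqrt (n p))))\<close> of them, or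
  \<open>n!\<close> times as many after relabelling by an arbitrary permutation. Bernstein's inequality holds for
  all of them at once, and summing over the levels costs a factor \<open>sqrt (ln n)\<close>.
\<close>

section \<open>Bernstein's inequality for products of finite distributions\<close>

text \<open>The permutation \<open>\<sigma>\<close> is computed from the same data as the noise, and
  so is the projection. Hence the noise is controlled on all relabelled level sets simultaneously.
  The logarithm of their number, \<open>n * ln n\<close> for the permutations plus a multiple of
  \<open>n * min k (sqrt (n p))\<close> for the staircases, sets the exponent \<open>H\<close> in
  Bernstein's inequality. These two summands become the two terms of the rate, each with another
  \<open>ln n\<close> from the sum over levels.

  The level sets of \<open>M - \<theta>\<^sub>0\<close> have no monotone shape, since
  \<open>\<theta>\<^sub>0\<close> varies too; subtracting a matrix that is constant on cells
  restores it. A rounding with about \<open>sqrt (n p)\<close> values is at squared distance at most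
  \<open>n / p\<close> from \<open>\<theta>\<^sub>0\<close>, which is affordable; hence the minimum
  with \<open>sqrt (n p)\<close>.

  The assumption \<open>n p \<ge> 2 ln n\<close> keeps the linear part of Bernstein's bound below
  the Gaussian part for row sums and for \<open>p_hat\<close>. Off the good event, of probability
  \<open>O(1/n)\<close>, the error is at most \<open>n^2\<close>, which contributes only
  \<open>O(n)\<close>.\<close>

lemma exp_le_quadratic:
  fixes x :: real
  assumes "x \<le> 1"
  shows "exp x \<le> 1 + x + x\<^sup>2"
proof (cases "x \<ge> 0")
  case True
  then show ?thesis using exp_bound assms by blast
next
  case False
  define t where "t = - x"
  have t: "t \<ge> 0" using False by (simp add: t_def)
  have q: "1 + t + t\<^sup>2 / 2 \<le> exp t" using exp_lower_Taylor_quadratic[OF t] .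
  \<comment> \<open>For negative arguments the claim is \<open>exp (- t) \<le> 1 - t + t^2\<close>;
    multiplying by the Taylor lower bound of \<open>exp t\<close> reduces it to a polynomial
    inequality whose linear terms cancel.\<close>
  have "1 \<le> (1 - t + t\<^sup>2) * (1 + t + t\<^sup>2 / 2)"
  proof -
    have "(1 - t + t\<^sup>2) * (1 + t + t\<^sup>2 / 2) = 1 + (t^2 + t^3 + t^4) / 2"
      by (simp add: field_simps power2_eq_square power3_eq_cube power4_eq_xxxx)
    then show ?thesis using t by simp
  qed
  also have "\<dots> \<le> (1 - t + t\<^sup>2) * exp t"
  proof (rule mult_left_mono[OF q])
    have "0 \<le> (t - 1/2)\<^sup>2 + 3/4" by simp
    then show "0 \<le> 1 - t + t\<^sup>2" by (simp add: power2_eq_square algebra_simps)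
  qed
  finally have "exp (- t) \<le> 1 - t + t\<^sup>2"
    by (simp add: exp_minus field_simps)
  then show ?thesis by (simp add: t_def)
qed

text \<open>The linear term of the quadratic bound has mean zero, so only the variance is left in
  the exponent. That it is the variance, later of order \<open>p\<close>, and not the range of
  \<open>X\<close> is what makes the final rate depend on \<open>n p\<close>.\<close>

lemma mgf_bounded_pmf:
  fixes X :: "'a \<Rightarrow> real"
  assumes fin: "finite (set_pmf M)"
    and bd: "\<And>x. x \<in> set_pmf M \<Longrightarrow> \<bar>X x\<bar> \<le> 1"
    and mean: "measure_pmf.expectation M X = 0"
    and var: "measure_pmf.expectation M (\<lambda>x. (X x)\<^sup>2) \<le> v"
    and t: "\<bar>t\<bar> \<le> 1"
  shows "measure_pmf.expectation M (\<lambda>x. exp (t * X x)) \<le> exp (t\<^sup>2 * v)"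
proof -
  have int: "integrable (measure_pmf M) f" for f :: "'a \<Rightarrow> real"
    using fin by (rule integrable_measure_pmf_finite)
  have "measure_pmf.expectation M (\<lambda>x. exp (t * X x)) 
      \<le> measure_pmf.expectation M (\<lambda>x. 1 + t * X x + t\<^sup>2 * (X x)\<^sup>2)"
  proof (rule integral_mono_AE[OF int int], rule AE_pmfI)
    fix x assume "x \<in> set_pmf M"
    then have "\<bar>t * X x\<bar> \<le> 1" using t bd[of x] by (simp add: abs_mult mult_le_one)
    then have "t * X x \<le> 1" by linarith
    then show "exp (t * X x) \<le> 1 + t * X x + t\<^sup>2 * (X x)\<^sup>2"
      using exp_le_quadratic[of "t * X x"] by (simp add: power_mult_distrib)
  qed
  also have "\<dots> = 1 + t\<^sup>2 * measure_pmf.expectation M (\<lambda>x. (X x)\<^sup>2)"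
    using int mean by simp
  also have "\<dots> \<le> 1 + t\<^sup>2 * v" using var by (simp add: mult_left_mono)
  also have "\<dots> \<le> exp (t\<^sup>2 * v)" by (rule exp_ge_add_one_self)
  finally show ?thesis .
qed

lemma mgf_sum_Pi_pmf:
  fixes X :: "'e \<Rightarrow> 'a \<Rightarrow> real"
  assumes finA: "finite A"
    and fin: "\<And>e. e \<in> A \<Longrightarrow> finite (set_pmf (M e))"
    and bd: "\<And>e x. e \<in> A \<Longrightarrow> x \<in> set_pmf (M e) \<Longrightarrow> \<bar>X e x\<bar> \<le> 1"
    and mean: "\<And>e. e \<in> A \<Longrightarrow> measure_pmf.expectation (M e) (X e) = 0"
    and var: "\<And>e. e \<in> A \<Longrightarrow> measure_pmf.expectation (M e) (\<lambda>x. (X e x)\<^sup>2) \<le> v"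
    and t: "\<And>e. e \<in> A \<Longrightarrow> \<bar>t * c e\<bar> \<le> 1"
  shows "measure_pmf.expectation (Pi_pmf A d M) (\<lambda>\<omega>. exp (t * (\<Sum>e\<in>A. c e * X e (\<omega> e))))
           \<le> exp (t\<^sup>2 * v * (\<Sum>e\<in>A. (c e)\<^sup>2))"
proof -
  have "measure_pmf.expectation (Pi_pmf A d M) (\<lambda>\<omega>. exp (t * (\<Sum>e\<in>A. c e * X e (\<omega> e))))
      = measure_pmf.expectation (Pi_pmf A d M) (\<lambda>\<omega>. \<Prod>e\<in>A. exp (t * c e * X e (\<omega> e)))"
    using finA by (simp add: exp_sum sum_distrib_left mult.assoc)
  also have "\<dots> = (\<Prod>e\<in>A. measure_pmf.expectation (M e) (\<lambda>x. exp (t * c e * X e x)))"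
    using finA by (intro expectation_prod_Pi_pmf integrable_measure_pmf_finite fin) auto
  also have "\<dots> \<le> (\<Prod>e\<in>A. exp ((t * c e)\<^sup>2 * v))"
    by (intro prod_mono conjI mgf_bounded_pmf integral_nonneg fin bd mean var t) auto
  also have "\<dots> = exp (t\<^sup>2 * v * (\<Sum>e\<in>A. (c e)\<^sup>2))"
    using finA by (simp add: exp_sum sum_distrib_left power_mult_distrib mult_ac)
  finally show ?thesis .
qed

lemma finite_set_Pi_pmf:
  assumes "finite A" "\<And>e. e \<in> A \<Longrightarrow> finite (set_pmf (M e))"
  shows "finite (set_pmf (Pi_pmf A d M))"
  using assms by (simp add: set_Pi_pmf finite_PiE_dflt)

text \<open>Chernoff's method. Weights up to 2 are allowed because an entry and its mirror image
  share one random variable; they limit the exponent to \<open>t \<le> 1/2\<close>, since the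
  quadratic bound needs \<open>\<bar>t * c e * X e x\<bar> \<le> 1\<close>.\<close>

lemma tail_sum_Pi_pmf:
  fixes X :: "'e \<Rightarrow> 'a \<Rightarrow> real"
  assumes finA: "finite A"
    and fin: "\<And>e. e \<in> A \<Longrightarrow> finite (set_pmf (M e))"
    and bd: "\<And>e x. e \<in> A \<Longrightarrow> x \<in> set_pmf (M e) \<Longrightarrow> \<bar>X e x\<bar> \<le> 1"
    and mean: "\<And>e. e \<in> A \<Longrightarrow> measure_pmf.expectation (M e) (X e) = 0"
    and var: "\<And>e. e \<in> A \<Longrightarrow> measure_pmf.expectation (M e) (\<lambda>x. (X e x)\<^sup>2) \<le> v"
    and c: "\<And>e. e \<in> A \<Longrightarrow> \<bar>c e\<bar> \<le> 2"
    and s: "v * (\<Sum>e\<in>A. (c e)\<^sup>2) \<le> s"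
    and s0: "0 \<le> s" and H: "H > 0"
  shows "measure_pmf.prob (Pi_pmf A d M) {\<omega>. 2 * sqrt (H * s) + 4 * H < (\<Sum>e\<in>A. c e * X e (\<omega> e))}
           \<le> exp (- H)"
proof -
  let ?P = "Pi_pmf A d M"
  let ?S = "\<lambda>\<omega>. \<Sum>e\<in>A. c e * X e (\<omega> e)"
  define x where "x = 2 * sqrt (H * s) + 4 * H"
  \<comment> \<open>Balancing \<open>t * s\<close> against \<open>H / t\<close> gives
    \<open>t = sqrt (H / s)\<close>, and \<open>4 * H \<le> s\<close> says exactly that this is at
    most 1/2. Otherwise \<open>t = 1/2\<close> is used and the linear term \<open>4 * H\<close>
    pays.\<close>
  obtain t where t: "0 < t" "t \<le> 1/2" "t\<^sup>2 * s + H \<le> t * x"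
  proof (cases "4 * H \<le> s")
    case True
    then have s0: "s > 0" using H by linarith
    define t where "t = sqrt (H / s)"
    have t0: "t > 0" using H s0 by (simp add: t_def)
    have "H / s \<le> (1/2)\<^sup>2" using True s0 H by (simp add: field_simps power2_eq_square)
    then have "t \<le> 1/2" unfolding t_def by (metis real_le_lsqrt zero_le_divide_1_iff zero_le_numeral)
    moreover have t2: "t\<^sup>2 = H / s" using s0 H by (simp add: t_def)
    moreover have "t * sqrt (H * s) = H"
    proof -
      have "t * sqrt (H * s) = sqrt ((H / s) * (H * s))"
        unfolding t_def by (rule real_sqrt_mult[symmetric])
      also have "(H / s) * (H * s) = H\<^sup>2" using s0 by (simp add: power2_eq_square)
      finally show ?thesis using H by simp
    qed
    moreover have "0 \<le> t * (4 * H)" using t0 H by simp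
    ultimately have "t\<^sup>2 * s + H \<le> t * x"
      using s0 by (simp add: x_def algebra_simps)
    then show ?thesis using that t0 \<open>t \<le> 1/2\<close> by blast
  next
    case False
    have "0 \<le> sqrt (H * s)" using H s0 by simp
    then have "(1/2)\<^sup>2 * s + H \<le> (1/2) * x"
      using False unfolding x_def power2_eq_square by argo
    then show ?thesis using that[of "1/2"] by simp
  qed
  have fin': "finite (set_pmf ?P)" by (rule finite_set_Pi_pmf[OF finA fin])
  have int: "integrable (measure_pmf ?P) f" for f :: "_ \<Rightarrow> real"
    using fin' by (rule integrable_measure_pmf_finite)
  have "measure_pmf.prob ?P {\<omega>. x < ?S \<omega>} = measure_pmf.expectation ?P (indicator {\<omega>. x < ?S \<omega>})"
    by simp
  also have "\<dots> \<le> measure_pmf.expectation ?P (\<lambda>\<omega>. exp (t * ?S \<omega>) * exp (- (t * x)))"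
  proof (rule integral_mono[OF int int])
    fix \<omega>
    show "indicat_real {\<omega>. x < ?S \<omega>} \<omega> \<le> exp (t * ?S \<omega>) * exp (- (t * x))"
    proof (cases "x < ?S \<omega>")
      case True
      then have "0 \<le> t * ?S \<omega> + - (t * x)" using t(1) by simp
      then show ?thesis unfolding exp_add[symmetric] using True by simp
    qed simp
  qed
  also have "\<dots> = measure_pmf.expectation ?P (\<lambda>\<omega>. exp (t * ?S \<omega>)) * exp (- (t * x))"
    by simp
  also have "\<dots> \<le> exp (t\<^sup>2 * v * (\<Sum>e\<in>A. (c e)\<^sup>2)) * exp (- (t * x))"
  proof (intro mult_right_mono mgf_sum_Pi_pmf assms)
    fix e assume "e \<in> A"
    from c[OF this] have "\<bar>t\<bar> * \<bar>c e\<bar> \<le> (1/2) * 2" using t by (intro mult_mono) auto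
    then show "\<bar>t * c e\<bar> \<le> 1" by (simp add: abs_mult)
  qed auto
  also have "\<dots> \<le> exp (- H)"
  proof -
    have "t\<^sup>2 * v * (\<Sum>e\<in>A. (c e)\<^sup>2) \<le> t\<^sup>2 * s" using s by (simp add: mult.assoc mult_left_mono)
    then show ?thesis using t(3) by (simp flip: exp_add)
  qed
  finally show ?thesis by (simp add: x_def)
qed

section \<open>Moments of a single observation\<close>

definition centred_obs :: "bool \<times> bool \<Rightarrow> real" where
  "centred_obs s = (if snd s then of_bool (fst s) - 1/2 else 0)"

text \<open>A missing entry is recorded as 1/2, so its centred value is 0 and the mean of
  \<open>centred_obs\<close> is \<open>p * (q - 1/2)\<close>: divided by \<open>p\<close>, it
  estimates \<open>q - 1/2\<close> without bias.\<close>

definition entry_noise :: "real \<Rightarrow> real \<Rightarrow> bool \<times> bool \<Rightarrow> real" where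
  "entry_noise p q s = centred_obs s - p * (q - 1/2)"

lemma expectation_obs_pair:
  fixes f :: "bool \<times> bool \<Rightarrow> real"
  assumes "0 \<le> p" "p \<le> 1" "0 \<le> q" "q \<le> 1"
  shows "measure_pmf.expectation (pair_pmf (bernoulli_pmf q) (bernoulli_pmf p)) f
    = f (True, True) * (q * p) + f (True, False) * (q * (1 - p))
      + f (False, True) * ((1 - q) * p) + f (False, False) * ((1 - q) * (1 - p))"
proof -
  have U: "(UNIV :: (bool \<times> bool) set) = {(True, True), (True, False), (False, True), (False, False)}"
    by auto
  show ?thesis using assms
    by (subst integral_measure_pmf_real[of UNIV]) (auto simp: U pmf_pair)
qed

lemma entry_noise_mean:
  assumes "0 \<le> p" "p \<le> 1" "0 \<le> q" "q \<le> 1"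
  shows "measure_pmf.expectation (pair_pmf (bernoulli_pmf q) (bernoulli_pmf p)) (entry_noise p q) = 0"
  by (subst expectation_obs_pair[OF assms]) (simp add: entry_noise_def centred_obs_def field_simps)

lemma entry_noise_bound:
  assumes "0 \<le> p" "p \<le> 1" "0 \<le> q" "q \<le> 1"
  shows "\<bar>entry_noise p q s\<bar> \<le> 1"
proof -
  have "\<bar>p * (q - 1/2)\<bar> \<le> 1 * (1/2)" unfolding abs_mult using assms
    by (intro mult_mono) (auto simp: abs_if)
  then show ?thesis by (cases s) (auto simp: entry_noise_def centred_obs_def)
qed

lemma entry_noise_variance:
  assumes "0 \<le> p" "p \<le> 1" "0 \<le> q" "q \<le> 1"
  shows "measure_pmf.expectation (pair_pmf (bernoulli_pmf q) (bernoulli_pmf p))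
           (\<lambda>s. (entry_noise p q s)\<^sup>2) \<le> p / 2"
proof -
  have "measure_pmf.expectation (pair_pmf (bernoulli_pmf q) (bernoulli_pmf p))
           (\<lambda>s. (entry_noise p q s)\<^sup>2) = p / 4 - (p * (q - 1/2))\<^sup>2"
    by (subst expectation_obs_pair[OF assms])
       (simp add: entry_noise_def centred_obs_def field_simps power2_eq_square)
  then show ?thesis using assms(1) zero_le_power2[of "p * (q - 1/2)"] by linarith
qed

lemma indicator_noise:
  assumes "0 \<le> p" "p \<le> 1" "0 \<le> q" "q \<le> 1"
  shows "measure_pmf.expectation (pair_pmf (bernoulli_pmf q) (bernoulli_pmf p))
           (\<lambda>s. of_bool (snd s) - p) = 0"
    and "measure_pmf.expectation (pair_pmf (bernoulli_pmf q) (bernoulli_pmf p))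
           (\<lambda>s. (of_bool (snd s) - p)\<^sup>2) \<le> p"
    and "\<bar>of_bool b - p\<bar> \<le> 1"
proof -
  show "measure_pmf.expectation (pair_pmf (bernoulli_pmf q) (bernoulli_pmf p))
           (\<lambda>s. of_bool (snd s) - p) = 0"
    by (subst expectation_obs_pair[OF assms]) (simp add: algebra_simps)
  have "measure_pmf.expectation (pair_pmf (bernoulli_pmf q) (bernoulli_pmf p))
           (\<lambda>s. (of_bool (snd s) - p)\<^sup>2) = p - p\<^sup>2"
    by (subst expectation_obs_pair[OF assms]) (simp add: algebra_simps power2_eq_square)
  then show "measure_pmf.expectation (pair_pmf (bernoulli_pmf q) (bernoulli_pmf p))
           (\<lambda>s. (of_bool (snd s) - p)\<^sup>2) \<le> p" by simp
  show "\<bar>of_bool b - p\<bar> \<le> 1" using assms by (cases b) auto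
qed

section \<open>Staircases and level sets\<close>

text \<open>The keys \<open>f\<close> and \<open>g\<close> carry the order, so that decreasing
  columns and, with both keys negated, down-closed sets are covered by the same count.\<close>

definition upsets :: "('a \<Rightarrow> 'k::linorder) \<Rightarrow> ('b \<Rightarrow> 'l::linorder) \<Rightarrow> 'a set \<Rightarrow> 'b set \<Rightarrow> ('a \<times> 'b) set set"
  where "upsets f g C D = {T. T \<subseteq> C \<times> D \<and>
    (\<forall>i j i' j'. (i, j) \<in> T \<longrightarrow> i' \<in> C \<longrightarrow> j' \<in> D \<longrightarrow> f i \<le> f i' \<longrightarrow> g j \<le> g j' \<longrightarrow> (i', j') \<in> T)}"

lemma finite_upsets:
  assumes "finite C" "finite D"
  shows "finite (upsets f g C D)"
proof (rule finite_subset)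
  show "upsets f g C D \<subseteq> Pow (C \<times> D)" by (auto simp: upsets_def)
  show "finite (Pow (C \<times> D))" using assms by simp
qed

text \<open>The boundary of an up-closed set is a lattice path, read here one step at a time from
  the corner of the top row \<open>c\<close> and the lowest column \<open>d\<close>. If the corner
  belongs to \<open>T\<close>, the whole row \<open>c\<close> does and can be removed; if not,
  column \<open>d\<close> is disjoint from \<open>T\<close> and can be removed. Each step offers two
  choices.\<close>

lemma card_upsets:
  fixes f :: "'a \<Rightarrow> 'k::linorder" and g :: "'b \<Rightarrow> 'l::linorder"
  assumes "finite C" "finite D"
  shows "card (upsets f g C D) \<le> 2 ^ (card C + card D)"
  using assms
proof (induction "card C + card D" arbitrary: C D rule: less_induct)
  case less
  note fin = less.prems
  show ?case
  proof (cases "C = {} \<or> D = {}")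
    case True
    then have "upsets f g C D \<subseteq> {{}}" by (auto simp: upsets_def)
    then have "card (upsets f g C D) \<le> card {{} :: ('a \<times> 'b) set}" by (intro card_mono) auto
    also have "\<dots> \<le> 2 ^ (card C + card D)" by simp
    finally show ?thesis .
  next
    case False
    then have ne: "C \<noteq> {}" "D \<noteq> {}" by auto
    obtain c where c: "c \<in> C" "\<And>i. i \<in> C \<Longrightarrow> f i \<le> f c"
    proof -
      have "Max (f ` C) \<in> f ` C" using ne fin by simp
      then obtain c where "c \<in> C" "f c = Max (f ` C)" by auto
      then show ?thesis using that[of c] fin by simp
    qed
    obtain d where d: "d \<in> D" "\<And>j. j \<in> D \<Longrightarrow> g d \<le> g j"
    proof -
      have "Min (g ` D) \<in> g ` D" using ne fin by simp
      then obtain d where "d \<in> D" "g d = Min (g ` D)" by auto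
      then show ?thesis using that[of d] fin by simp
    qed
    have sub: "upsets f g C D
        \<subseteq> (\<lambda>T. {c} \<times> D \<union> T) ` upsets f g (C - {c}) D \<union> upsets f g C (D - {d})"
    proof
      fix T assume T: "T \<in> upsets f g C D"
      have TCD: "T \<subseteq> C \<times> D" using T by (simp add: upsets_def)
      have up: "(i', j') \<in> T"
        if "(i, j) \<in> T" "i' \<in> C" "j' \<in> D" "f i \<le> f i'" "g j \<le> g j'" for i j i' j'
        using T that by (simp add: upsets_def)
      show "T \<in> (\<lambda>T. {c} \<times> D \<union> T) ` upsets f g (C - {c}) D \<union> upsets f g C (D - {d})"
      proof (cases "(c, d) \<in> T")
        case True
        have row: "{c} \<times> D \<subseteq> T" using up[OF True c(1)] d(2) by auto
        let ?T = "T - {c} \<times> D"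
        have "?T \<in> upsets f g (C - {c}) D"
          using TCD unfolding upsets_def by (auto intro: up)
        moreover have "T = {c} \<times> D \<union> ?T" using row by auto
        ultimately show ?thesis by blast
      next
        case False
        have "(i, d) \<notin> T" for i
          using False up[of i d c d] TCD c d(1) by auto
        then have "T \<in> upsets f g C (D - {d})"
          using TCD unfolding upsets_def by (auto intro: up)
        then show ?thesis by blast
      qed
    qed
    have cards: "card (C - {c}) + card D < card C + card D" "card C + card (D - {d}) < card C + card D"
      using card_Diff1_less[OF fin(1) c(1)] card_Diff1_less[OF fin(2) d(1)] by auto
    have eqs: "card C + card D = Suc (card (C - {c}) + card D)"
        "card C + card D = Suc (card C + card (D - {d}))"
      using card_Suc_Diff1[OF fin(1) c(1)] card_Suc_Diff1[OF fin(2) d(1)] by auto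
    have "card (upsets f g C D) \<le> card ((\<lambda>T. {c} \<times> D \<union> T) ` upsets f g (C - {c}) D \<union> upsets f g C (D - {d}))"
      using fin by (intro card_mono sub) (auto simp: finite_upsets)
    also have "\<dots> \<le> card (upsets f g (C - {c}) D) + card (upsets f g C (D - {d}))"
      using fin by (intro order_trans[OF card_Un_le] add_mono card_image_le) (auto simp: finite_upsets)
    also have "\<dots> \<le> 2 ^ (card (C - {c}) + card D) + 2 ^ (card C + card (D - {d}))"
      using fin by (intro add_mono less.hyps cards) auto
    also have "\<dots> = 2 ^ (card C + card D)"
      using eqs by (metis mult_2 power_Suc add_left_cancel Suc_inject)
    finally show ?thesis .
  qed
qed

section \<open>Inner products bounded through level sets\<close>

lemma harm_le_ln: "n > 0 \<Longrightarrow> (\<Sum>l=1..n. 1 / real l) \<le> 1 + ln (real n)"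
proof -
  assume "n > 0"
  then obtain m where m: "n = Suc m" using gr0_implies_Suc by blast
  have "harm (Suc m) - ln (real (Suc m)) \<le> harm (Suc 0) - ln (real (Suc 0))"
    using decseq_harm_diff_ln by (rule decseqD) simp
  then show ?thesis by (simp add: m harm_def inverse_eq_divide)
qed

text \<open>With \<open>m\<close> the integer part of \<open>N * d\<close>, all sums run over
  \<open>1..m\<close>. The third is the one produced by the weights \<open>l\<close> in
  Cauchy--Schwarz; bounding each of its \<open>m\<close> terms by \<open>m\<close> is
  enough.\<close>

lemma layer_counts:
  fixes d :: real and N :: nat
  assumes "0 \<le> d" "d \<le> 1" "N > 0"
  shows "(\<Sum>l=1..N. of_bool (real l / N \<le> d)) \<le> N * d"
    and "N * d - 1 \<le> (\<Sum>l=1..N. of_bool (real l / N \<le> d))"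
    and "(\<Sum>l=1..N. real l * of_bool (real l / N \<le> d)) \<le> (N * d)\<^sup>2"
proof -
  define m where "m = nat \<lfloor>N * d\<rfloor>"
  have Nd: "0 \<le> N * d" using assms by simp
  have m: "real m \<le> N * d" "N * d - 1 \<le> real m"
    unfolding m_def using Nd by linarith+
  have "N * d \<le> real N * 1" using assms by (intro mult_left_mono) auto
  then have mN: "m \<le> N" using m by linarith
  have iff: "real l / N \<le> d \<longleftrightarrow> l \<le> m" for l
  proof -
    have "real l / N \<le> d \<longleftrightarrow> real l \<le> N * d" using assms(3) by (simp add: field_simps)
    also have "\<dots> \<longleftrightarrow> l \<le> m" unfolding m_def using Nd by linarith
    finally show ?thesis .
  qed
  have set: "{1..N} \<inter> {l. l \<le> m} = {1..m}" using mN by auto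
  have eq: "(\<Sum>l=1..N. of_bool (real l / N \<le> d)) = real m"
    unfolding iff by (simp add: of_bool_def sum.If_cases set[unfolded One_nat_def])
  show "(\<Sum>l=1..N. of_bool (real l / N \<le> d)) \<le> N * d" "N * d - 1 \<le> (\<Sum>l=1..N. of_bool (real l / N \<le> d))"
    unfolding eq using m by auto
  have "(\<Sum>l=1..N. real l * of_bool (real l / N \<le> d)) = (\<Sum>l=1..m. real l)"
    unfolding iff by (simp add: of_bool_def if_distrib sum.If_cases set[unfolded One_nat_def] cong: if_cong)
  also have "\<dots> \<le> (\<Sum>l=1..m. real m)" by (intro sum_mono) auto
  also have "\<dots> = (real m)\<^sup>2" by (simp add: power2_eq_square)
  also have "\<dots> \<le> (N * d)\<^sup>2" using m by (intro power_mono) auto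
  finally show "(\<Sum>l=1..N. real l * of_bool (real l / N \<le> d)) \<le> (N * d)\<^sup>2" .
qed

text \<open>
  Cauchy--Schwarz with weights \<open>l\<close> and \<open>1/l\<close>: the harmonic sum is the price for passing from
  level sets to the \<open>L2\<close> norm.
\<close>

lemma level_set_bound:
  fixes z d :: "'a \<Rightarrow> real" and N :: nat
  assumes I: "finite I" and N: "N > 0"
    and d: "\<And>i. i \<in> I \<Longrightarrow> 0 \<le> d i" "\<And>i. i \<in> I \<Longrightarrow> d i \<le> 1"
    and z: "\<And>i. i \<in> I \<Longrightarrow> \<bar>z i\<bar> \<le> 1"
    and ab: "0 \<le> \<alpha>"
    and lev: "\<And>u. u > 0 \<Longrightarrow> \<bar>\<Sum>i\<in>{i\<in>I. u \<le> d i}. z i\<bar> \<le> \<alpha> * sqrt (card {i\<in>I. u \<le> d i}) + \<beta>"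
  shows "\<bar>\<Sum>i\<in>I. z i * d i\<bar> \<le> \<alpha> * sqrt (1 + ln N) * sqrt (\<Sum>i\<in>I. (d i)\<^sup>2) + \<beta> + card I / N"
proof -
  define U where "U l = {i\<in>I. real l / N \<le> d i}" for l :: nat
  \<comment> \<open>\<open>q i\<close> is \<open>d i\<close> rounded down to a multiple of
    \<open>1 / N\<close>, written as an average of level indicators; the rounding later costs
    \<open>card I / N\<close>.\<close>
  define q where "q i = (\<Sum>l=1..N. of_bool (real l / N \<le> d i)) / N" for i
  have finU: "finite (U l)" for l using I by (simp add: U_def)
  have q: "\<bar>d i - q i\<bar> \<le> 1 / N" if "i \<in> I" for i
  proof -
    have "N * (d i - q i) = N * d i - (\<Sum>l=1..N. of_bool (real l / N \<le> d i))"
      using N by (simp add: q_def right_diff_distrib)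
    then have "0 \<le> N * (d i - q i)" "N * (d i - q i) \<le> 1"
      using layer_counts(1,2)[OF d[OF that] N] by linarith+
    then show ?thesis using N by (simp add: zero_le_mult_iff pos_le_divide_eq mult.commute)
  qed
  have sumU: "(\<Sum>i\<in>I. h i * of_bool (real l / N \<le> d i)) = (\<Sum>i\<in>U l. h i)" for h :: "'a \<Rightarrow> real" and l
    using I by (simp add: of_bool_def if_distrib sum.If_cases U_def Int_def cong: if_cong)
  have zq: "(\<Sum>i\<in>I. z i * q i) = (\<Sum>l=1..N. \<Sum>i\<in>U l. z i) / N"
  proof -
    have "(\<Sum>i\<in>I. z i * q i) = (\<Sum>i\<in>I. \<Sum>l=1..N. z i * of_bool (real l / N \<le> d i)) / N"
      by (simp only: q_def sum_distrib_left[symmetric] sum_divide_distrib[symmetric] times_divide_eq_right)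
    also have "(\<Sum>i\<in>I. \<Sum>l=1..N. z i * of_bool (real l / N \<le> d i))
        = (\<Sum>l=1..N. \<Sum>i\<in>I. z i * of_bool (real l / N \<le> d i))" by (rule sum.swap)
    also have "\<dots> = (\<Sum>l=1..N. \<Sum>i\<in>U l. z i)" by (simp only: sumU)
    finally show ?thesis .
  qed
  have "(\<Sum>l=1..N. sqrt (card (U l)))\<^sup>2 = (\<Sum>l=1..N. sqrt (real l * card (U l)) * sqrt (1 / real l))\<^sup>2"
  proof -
    have "sqrt (card (U l)) = sqrt (real l * card (U l)) * sqrt (1 / real l)" if "l \<in> {1..N}" for l
      using that by (simp flip: real_sqrt_mult)
    then show ?thesis by (intro arg_cong[where f = "\<lambda>x. x\<^sup>2"] sum.cong refl)
  qed
  also have "\<dots> \<le> (\<Sum>l=1..N. (sqrt (real l * card (U l)))\<^sup>2) * (\<Sum>l=1..N. (sqrt (1 / real l))\<^sup>2)"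
    by (rule Cauchy_Schwarz_ineq_sum)
  also have "\<dots> = (\<Sum>l=1..N. real l * card (U l)) * (\<Sum>l=1..N. 1 / real l)"
    by simp
  also have "(\<Sum>l=1..N. real l * card (U l)) = (\<Sum>i\<in>I. \<Sum>l=1..N. real l * of_bool (real l / N \<le> d i))"
  proof -
    have "real l * card (U l) = (\<Sum>i\<in>I. real l * of_bool (real l / N \<le> d i))" for l
      by (subst sumU) simp
    then show ?thesis by (simp add: sum.swap[of _ I])
  qed
  also have "\<dots> \<le> (\<Sum>i\<in>I. (N * d i)\<^sup>2)" by (intro sum_mono layer_counts d N)
  also have "(\<Sum>l=1..N. 1 / real l) \<le> 1 + ln N" by (rule harm_le_ln[OF N])
  finally have "(\<Sum>l=1..N. sqrt (card (U l)))\<^sup>2 \<le> (\<Sum>i\<in>I. (N * d i)\<^sup>2) * (1 + ln N)"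
    by (simp add: mult_mono sum_nonneg mult_left_mono mult_right_mono)
  then have "(\<Sum>l=1..N. sqrt (card (U l))) \<le> sqrt ((\<Sum>i\<in>I. (N * d i)\<^sup>2) * (1 + ln N))"
    by (rule real_le_rsqrt)
  also have "\<dots> = N * (sqrt (1 + ln N) * sqrt (\<Sum>i\<in>I. (d i)\<^sup>2))"
    by (simp add: power_mult_distrib real_sqrt_mult flip: sum_distrib_left)
  finally have cs: "(\<Sum>l=1..N. sqrt (card (U l))) \<le> N * (sqrt (1 + ln N) * sqrt (\<Sum>i\<in>I. (d i)\<^sup>2))" .
  \<comment> \<open>The sum over \<open>N\<close> levels is divided by \<open>N\<close> in
    \<open>zq\<close>, so the additive \<open>\<beta>\<close> is paid once in total and not once per
    level.\<close>
  have "\<bar>\<Sum>l=1..N. \<Sum>i\<in>U l. z i\<bar> \<le> (\<Sum>l=1..N. \<alpha> * sqrt (card (U l)) + \<beta>)"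
  proof (rule order_trans[OF sum_abs sum_mono])
    fix l assume "l \<in> {1..N}"
    then have "0 < real l / N" using N by simp
    from lev[OF this] show "\<bar>\<Sum>i\<in>U l. z i\<bar> \<le> \<alpha> * sqrt (card (U l)) + \<beta>" by (simp add: U_def)
  qed
  also have "\<dots> = \<alpha> * (\<Sum>l=1..N. sqrt (card (U l))) + N * \<beta>" by (simp add: sum.distrib sum_distrib_left)
  also have "\<dots> \<le> \<alpha> * (N * (sqrt (1 + ln N) * sqrt (\<Sum>i\<in>I. (d i)\<^sup>2))) + N * \<beta>"
    using cs ab by (intro add_right_mono mult_left_mono)
  finally have "\<bar>\<Sum>l=1..N. \<Sum>i\<in>U l. z i\<bar>
      \<le> N * (\<alpha> * sqrt (1 + ln N) * sqrt (\<Sum>i\<in>I. (d i)\<^sup>2) + \<beta>)" by (simp add: algebra_simps)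
  then have main: "\<bar>\<Sum>i\<in>I. z i * q i\<bar> \<le> \<alpha> * sqrt (1 + ln N) * sqrt (\<Sum>i\<in>I. (d i)\<^sup>2) + \<beta>"
    unfolding zq using N by (simp add: abs_divide field_simps)
  have "\<bar>\<Sum>i\<in>I. z i * (d i - q i)\<bar> \<le> (\<Sum>i\<in>I. 1 * (1 / N))"
  proof (rule order_trans[OF sum_abs sum_mono])
    fix i assume "i \<in> I"
    then show "\<bar>z i * (d i - q i)\<bar> \<le> 1 * (1 / N)"
      unfolding abs_mult by (intro mult_mono z q) auto
  qed
  then have "\<bar>\<Sum>i\<in>I. z i * (d i - q i)\<bar> \<le> card I / N" by simp
  moreover have "(\<Sum>i\<in>I. z i * d i) = (\<Sum>i\<in>I. z i * q i) + (\<Sum>i\<in>I. z i * (d i - q i))"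
    by (simp add: algebra_simps flip: sum.distrib)
  ultimately show ?thesis using main by linarith
qed

lemma level_set_bound_signed:
  fixes z d :: "'a \<Rightarrow> real" and N :: nat
  assumes I: "finite I" and N: "N > 0"
    and d: "\<And>i. i \<in> I \<Longrightarrow> \<bar>d i\<bar> \<le> 1"
    and z: "\<And>i. i \<in> I \<Longrightarrow> \<bar>z i\<bar> \<le> 1"
    and ab: "0 \<le> \<alpha>"
    and pos: "\<And>u. \<bar>\<Sum>i\<in>{i\<in>I. u \<le> d i}. z i\<bar> \<le> \<alpha> * sqrt (card {i\<in>I. u \<le> d i}) + \<beta>"
    and neg: "\<And>u. \<bar>\<Sum>i\<in>{i\<in>I. u \<le> - d i}. z i\<bar> \<le> \<alpha> * sqrt (card {i\<in>I. u \<le> - d i}) + \<beta>"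
  shows "\<bar>\<Sum>i\<in>I. z i * d i\<bar> \<le> 2 * \<alpha> * sqrt (1 + ln N) * sqrt (\<Sum>i\<in>I. (d i)\<^sup>2) + 2 * \<beta> + 2 * card I / N"
proof -
  have part: "\<bar>\<Sum>i\<in>I. z i * max (h i) 0\<bar>
      \<le> \<alpha> * sqrt (1 + ln N) * sqrt (\<Sum>i\<in>I. (d i)\<^sup>2) + \<beta> + card I / N"
    if h: "\<And>i. h i = d i \<or> h i = - d i"
      and lev: "\<And>u. \<bar>\<Sum>i\<in>{i\<in>I. u \<le> h i}. z i\<bar> \<le> \<alpha> * sqrt (card {i\<in>I. u \<le> h i}) + \<beta>" for h
  proof -
    have "\<bar>\<Sum>i\<in>I. z i * max (h i) 0\<bar>
      \<le> \<alpha> * sqrt (1 + ln N) * sqrt (\<Sum>i\<in>I. (max (h i) 0)\<^sup>2) + \<beta> + card I / N"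
    proof (intro level_set_bound I N z ab)
      fix u :: real assume u: "u > 0"
      \<comment> \<open>Positive thresholds do not see the truncation at 0, so the level sets of the
        positive part are level sets of \<open>h\<close> itself. Treating the positive and the
        negative part of \<open>d\<close> in this way gives the factors 2.\<close>
      then have "{i\<in>I. u \<le> max (h i) 0} = {i\<in>I. u \<le> h i}" by auto
      then show "\<bar>\<Sum>i\<in>{i\<in>I. u \<le> max (h i) 0}. z i\<bar> \<le> \<alpha> * sqrt (card {i\<in>I. u \<le> max (h i) 0}) + \<beta>"
        using lev by simp
    next
      fix i assume "i \<in> I"
      then show "max (h i) 0 \<le> 1" using d[of i] h[of i] by (auto simp: abs_le_iff)
    qed auto
    also have "sqrt (\<Sum>i\<in>I. (max (h i) 0)\<^sup>2) \<le> sqrt (\<Sum>i\<in>I. (d i)\<^sup>2)"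
    proof (intro real_sqrt_le_mono sum_mono)
      fix i show "(max (h i) 0)\<^sup>2 \<le> (d i)\<^sup>2" using h[of i] by (auto simp: max_def)
    qed
    finally show ?thesis using ab N by (simp add: mult_left_mono)
  qed
  have "(\<Sum>i\<in>I. z i * d i) = (\<Sum>i\<in>I. z i * max (d i) 0) - (\<Sum>i\<in>I. z i * max (- d i) 0)"
    unfolding sum_subtractf[symmetric] by (intro sum.cong) (auto simp: max_def)
  then show ?thesis using part[of d, OF _ pos] part[of "\<lambda>i. - d i", OF _ neg] by force
qed

section \<open>Existence of the projection\<close>

lemma continuous_on_entry: "continuous_on S (\<lambda>M :: rmat. M i j)"
proof -
  have "continuous_on S (\<lambda>M :: rmat. M i)"
    by (rule continuous_on_product_then_coordinatewise[OF continuous_on_id, unfolded id_def])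
  then show ?thesis by (rule continuous_on_product_then_coordinatewise)
qed

lemma compact_Pi_UNIV:
  fixes K :: "'i \<Rightarrow> 'a::topological_space set"
  assumes "\<And>i. compact (K i)"
  shows "compact {f. \<forall>i. f i \<in> K i}"
proof -
  have "compactin (product_topology (\<lambda>i::'i. euclidean) UNIV) (PiE UNIV K)"
    using assms by (simp add: compactin_PiE)
  moreover have "PiE UNIV K = {f. \<forall>i. f i \<in> K i}" by (auto simp: PiE_def)
  ultimately show ?thesis by (simp add: euclidean_product_topology)
qed

lemma ordered_matrices_unit: "ordered_matrices m n \<subseteq> unit_matrices n"
  by (cases m) (auto simp: tournament_matrices_def graph_matrices_def)

text \<open>Matrices are functions on an infinite index set, where closed and bounded is not enough.
  Their entries lie in the unit interval everywhere, also outside the index range, so Tychonoff's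
  theorem gives a compact cube; each defining condition is closed because evaluation at an entry is
  continuous.\<close>

lemma compact_ordered_matrices: "compact (ordered_matrices m n)"
proof -
  have "compact {M :: rmat. \<forall>i. M i \<in> {f. \<forall>j. f j \<in> {0..1}}}"
    by (intro compact_Pi_UNIV) simp
  moreover have "closed (ordered_matrices m n)"
  proof -
    have cl: "closed {M :: rmat. P \<longrightarrow> Q M}" if "closed {M. Q M}" for P Q
      using that by (cases P) auto
    note ins = closed_Collect_conj closed_Collect_all cl closed_Collect_le closed_Collect_eq
      continuous_on_entry continuous_intros
    show ?thesis
    proof (cases m)
      case Tournament
      show ?thesis
        unfolding Tournament ordered_matrices.simps tournament_matrices_def unit_matrices_def Ball_def mem_Collect_eq
        by (intro ins)
    next
      case Graph
      show ?thesis
        unfolding Graph ordered_matrices.simps graph_matrices_def unit_matrices_def Ball_def mem_Collect_eq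
        by (intro ins)
    qed
  qed
  ultimately have "compact ({M :: rmat. \<forall>i. M i \<in> {f. \<forall>j. f j \<in> {0..1}}} \<inter> ordered_matrices m n)"
    by (rule compact_Int_closed)
  moreover have "ordered_matrices m n \<subseteq> {M :: rmat. \<forall>i. M i \<in> {f. \<forall>j. f j \<in> {0..1}}}"
  proof
    fix M assume "M \<in> ordered_matrices m n"
    then have M: "M \<in> unit_matrices n" using ordered_matrices_unit by blast
    have "0 \<le> M i j \<and> M i j \<le> 1" for i j
      using M by (cases "i \<in> {1..n} \<and> j \<in> {1..n}") (auto simp: unit_matrices_def)
    then show "M \<in> {M :: rmat. \<forall>i. M i \<in> {f. \<forall>j. f j \<in> {0..1}}}" by auto
  qed
  ultimately show ?thesis by (simp add: Int_absorb1)
qed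

lemma frob_norm_sq: "(frob_norm n A)\<^sup>2 = (\<Sum>i=1..n. \<Sum>j=1..n. (A i j)\<^sup>2)"
  by (simp add: frob_norm_def L2_set_def sum_nonneg sum.cartesian_product case_prod_unfold)

text \<open>\<open>proj\<close> is a choice of minimiser, about which nothing is known until the
  minimum is shown to be attained. \<open>B\<close> provides nonemptiness as well as the
  competitor.\<close>

lemma proj_minimal:
  assumes "B \<in> ordered_matrices m n"
  shows "proj n (ordered_matrices m n) A \<in> ordered_matrices m n"
    and "frob_norm n (\<lambda>i j. A i j - proj n (ordered_matrices m n) A i j) \<le> frob_norm n (\<lambda>i j. A i j - B i j)"
proof -
  let ?f = "\<lambda>M. frob_norm n (\<lambda>i j. A i j - M i j)"
  let ?K = "ordered_matrices m n"
  have "continuous_on ?K ?f"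
    unfolding frob_norm_def L2_set_def case_prod_unfold
    by (intro continuous_intros continuous_on_entry)
  then obtain M where M: "M \<in> ?K" "\<forall>N\<in>?K. ?f M \<le> ?f N"
    using continuous_attains_inf[OF compact_ordered_matrices] assms by blast
  have "is_arg_min ?f (\<lambda>M. M \<in> ?K) (arg_min ?f (\<lambda>M. M \<in> ?K))"
    using M by (intro arg_minI[where P = "\<lambda>M. M \<in> ?K" and Q = "is_arg_min ?f (\<lambda>M. M \<in> ?K)", of M])
       (auto simp: is_arg_min_linorder not_less)
  then have "is_arg_min ?f (\<lambda>M. M \<in> ?K) (proj n ?K A)"
    by (simp add: proj_def arg_min_on_def)
  then show "proj n ?K A \<in> ?K" "?f (proj n ?K A) \<le> ?f B"
    using assms by (auto simp: is_arg_min_linorder)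
qed

lemma frob_norm_minimal_ineq:
  assumes "frob_norm n (\<lambda>i j. Y i j - P i j) \<le> frob_norm n (\<lambda>i j. Y i j - A i j)"
  shows "(frob_norm n (\<lambda>i j. P i j - A i j))\<^sup>2
    \<le> 2 * (\<Sum>i=1..n. \<Sum>j=1..n. (Y i j - A i j) * (P i j - A i j))"
proof -
  have "(frob_norm n (\<lambda>i j. Y i j - P i j))\<^sup>2 \<le> (frob_norm n (\<lambda>i j. Y i j - A i j))\<^sup>2"
    using assms by (intro power_mono) (auto simp: frob_norm_def)
  moreover have "(frob_norm n (\<lambda>i j. Y i j - P i j))\<^sup>2 = (frob_norm n (\<lambda>i j. Y i j - A i j))\<^sup>2
      + (frob_norm n (\<lambda>i j. P i j - A i j))\<^sup>2 - 2 * (\<Sum>i=1..n. \<Sum>j=1..n. (Y i j - A i j) * (P i j - A i j))"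
    unfolding frob_norm_sq sum_distrib_left sum.distrib[symmetric] sum_subtractf[symmetric]
    by (intro sum.cong refl) (simp add: power2_eq_square algebra_simps)
  ultimately show ?thesis by linarith
qed

section \<open>Ordered matrices and sorting\<close>

definition off_diag :: "nat \<Rightarrow> (nat \<times> nat) set" where
  "off_diag n = {(i, j). i \<in> {1..n} \<and> j \<in> {1..n} \<and> i \<noteq> j}"

lemma finite_off_diag [simp]: "finite (off_diag n)"
  by (rule finite_subset[of _ "{1..n} \<times> {1..n}"]) (auto simp: off_diag_def)

lemma card_off_diag_le: "real (card (off_diag n)) \<le> (real n)\<^sup>2"
proof -
  have "card (off_diag n) \<le> card ({1..n} \<times> {1..n})"
    by (rule card_mono) (auto simp: off_diag_def)
  then have "real (card (off_diag n)) \<le> real (card ({1..n} \<times> {1..n}))" by linarith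
  then show ?thesis by (simp add: power2_eq_square)
qed

lemma tournament_matricesD:
  assumes "M \<in> tournament_matrices n"
  shows "M \<in> unit_matrices n"
    and "\<lbrakk>i \<in> {1..n}; j \<in> {1..n}; k \<in> {1..n}; i \<noteq> k; i \<noteq> j; k < j\<rbrakk> \<Longrightarrow> M i j \<le> M i k"
    and "\<lbrakk>i \<in> {1..n}; j \<in> {1..n}; i \<noteq> j\<rbrakk> \<Longrightarrow> M j i = 1 - M i j"
    and "i \<in> {1..n} \<Longrightarrow> M i i = 0"
    and "\<lbrakk>i \<in> {1..n}; j \<in> {1..n}; i < j\<rbrakk> \<Longrightarrow> M i j \<le> 1/2"
  using assms unfolding tournament_matrices_def by blast+

lemma graph_matricesD:
  assumes "M \<in> graph_matrices n"
  shows "M \<in> unit_matrices n"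
    and "\<lbrakk>i \<in> {1..n}; j \<in> {1..n}; k \<in> {1..n}; i \<noteq> k; i \<noteq> j; j < k\<rbrakk> \<Longrightarrow> M i j \<le> M i k"
    and "\<lbrakk>i \<in> {1..n}; j \<in> {1..n}; i \<noteq> j\<rbrakk> \<Longrightarrow> M j i = M i j"
    and "i \<in> {1..n} \<Longrightarrow> M i i = 0"
  using assms unfolding graph_matrices_def by blast+

lemma ordered_matricesD:
  assumes "M \<in> ordered_matrices m n"
  shows "i \<notin> {1..n} \<or> j \<notin> {1..n} \<Longrightarrow> M i j = 0"
    and "0 \<le> M i j" "M i j \<le> 1"
    and "M i i = 0"
    and "(i, j) \<in> off_diag n \<Longrightarrow> M j i = reflect_entry m (M i j)"
proof -
  have u: "M \<in> unit_matrices n"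
    using assms by (cases m) (auto dest: tournament_matricesD(1) graph_matricesD(1))
  show out: "M i j = 0" if "i \<notin> {1..n} \<or> j \<notin> {1..n}" for i j
    using u that by (auto simp: unit_matrices_def)
  have "0 \<le> M i j \<and> M i j \<le> 1"
  proof (cases "i \<in> {1..n} \<and> j \<in> {1..n}")
    case True
    then show ?thesis using u by (simp add: unit_matrices_def)
  qed (use out in auto)
  then show "0 \<le> M i j" "M i j \<le> 1" by auto
  show "M i i = 0"
    using assms out[of i i] tournament_matricesD(4)[of M n i] graph_matricesD(4)[of M n i]
    by (cases m; cases "i \<in> {1..n}") auto
  show "M j i = reflect_entry m (M i j)" if "(i, j) \<in> off_diag n"
    using assms that tournament_matricesD(3)[of M n i j] graph_matricesD(3)[of M n i j]
    by (cases m) (auto simp: off_diag_def)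
qed

lemma graph_rowD:
  assumes "M \<in> graph_matrices n" "i \<in> {1..n}" "j \<in> {1..n}" "k \<in> {1..n}" "i \<noteq> j" "i \<noteq> k" "j \<le> k"
  shows "M i j \<le> M i k"
  using assms graph_matricesD(2)[of M n i j k] by (cases "j = k") auto

lemma tournament_rowD:
  assumes "M \<in> tournament_matrices n" "i \<in> {1..n}" "j \<in> {1..n}" "k \<in> {1..n}" "i \<noteq> j" "i \<noteq> k" "k \<le> j"
  shows "M i j \<le> M i k"
  using assms tournament_matricesD(2)[of M n i j k] by (cases "j = k") auto

text \<open>
  The order conditions skip the diagonal; filling it in suitably makes the matrix monotone in both
  indices. Columns of the tournament model are read in reverse.
\<close>

fun fill_diag :: "model \<Rightarrow> rmat \<Rightarrow> rmat" where
  "fill_diag Tournament M i j = (if i = j then 1/2 else M i j)"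
| "fill_diag Graph M i j = (if i = j then (if i \<le> 1 then 0 else M i (i - 1)) else M i j)"

fun col_key :: "model \<Rightarrow> nat \<Rightarrow> int" where
  "col_key Tournament j = - int j"
| "col_key Graph j = int j"

lemma fill_diag_off [simp]: "i \<noteq> j \<Longrightarrow> fill_diag m M i j = M i j"
  by (cases m) auto

text \<open>The value 1/2 separates the row: entries right of the diagonal are at most 1/2 by
  assumption, those to the left at least 1/2 by reflection.\<close>

lemma fill_diag_tournament_row:
  assumes M: "M \<in> tournament_matrices n" and "i \<in> {1..n}" "j \<in> {1..n}" "k \<in> {1..n}" "k \<le> j"
  shows "fill_diag Tournament M i j \<le> fill_diag Tournament M i k"
proof (cases "i = j \<or> i = k")
  case False
  then show ?thesis using tournament_rowD[OF M] assms by simp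
next
  case True
  have half: "M a b \<le> 1/2" if "a \<in> {1..n}" "b \<in> {1..n}" "a < b" for a b
    using tournament_matricesD(5)[OF M] that .
  have refl: "M a b = 1 - M b a" if "a \<in> {1..n}" "b \<in> {1..n}" "a \<noteq> b" for a b
    using tournament_matricesD(3)[OF M, of b a] that by simp
  show ?thesis
  proof (cases "j = k")
    case False
    then have "k < j" using assms by simp
    then show ?thesis
      using True half[of i j] half[of k i] refl[of i k] assms False by auto
  qed simp
qed

lemma fill_diag_tournament_swap:
  assumes "M \<in> tournament_matrices n" "i \<in> {1..n}" "j \<in> {1..n}"
  shows "fill_diag Tournament M i j = 1 - fill_diag Tournament M j i"
  using assms tournament_matricesD(3)[OF assms(1), of j i] by auto

text \<open>The diagonal takes the value of its left neighbour, which bounds the entries on the left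
  and is bounded by those on the right. For \<open>i = 1\<close> there is no neighbour, and 0 serves
  because entries are nonnegative.\<close>

lemma fill_diag_graph_row:
  assumes M: "M \<in> graph_matrices n" and "i \<in> {1..n}" "j \<in> {1..n}" "k \<in> {1..n}" "j \<le> k"
  shows "fill_diag Graph M i j \<le> fill_diag Graph M i k"
proof (cases "i = j \<or> i = k")
  case False
  then show ?thesis using graph_rowD[OF M] assms by simp
next
  case True
  have pos: "0 \<le> M a b" for a b
    using ordered_matricesD(2)[of M Graph n] M by simp
  show ?thesis
  proof (cases "j = k")
    case False
    then have jk: "j < k" using assms by simp
    show ?thesis
    proof (cases "i = j")
      case True
      then show ?thesis using jk pos graph_rowD[OF M, of i "i - 1" k] assms by auto
    next
      case False
      then have "i = k" using True by simp
      then show ?thesis using jk False graph_rowD[OF M, of i j "i - 1"] assms by auto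
    qed
  qed simp
qed

lemma fill_diag_graph_swap:
  assumes "M \<in> graph_matrices n" "i \<in> {1..n}" "j \<in> {1..n}"
  shows "fill_diag Graph M i j = fill_diag Graph M j i"
  using assms graph_matricesD(3)[OF assms(1), of j i] by auto

text \<open>Monotonicity in the row index is monotonicity along rows, transported through the
  reflection at the diagonal. In the tournament model the reflection reverses the order, which
  matches the reversed column key.\<close>

lemma fill_diag_mono:
  assumes M: "M \<in> ordered_matrices m n"
    and ij: "i \<in> {1..n}" "j \<in> {1..n}" "i' \<in> {1..n}" "j' \<in> {1..n}"
    and le: "i \<le> i'" "col_key m j \<le> col_key m j'"
  shows "fill_diag m M i j \<le> fill_diag m M i' j'"
proof (cases m)
  case Tournament
  note [simp del] = fill_diag.simps
  have T: "M \<in> tournament_matrices n" using M Tournament by simp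
  have "fill_diag m M i j \<le> fill_diag m M i' j"
    using fill_diag_tournament_row[OF T, of j i' i] fill_diag_tournament_swap[OF T, of i j]
      fill_diag_tournament_swap[OF T, of i' j] ij le Tournament by simp
  also have "\<dots> \<le> fill_diag m M i' j'"
    using fill_diag_tournament_row[OF T, of i' j j'] ij le Tournament by simp
  finally show ?thesis .
next
  case Graph
  note [simp del] = fill_diag.simps
  have T: "M \<in> graph_matrices n" using M Graph by simp
  have "fill_diag m M i j \<le> fill_diag m M i' j"
    using fill_diag_graph_row[OF T, of j i i'] fill_diag_graph_swap[OF T, of i j]
      fill_diag_graph_swap[OF T, of i' j] ij le Graph by simp
  also have "\<dots> \<le> fill_diag m M i' j'"
    using fill_diag_graph_row[OF T, of i' j j'] ij le Graph by simp
  finally show ?thesis .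
qed

section \<open>Counting level sets\<close>

definition level_sets :: "model \<Rightarrow> nat \<Rightarrow> rmat \<Rightarrow> (nat \<times> nat) set set" where
  "level_sets m n A = {U. \<exists>M\<in>ordered_matrices m n. \<exists>u.
     U = {(i, j) \<in> off_diag n. u \<le> M i j - A i j} \<or> U = {(i, j) \<in> off_diag n. u \<le> A i j - M i j}}"

text \<open>On a cell \<open>S q\<close> the matrix \<open>A\<close> is constant, so a level set of
  \<open>M - A\<close> is there a level set of the monotone \<open>fill_diag m M\<close>, that is,
  the trace on \<open>S q\<close> of an up-closed subset of the rectangle
  \<open>C q \<times> D q\<close>. Cells may have any shape inside their rectangles; only the side
  lengths enter the count. Blocks and roundings are the two instances.\<close>

lemma card_level_sets:
  fixes C D :: "'q \<Rightarrow> nat set" and S :: "'q \<Rightarrow> (nat \<times> nat) set"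
  assumes Q: "finite Q"
    and C: "\<And>q. q \<in> Q \<Longrightarrow> C q \<subseteq> {1..n}" and D: "\<And>q. q \<in> Q \<Longrightarrow> D q \<subseteq> {1..n}"
    and S: "\<And>q. q \<in> Q \<Longrightarrow> S q \<subseteq> C q \<times> D q" and cov: "(\<Union>q\<in>Q. S q) = off_diag n"
    and A: "\<And>q i j. q \<in> Q \<Longrightarrow> (i, j) \<in> S q \<Longrightarrow> A i j = v q"
  shows "finite (level_sets m n A)"
    and "card (level_sets m n A) \<le> 2 * 2 ^ (\<Sum>q\<in>Q. card (C q) + card (D q))"
proof -
  \<comment> \<open>The sign \<open>s = 1\<close> encodes thresholds of \<open>M - A\<close>, and
    \<open>s = -1\<close>, reversing both orders, those of \<open>A - M\<close>.\<close>
  define F where "F s = (\<lambda>T. \<Union>q\<in>Q. S q \<inter> T q) `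
      (PiE Q (\<lambda>q. upsets (\<lambda>i. s * int i) (\<lambda>j. s * col_key m j) (C q) (D q)))" for s :: int
  have finCD: "finite (C q)" "finite (D q)" if "q \<in> Q" for q
    using C[OF that] D[OF that] finite_subset by auto
  have finF: "finite (F s)" for s
    unfolding F_def using Q finCD by (intro finite_imageI finite_PiE finite_upsets) auto
  have cardF: "card (F s) \<le> 2 ^ (\<Sum>q\<in>Q. card (C q) + card (D q))" for s
  proof -
    have "card (F s) \<le> card (PiE Q (\<lambda>q. upsets (\<lambda>i. s * int i) (\<lambda>j. s * col_key m j) (C q) (D q)))"
      unfolding F_def using Q finCD by (intro card_image_le finite_PiE finite_upsets) auto
    also have "\<dots> = (\<Prod>q\<in>Q. card (upsets (\<lambda>i. s * int i) (\<lambda>j. s * col_key m j) (C q) (D q)))"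
      using Q by (rule card_PiE)
    also have "\<dots> \<le> (\<Prod>q\<in>Q. 2 ^ (card (C q) + card (D q)))"
      using finCD by (intro prod_mono conjI card_upsets) auto
    also have "\<dots> = 2 ^ (\<Sum>q\<in>Q. card (C q) + card (D q))" by (simp add: power_sum)
    finally show ?thesis .
  qed
  have sub: "level_sets m n A \<subseteq> F 1 \<union> F (- 1)"
  proof
    fix U assume "U \<in> level_sets m n A"
    then obtain M u where M: "M \<in> ordered_matrices m n"
      and U: "U = {(i, j) \<in> off_diag n. u \<le> M i j - A i j} \<or> U = {(i, j) \<in> off_diag n. u \<le> A i j - M i j}"
      by (auto simp: level_sets_def)
    have mono: "fill_diag m M i j \<le> fill_diag m M i' j'"
      if "q \<in> Q" "i \<in> C q" "j \<in> D q" "i' \<in> C q" "j' \<in> D q" "i \<le> i'" "col_key m j \<le> col_key m j'"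
      for q i j i' j'
      using C[OF that(1)] D[OF that(1)] that by (intro fill_diag_mono[OF M]) blast+
    have SM: "fill_diag m M i j = M i j" "A i j = v q" "i \<in> C q" "j \<in> D q" if "q \<in> Q" "(i, j) \<in> S q" for q i j
    proof -
      have "(i, j) \<in> off_diag n" using cov that by blast
      then show "fill_diag m M i j = M i j" by (simp add: off_diag_def)
    qed (use A[OF that] S[OF that(1)] that(2) in auto)
    from U show "U \<in> F 1 \<union> F (- 1)"
    proof
      assume U: "U = {(i, j) \<in> off_diag n. u \<le> M i j - A i j}"
      \<comment> \<open>The threshold is imposed on the whole rectangle, diagonal included, where
        \<open>fill_diag\<close> makes it up-closed; intersecting with \<open>S q\<close> removes
        the artificial entries.\<close>
      define T where "T = restrict (\<lambda>q. {(i, j) \<in> C q \<times> D q. u \<le> fill_diag m M i j - v q}) Q"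
      have "T q \<in> upsets (\<lambda>i. 1 * int i) (\<lambda>j. 1 * col_key m j) (C q) (D q)" if q: "q \<in> Q" for q
        unfolding T_def upsets_def by (auto simp: q intro: order_trans[OF _ diff_right_mono[OF mono[OF q]]])
      then have "T \<in> PiE Q (\<lambda>q. upsets (\<lambda>i. 1 * int i) (\<lambda>j. 1 * col_key m j) (C q) (D q))"
        by (intro PiE_I) (auto simp: T_def)
      moreover have "U = (\<Union>q\<in>Q. S q \<inter> T q)"
        unfolding U cov[symmetric] T_def by (auto simp: SM)
      ultimately show ?thesis unfolding F_def by blast
    next
      assume U: "U = {(i, j) \<in> off_diag n. u \<le> A i j - M i j}"
      define T where "T = restrict (\<lambda>q. {(i, j) \<in> C q \<times> D q. u \<le> v q - fill_diag m M i j}) Q"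
      have "T q \<in> upsets (\<lambda>i. (-1) * int i) (\<lambda>j. (-1) * col_key m j) (C q) (D q)" if q: "q \<in> Q" for q
        unfolding T_def upsets_def by (auto simp: q intro: order_trans[OF _ diff_left_mono[OF mono[OF q]]])
      then have "T \<in> PiE Q (\<lambda>q. upsets (\<lambda>i. (-1) * int i) (\<lambda>j. (-1) * col_key m j) (C q) (D q))"
        by (intro PiE_I) (auto simp: T_def)
      moreover have "U = (\<Union>q\<in>Q. S q \<inter> T q)"
        unfolding U cov[symmetric] T_def by (auto simp: SM)
      ultimately show ?thesis unfolding F_def by blast
    qed
  qed
  show "finite (level_sets m n A)" using sub finF finite_subset by blast
  have "card (level_sets m n A) \<le> card (F 1 \<union> F (- 1))" using sub finF by (intro card_mono) auto
  also have "\<dots> \<le> card (F 1) + card (F (- 1))" by (rule card_Un_le)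
  also have "\<dots> \<le> 2 * 2 ^ (\<Sum>q\<in>Q. card (C q) + card (D q))"
    using cardF[of 1] cardF[of "-1"] by simp
  finally show "card (level_sets m n A) \<le> 2 * 2 ^ (\<Sum>q\<in>Q. card (C q) + card (D q))" .
qed

section \<open>Stability of sorting and comparison of rows\<close>

lemma sorted_compare:
  fixes f g :: "nat \<Rightarrow> real"
  assumes \<sigma>: "\<sigma> permutes {1..n}" and \<tau>: "\<tau> permutes {1..n}"
    and f: "mono_on {1..n} (\<lambda>i. f (\<sigma> i))" and g: "mono_on {1..n} (\<lambda>i. g (\<tau> i))"
    and le: "\<And>a. a \<in> {1..n} \<Longrightarrow> g a \<le> f a + x" and i: "i \<in> {1..n}"
  shows "g (\<tau> i) \<le> f (\<sigma> i) + x"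
proof -
  \<comment> \<open>Pigeonhole: the last \<open>n - i + 1\<close> places of \<open>\<tau>\<close>
    and the first \<open>i\<close> places of \<open>\<sigma>\<close> together claim
    \<open>n + 1\<close> indices out of \<open>n\<close>. A common index lies weakly above
    \<open>\<tau> i\<close> in the order of \<open>g\<close> and weakly below
    \<open>\<sigma> i\<close> in that of \<open>f\<close>.\<close>
  have "\<tau> ` {i..n} \<inter> \<sigma> ` {1..i} \<noteq> {}"
  proof
    assume dj: "\<tau> ` {i..n} \<inter> \<sigma> ` {1..i} = {}"
    have "card (\<tau> ` {i..n} \<union> \<sigma> ` {1..i}) = card (\<tau> ` {i..n}) + card (\<sigma> ` {1..i})"
      using dj by (intro card_Un_disjoint) auto
    also have "\<dots> = n + 1"
      using i by (simp add: card_image permutes_inj_on[OF \<sigma>] permutes_inj_on[OF \<tau>])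
    finally have "n + 1 = card (\<tau> ` {i..n} \<union> \<sigma> ` {1..i})" ..
    also have "\<dots> \<le> card {1..n}"
    proof (rule card_mono)
      show "\<tau> ` {i..n} \<union> \<sigma> ` {1..i} \<subseteq> {1..n}"
        using i permutes_in_image[OF \<sigma>] permutes_in_image[OF \<tau>] by force
    qed simp
    finally show False by simp
  qed
  then obtain l k where lk: "l \<in> {i..n}" "k \<in> {1..i}" "\<tau> l = \<sigma> k" by blast
  have "g (\<tau> i) \<le> g (\<tau> l)" using lk i by (intro mono_onD[OF g]) auto
  also have "\<dots> \<le> f (\<sigma> k) + x" using le[of "\<sigma> k"] lk i permutes_in_image[OF \<sigma>, of k] by auto
  also have "f (\<sigma> k) \<le> f (\<sigma> i)" using lk i by (intro mono_onD[OF f]) auto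
  finally show ?thesis by simp
qed

lemma ordered_rows_mono:
  assumes M: "M \<in> ordered_matrices m n" and "a \<in> {1..n}" "b \<in> {1..n}" "a \<le> b" "j \<in> {1..n} - {a, b}"
  shows "M a j \<le> M b j"
  using fill_diag_mono[OF M, of a j b j] assms by auto

lemma row_sum_split:
  assumes "M i i = 0" "M j j = 0" "i \<in> {1..n}" "j \<in> {1..n}" "i \<noteq> j"
  shows "row_sum n M i = (\<Sum>k\<in>{1..n} - {i, j}. M i k) + M i j"
proof -
  have "row_sum n M i = (\<Sum>k\<in>{1..n} - {i, j}. M i k) + (\<Sum>k\<in>{i, j}. M i k)"
    unfolding row_sum_def using assms by (intro sum.subset_diff) auto
  then show ?thesis using assms by simp
qed

lemma ordered_row_sum_mono:
  assumes M: "M \<in> ordered_matrices m n"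
  shows "mono_on {1..n} (row_sum n M)"
proof (rule mono_onI)
  fix i j assume ij: "i \<in> {1..n}" "j \<in> {1..n}" "i \<le> j"
  show "row_sum n M i \<le> row_sum n M j"
  proof (cases "i = j")
    case False
    \<comment> \<open>Rows \<open>i\<close> and \<open>j\<close> are comparable in all columns
      except \<open>i\<close> and \<open>j\<close>, where one entry of each row is a diagonal zero.
      What remains is \<open>M i j\<close> against \<open>M j i\<close>: equal for graphs, and on
      the two sides of 1/2 for tournaments.\<close>
    have le: "M i j \<le> M j i"
      using M ij False tournament_matricesD(3,5)[of M n i j] graph_matricesD(3)[of M n i j]
      by (cases m) auto
    have "row_sum n M i = (\<Sum>k\<in>{1..n} - {i, j}. M i k) + M i j"
      using ordered_matricesD(4)[OF M] ij False by (intro row_sum_split) auto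
    also have "\<dots> \<le> (\<Sum>k\<in>{1..n} - {i, j}. M j k) + M j i"
      using ordered_rows_mono[OF M] ij le by (intro add_mono sum_mono) auto
    also have "\<dots> = row_sum n M j"
      using ordered_matricesD(4)[OF M] ij False row_sum_split[of M j i n] by (simp add: insert_commute)
    finally show ?thesis .
  qed simp
qed

lemma row_sum_perm:
  assumes "\<pi> permutes {1..n}"
  shows "row_sum n (M \<odot> \<pi>) a = row_sum n M (\<pi> a)"
  unfolding row_sum_def mat_perm_def using sum.permute[OF assms, of "\<lambda>j. M (\<pi> a) j"] by (simp add: o_def)

lemma ThetaE:
  assumes "\<theta> \<in> Theta m n"
  obtains \<theta>\<^sub>0 \<pi> where "\<theta>\<^sub>0 \<in> ordered_matrices m n" "\<pi> permutes {1..n}" "\<theta> = \<theta>\<^sub>0 \<odot> \<pi>"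
  using assms by (auto simp: Theta_def)

lemma ThetaD:
  assumes "\<theta> \<in> Theta m n"
  shows "0 \<le> \<theta> i j" "\<theta> i j \<le> 1" "\<theta> i i = 0"
    and "(i, j) \<in> off_diag n \<Longrightarrow> \<theta> j i = reflect_entry m (\<theta> i j)"
proof -
  obtain \<theta>\<^sub>0 \<pi> where t: "\<theta>\<^sub>0 \<in> ordered_matrices m n" and \<pi>: "\<pi> permutes {1..n}" and [simp]: "\<theta> = \<theta>\<^sub>0 \<odot> \<pi>"
    using assms by (rule ThetaE)
  note D = ordered_matricesD[OF t]
  show "0 \<le> \<theta> i j" "\<theta> i j \<le> 1" "\<theta> i i = 0" using D by (simp_all add: mat_perm_def)
  assume "(i, j) \<in> off_diag n"
  then have "(\<pi> i, \<pi> j) \<in> off_diag n"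
    using permutes_in_image[OF \<pi>] permutes_inj[OF \<pi>] by (auto simp: off_diag_def inj_def)
  then show "\<theta> j i = reflect_entry m (\<theta> i j)" using D by (simp add: mat_perm_def)
qed

text \<open>Two rows of \<open>\<theta>\<close> are ordered entry by entry outside the columns
  \<open>a\<close> and \<open>b\<close>, so the L1 distance there is a plain difference of sums. The
  extra 1 covers the entries \<open>\<theta> a b\<close> and \<open>\<theta> b a\<close>.\<close>

lemma row_distance_l1:
  assumes \<theta>: "\<theta> \<in> Theta m n" and ab: "a \<in> {1..n}" "b \<in> {1..n}"
  shows "(\<Sum>j\<in>{1..n} - {a, b}. \<bar>\<theta> a j - \<theta> b j\<bar>) \<le> \<bar>row_sum n \<theta> a - row_sum n \<theta> b\<bar> + 1"
proof -
  obtain \<theta>\<^sub>0 \<pi> where t: "\<theta>\<^sub>0 \<in> ordered_matrices m n" and \<pi>: "\<pi> permutes {1..n}" and e: "\<theta> = \<theta>\<^sub>0 \<odot> \<pi>"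
    using \<theta> by (rule ThetaE)
  have main: "(\<Sum>j\<in>{1..n} - {a, b}. \<bar>\<theta> a j - \<theta> b j\<bar>) \<le> \<bar>row_sum n \<theta> a - row_sum n \<theta> b\<bar> + 1"
    if ab: "a \<in> {1..n}" "b \<in> {1..n}" "\<pi> a \<le> \<pi> b" "a \<noteq> b" for a b
  proof -
    have le: "\<theta> a j \<le> \<theta> b j" if "j \<in> {1..n} - {a, b}" for j
      unfolding e mat_perm_def
      using that ab permutes_in_image[OF \<pi>] permutes_inj[OF \<pi>]
      by (intro ordered_rows_mono[OF t]) (auto simp: inj_def)
    have "(\<Sum>j\<in>{1..n} - {a, b}. \<bar>\<theta> a j - \<theta> b j\<bar>) = (\<Sum>j\<in>{1..n} - {a, b}. \<theta> b j - \<theta> a j)"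
      using le by (intro sum.cong refl) auto
    also have "\<dots> = (row_sum n \<theta> b - \<theta> b a) - (row_sum n \<theta> a - \<theta> a b)"
      using row_sum_split[of \<theta> a b n] row_sum_split[of \<theta> b a n] ThetaD(3)[OF \<theta>] ab
      by (simp add: sum_subtractf insert_commute)
    also have "\<dots> \<le> \<bar>row_sum n \<theta> a - row_sum n \<theta> b\<bar> + 1"
      using ThetaD(1)[OF \<theta>, of b a] ThetaD(2)[OF \<theta>, of a b] by linarith
    finally show ?thesis .
  qed
  consider "a = b" | "\<pi> a \<le> \<pi> b" "a \<noteq> b" | "\<pi> b \<le> \<pi> a" "b \<noteq> a" by linarith
  then show ?thesis
  proof cases
    case 3
    then show ?thesis using main[of b a] ab by (simp add: insert_commute abs_minus_commute)
  qed (use main[of a b] ab in auto)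
qed

section \<open>Squared distance of rows and the cost of a wrong permutation\<close>

definition row_gap :: "nat \<Rightarrow> rmat \<Rightarrow> nat \<Rightarrow> nat \<Rightarrow> real" where
  "row_gap n \<theta> a b = (\<Sum>j\<in>{1..n} - {a, b}. (\<theta> a j - \<theta> b j)\<^sup>2)"

lemma row_gap_le_l1:
  assumes \<theta>: "\<theta> \<in> Theta m n"
  shows "row_gap n \<theta> a b \<le> (\<Sum>j\<in>{1..n} - {a, b}. \<bar>\<theta> a j - \<theta> b j\<bar>)"
  unfolding row_gap_def
proof (rule sum_mono)
  fix j
  have "\<bar>\<theta> a j - \<theta> b j\<bar> \<le> 1" using ThetaD(1,2)[OF \<theta>, of a j] ThetaD(1,2)[OF \<theta>, of b j] by linarith
  then have "\<bar>\<theta> a j - \<theta> b j\<bar> * \<bar>\<theta> a j - \<theta> b j\<bar> \<le> 1 * \<bar>\<theta> a j - \<theta> b j\<bar>" by (rule mult_right_mono) simp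
  then show "(\<theta> a j - \<theta> b j)\<^sup>2 \<le> \<bar>\<theta> a j - \<theta> b j\<bar>" by (simp add: power2_eq_square)
qed

lemma sum_le_off_two:
  fixes h :: "nat \<Rightarrow> real"
  assumes "\<And>j. h j \<le> 1" "\<And>j. 0 \<le> h j"
  shows "(\<Sum>j=1..n. h j) \<le> 2 + (\<Sum>j\<in>{1..n} - {a, b}. h j)"
proof -
  have "(\<Sum>j=1..n. h j) \<le> (\<Sum>j\<in>({1..n} - {a, b}) \<union> {a, b}. h j)"
    using assms by (intro sum_mono2) auto
  also have "\<dots> = (\<Sum>j\<in>{1..n} - {a, b}. h j) + (\<Sum>j\<in>{a, b}. h j)"
    by (intro sum.union_disjoint) auto
  also have "(\<Sum>j\<in>{a, b}. h j) \<le> 2"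
    using assms(1)[of a] assms(1)[of b] by (cases "a = b") auto
  finally show ?thesis by simp
qed

text \<open>The permutation is exchanged in two moves, rows first and columns second, through the
  mixed entries \<open>\<theta> (\<tau> i) (\<sigma> j)\<close>. Reflection turns the column move
  into a distance of rows. In each row or column at most two entries fall outside
  \<open>row_gap\<close>, and they cost at most 2.\<close>

lemma perm_error_le_row_gap:
  assumes \<theta>: "\<theta> \<in> Theta m n" and \<sigma>: "\<sigma> permutes {1..n}" and \<tau>: "\<tau> permutes {1..n}"
    and gap: "\<And>i. i \<in> {1..n} \<Longrightarrow> row_gap n \<theta> (\<sigma> i) (\<tau> i) \<le> g"
  shows "(frob_norm n (\<lambda>i j. (\<theta> \<odot> \<sigma>) i j - (\<theta> \<odot> \<tau>) i j))\<^sup>2 \<le> 4 * real n * (2 + g)"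
proof -
  have sq1: "(x - y)\<^sup>2 \<le> 1" if "0 \<le> x" "x \<le> 1" "0 \<le> y" "y \<le> 1" for x y :: real
    using that by (intro power2_le_iff_abs_le[THEN iffD2, of 1, simplified]) auto
  have rows: "(\<Sum>j=1..n. (\<theta> (\<sigma> i) (\<sigma> j) - \<theta> (\<tau> i) (\<sigma> j))\<^sup>2) \<le> 2 + g" if i: "i \<in> {1..n}" for i
  proof -
    have "(\<Sum>j=1..n. (\<theta> (\<sigma> i) (\<sigma> j) - \<theta> (\<tau> i) (\<sigma> j))\<^sup>2) = (\<Sum>j=1..n. (\<theta> (\<sigma> i) j - \<theta> (\<tau> i) j)\<^sup>2)"
      using sum.permute[OF \<sigma>, of "\<lambda>j. (\<theta> (\<sigma> i) j - \<theta> (\<tau> i) j)\<^sup>2"] by (simp add: o_def)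
    also have "\<dots> \<le> 2 + row_gap n \<theta> (\<sigma> i) (\<tau> i)"
      unfolding row_gap_def by (intro sum_le_off_two sq1 ThetaD[OF \<theta>]) auto
    finally show ?thesis using gap[OF i] by simp
  qed
  have cols: "(\<Sum>i=1..n. (\<theta> (\<tau> i) (\<sigma> j) - \<theta> (\<tau> i) (\<tau> j))\<^sup>2) \<le> 2 + g" if j: "j \<in> {1..n}" for j
  proof -
    have in': "\<sigma> j \<in> {1..n}" "\<tau> j \<in> {1..n}" using j permutes_in_image[OF \<sigma>] permutes_in_image[OF \<tau>] by auto
    have "(\<Sum>i=1..n. (\<theta> (\<tau> i) (\<sigma> j) - \<theta> (\<tau> i) (\<tau> j))\<^sup>2) = (\<Sum>i=1..n. (\<theta> i (\<sigma> j) - \<theta> i (\<tau> j))\<^sup>2)"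
      using sum.permute[OF \<tau>, of "\<lambda>i. (\<theta> i (\<sigma> j) - \<theta> i (\<tau> j))\<^sup>2"] by (simp add: o_def)
    also have "\<dots> \<le> 2 + (\<Sum>i\<in>{1..n} - {\<sigma> j, \<tau> j}. (\<theta> i (\<sigma> j) - \<theta> i (\<tau> j))\<^sup>2)"
      by (intro sum_le_off_two sq1 ThetaD[OF \<theta>]) auto
    also have "(\<Sum>i\<in>{1..n} - {\<sigma> j, \<tau> j}. (\<theta> i (\<sigma> j) - \<theta> i (\<tau> j))\<^sup>2) = row_gap n \<theta> (\<sigma> j) (\<tau> j)"
      unfolding row_gap_def
    proof (rule sum.cong[OF refl])
      fix i assume i: "i \<in> {1..n} - {\<sigma> j, \<tau> j}"
      have "\<theta> i (\<sigma> j) = reflect_entry m (\<theta> (\<sigma> j) i)" "\<theta> i (\<tau> j) = reflect_entry m (\<theta> (\<tau> j) i)"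
        using i in' by (auto intro!: ThetaD[OF \<theta>] simp: off_diag_def)
      then show "(\<theta> i (\<sigma> j) - \<theta> i (\<tau> j))\<^sup>2 = (\<theta> (\<sigma> j) i - \<theta> (\<tau> j) i)\<^sup>2"
        by (cases m) (auto simp: power2_commute)
    qed
    finally show ?thesis using gap[OF j] by simp
  qed
  have "(frob_norm n (\<lambda>i j. (\<theta> \<odot> \<sigma>) i j - (\<theta> \<odot> \<tau>) i j))\<^sup>2
      = (\<Sum>i=1..n. \<Sum>j=1..n. (\<theta> (\<sigma> i) (\<sigma> j) - \<theta> (\<tau> i) (\<tau> j))\<^sup>2)"
    by (simp add: frob_norm_def L2_set_def sum_nonneg sum.cartesian_product case_prod_unfold mat_perm_def)
  also have "\<dots> \<le> (\<Sum>i=1..n. \<Sum>j=1..n. 2 * (\<theta> (\<sigma> i) (\<sigma> j) - \<theta> (\<tau> i) (\<sigma> j))\<^sup>2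
      + 2 * (\<theta> (\<tau> i) (\<sigma> j) - \<theta> (\<tau> i) (\<tau> j))\<^sup>2)"
  proof (intro sum_mono)
    fix i j
    have "(x - z)\<^sup>2 \<le> 2 * (x - y)\<^sup>2 + 2 * (y - z)\<^sup>2" for x y z :: real
    proof -
      have "0 \<le> ((x - y) - (y - z))\<^sup>2" by simp
      then show ?thesis by (simp add: power2_eq_square algebra_simps)
    qed
    then show "(\<theta> (\<sigma> i) (\<sigma> j) - \<theta> (\<tau> i) (\<tau> j))\<^sup>2 \<le> 2 * (\<theta> (\<sigma> i) (\<sigma> j) - \<theta> (\<tau> i) (\<sigma> j))\<^sup>2
      + 2 * (\<theta> (\<tau> i) (\<sigma> j) - \<theta> (\<tau> i) (\<tau> j))\<^sup>2" .
  qed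
  also have "\<dots> = 2 * (\<Sum>i=1..n. \<Sum>j=1..n. (\<theta> (\<sigma> i) (\<sigma> j) - \<theta> (\<tau> i) (\<sigma> j))\<^sup>2)
      + 2 * (\<Sum>j=1..n. \<Sum>i=1..n. (\<theta> (\<tau> i) (\<sigma> j) - \<theta> (\<tau> i) (\<tau> j))\<^sup>2)"
    by (subst (3) sum.swap) (simp add: sum.distrib sum_distrib_left)
  also have "\<dots> \<le> 2 * (\<Sum>i=1..n. 2 + g) + 2 * (\<Sum>j=1..n. 2 + g)"
    using rows cols by (intro add_mono mult_left_mono sum_mono) auto
  also have "\<dots> = 4 * real n * (2 + g)" by (simp add: algebra_simps)
  finally show ?thesis .
qed

section \<open>Block matrices\<close>

text \<open>When \<open>k\<close> does not divide \<open>n\<close> the block sizes differ, but the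
  \<open>n div k\<close> indices following \<open>(a - 1) * n div k\<close> always belong to block
  \<open>a\<close>. Since \<open>k \<le> n\<close>, taking the integer part loses at most a factor
  2.\<close>

lemma block_size:
  assumes k: "k \<in> {1..n}" and j: "j \<in> {1..n}"
  shows "real n / (2 * real k)
    \<le> card {i\<in>{1..n}. nat \<lceil>real k * real i / real n\<rceil> = nat \<lceil>real k * real j / real n\<rceil>}"
proof -
  have n: "n > 0" "k > 0" "k \<le> n" using k by auto
  define a where "a = nat \<lceil>real k * real j / real n\<rceil>"
  define d where "d = n div k"
  define l where "l = (a - 1) * n div k"
  have cj: "\<lceil>real k * real j / real n\<rceil> > 0" using n j by simp
  then have a1: "a \<ge> 1" unfolding a_def by linarith
  have "real k * real j / real n \<le> real k" using j n by (simp add: field_simps mult_left_mono)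
  then have "\<lceil>real k * real j / real n\<rceil> \<le> int k" by linarith
  then have ak: "a \<le> k" unfolding a_def by linarith
  have kl: "k * l \<le> (a - 1) * n" "(a - 1) * n < k * (l + 1)"
    unfolding l_def using n by (simp_all add: dividend_less_times_div)
  have kd: "k * d \<le> n" unfolding d_def by simp
  have sub: "{l+1..l+d} \<subseteq> {i\<in>{1..n}. nat \<lceil>real k * real i / real n\<rceil> = a}"
  proof
    fix i assume i: "i \<in> {l+1..l+d}"
    have up: "k * i \<le> a * n"
    proof -
      have "k * i \<le> k * l + k * d" using i by (metis add_mult_distrib2 atLeastAtMost_iff mult_le_mono2)
      also have "\<dots> \<le> (a - 1) * n + n" using kl kd by simp
      also have "\<dots> = a * n" using a1 by (cases a) auto
      finally show ?thesis .
    qed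
    have lo: "(a - 1) * n < k * i"
    proof -
      have "k * (l + 1) \<le> k * i" using i by (intro mult_le_mono2) simp
      then show ?thesis using kl by linarith
    qed
    have "k * i \<le> k * n" using up ak by (meson le_trans mult_le_mono1)
    then have "i \<le> n" using n by simp
    have "real ((a - 1) * n) < real (k * i)" "real (k * i) \<le> real (a * n)"
      using up lo by (simp_all only: of_nat_less_iff of_nat_le_iff)
    then have "real a - 1 < real k * real i / real n" "real k * real i / real n \<le> real a"
      using n a1 by (simp_all add: field_simps of_nat_diff)
    then have "\<lceil>real k * real i / real n\<rceil> = int a" by (intro ceiling_unique) auto
    then show "i \<in> {i\<in>{1..n}. nat \<lceil>real k * real i / real n\<rceil> = a}"
      using i \<open>i \<le> n\<close> by simp
  qed
  have "n < k * (d + 1)" unfolding d_def using n by (simp add: dividend_less_times_div)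
  moreover have "d \<ge> 1" unfolding d_def using n by (simp add: Suc_le_eq div_greater_zero_iff)
  then have "k * 1 \<le> k * d" by (rule mult_le_mono2)
  moreover have "k * (d + 1) = k * d + k" "2 * k * d = k * d + k * d" by simp_all
  ultimately have "n \<le> 2 * k * d" by linarith
  then have "real n \<le> real (2 * k * d)" by (simp only: of_nat_le_iff)
  then have "real n / (2 * real k) \<le> real d" using n by (simp add: field_simps)
  also have "d = card {l+1..l+d}" by simp
  also have "\<dots> \<le> card {i\<in>{1..n}. nat \<lceil>real k * real i / real n\<rceil> = a}"
    by (intro card_mono sub) simp
  finally show ?thesis unfolding a_def by simp
qed

text \<open>A sum of squares is at most the largest term times the L1 norm. In a block matrix a
  large difference is repeated along a whole block of about \<open>n / k\<close> columns, so the
  largest term is itself \<open>O(k / n)\<close> times the L1 norm. This is the gain over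
  \<open>row_gap_le_l1\<close> when there are few blocks.\<close>

lemma row_gap_blocks:
  assumes k: "k > 0" and n: "n > 0"
    and blk: "\<And>i j. (i, j) \<in> off_diag n \<Longrightarrow> \<theta> i j = B (c i) (c j)"
    and size: "\<And>j. j \<in> {1..n} \<Longrightarrow> real n / (2 * real k) \<le> card {i\<in>{1..n}. c i = c j}"
    and ab: "a \<in> {1..n}" "b \<in> {1..n}"
  shows "row_gap n \<theta> a b \<le> 6 * real k / n * (\<Sum>j\<in>{1..n} - {a, b}. \<bar>\<theta> a j - \<theta> b j\<bar>)\<^sup>2"
proof -
  define s where "s = (\<Sum>j\<in>{1..n} - {a, b}. \<bar>\<theta> a j - \<theta> b j\<bar>)"
  have bound: "\<bar>\<theta> a j - \<theta> b j\<bar> \<le> 6 * real k / n * s" if j: "j \<in> {1..n} - {a, b}" for j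
  proof -
    define G where "G = {i\<in>{1..n}. c i = c j} - {a, b}"
    have jG: "j \<in> G" using j by (simp add: G_def)
    have finG: "finite G" by (simp add: G_def)
    have "card {i\<in>{1..n}. c i = c j} \<le> card (G \<union> {a, b})" by (rule card_mono) (auto simp: G_def)
    also have "\<dots> \<le> card G + card {a, b}" by (rule card_Un_le)
    also have "card {a, b} \<le> 2" by (simp add: card_insert_if)
    finally have "card {i\<in>{1..n}. c i = c j} \<le> card G + 2" by simp
    \<comment> \<open>Deleting \<open>a\<close> and \<open>b\<close> may shrink the block, but it
      still contains \<open>j\<close>; hence it keeps at least a third of its size.\<close>
    moreover have "card G \<ge> 1" using jG finG by (simp add: Suc_le_eq card_gt_0_iff) blast
    ultimately have "card {i\<in>{1..n}. c i = c j} \<le> 3 * card G" by linarith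
    then have "real (card {i\<in>{1..n}. c i = c j}) \<le> 3 * real (card G)" by linarith
    then have "real n / (2 * real k) \<le> 3 * real (card G)" using size[of j] j by simp
    then have cG: "real n / (6 * real k) \<le> card G" by (simp add: field_simps)
    have "real n / (6 * real k) * \<bar>\<theta> a j - \<theta> b j\<bar> \<le> card G * \<bar>\<theta> a j - \<theta> b j\<bar>"
      using cG by (intro mult_right_mono) auto
    also have "\<dots> = (\<Sum>i\<in>G. \<bar>\<theta> a j - \<theta> b j\<bar>)" by simp
    also have "\<dots> = (\<Sum>i\<in>G. \<bar>\<theta> a i - \<theta> b i\<bar>)"
    proof (rule sum.cong[OF refl])
      fix i assume "i \<in> G"
      then have "(a, i) \<in> off_diag n" "(b, i) \<in> off_diag n" "(a, j) \<in> off_diag n" "(b, j) \<in> off_diag n" "c i = c j"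
        using j ab by (auto simp: G_def off_diag_def)
      then show "\<bar>\<theta> a j - \<theta> b j\<bar> = \<bar>\<theta> a i - \<theta> b i\<bar>" using blk by simp
    qed
    also have "\<dots> \<le> s" unfolding s_def by (intro sum_mono2) (auto simp: G_def)
    finally show ?thesis using k n by (simp add: field_simps)
  qed
  have "row_gap n \<theta> a b = (\<Sum>j\<in>{1..n} - {a, b}. \<bar>\<theta> a j - \<theta> b j\<bar> * \<bar>\<theta> a j - \<theta> b j\<bar>)"
    by (simp add: row_gap_def power2_eq_square)
  also have "\<dots> \<le> (\<Sum>j\<in>{1..n} - {a, b}. 6 * real k / n * s * \<bar>\<theta> a j - \<theta> b j\<bar>)"
    using bound by (intro sum_mono mult_right_mono) auto
  also have "\<dots> = 6 * real k / n * s\<^sup>2"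
    unfolding sum_distrib_left[symmetric] s_def[symmetric] by (simp add: power2_eq_square)
  finally show ?thesis unfolding s_def .
qed

text \<open>Each label class is a side of \<open>k\<close> cells in either direction, so the sides
  add up to \<open>2 * k * n\<close>. The classes may be arbitrary sets of indices: the permutation
  that reveals the blocks of a matrix can differ from the one that orders it.\<close>

lemma card_level_sets_blocks:
  assumes c: "\<And>i. i \<in> {1..n} \<Longrightarrow> c i \<in> {1..k}"
    and blk: "\<And>i j. (i, j) \<in> off_diag n \<Longrightarrow> A i j = B (c i) (c j)"
  shows "finite (level_sets m n A)" and "card (level_sets m n A) \<le> 2 * 2 ^ (2 * k * n)"
proof -
  define R where "R s = {i\<in>{1..n}. c i = s}" for s :: nat
  let ?Q = "{1..k} \<times> {1..k}"
  have sumR: "(\<Sum>s=1..k. card (R s)) = n"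
  proof -
    have "n = card (\<Union>s\<in>{1..k}. R s)"
    proof -
      have "(\<Union>s\<in>{1..k}. R s) = {1..n}" using c by (auto simp: R_def)
      then show ?thesis by simp
    qed
    also have "\<dots> = (\<Sum>s=1..k. card (R s))" by (intro card_UN_disjoint) (auto simp: R_def)
    finally show ?thesis ..
  qed
  have W: "(\<Sum>q\<in>?Q. card (R (fst q)) + card (R (snd q))) = 2 * k * n"
  proof -
    have "(\<Sum>q\<in>?Q. card (R (fst q)) + card (R (snd q)))
        = (\<Sum>s=1..k. \<Sum>t=1..k. card (R s) + card (R t))"
      by (simp add: sum.cartesian_product case_prod_unfold)
    also have "\<dots> = 2 * k * n"
      by (simp add: sum.distrib sumR[unfolded One_nat_def] flip: sum_distrib_left)
    finally show ?thesis .
  qed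
  have *: "finite (level_sets m n A) \<and>
      card (level_sets m n A) \<le> 2 * 2 ^ (\<Sum>q\<in>?Q. card (R (fst q)) + card (R (snd q)))"
  proof (intro conjI)
    let ?S = "\<lambda>q. R (fst q) \<times> R (snd q) \<inter> off_diag n"
    have cov: "(\<Union>q\<in>?Q. ?S q) = off_diag n"
    proof -
      have "(i, j) \<in> (\<Union>q\<in>?Q. ?S q)" if "(i, j) \<in> off_diag n" for i j
      proof (rule UN_I[of "(c i, c j)"])
        show "(c i, c j) \<in> ?Q" using that c by (auto simp: off_diag_def)
      qed (use that in \<open>auto simp: off_diag_def R_def\<close>)
      then show ?thesis by auto
    qed
    have val: "A i j = B (fst q) (snd q)" if "(i, j) \<in> ?S q" for q i j
      using that blk by (auto simp: R_def)
    show "finite (level_sets m n A)"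
      by (rule card_level_sets(1)[where Q = ?Q and S = ?S, OF _ _ _ _ cov val]) (auto simp: R_def)
    show "card (level_sets m n A) \<le> 2 * 2 ^ (\<Sum>q\<in>?Q. card (R (fst q)) + card (R (snd q)))"
      by (rule card_level_sets(2)[where Q = ?Q and S = ?S, OF _ _ _ _ cov val]) (auto simp: R_def)
  qed
  then show "finite (level_sets m n A)" "card (level_sets m n A) \<le> 2 * 2 ^ (2 * k * n)"
    unfolding W by auto
qed

section \<open>Rounding and the choice of centre\<close>

definition quantise :: "nat \<Rightarrow> rmat \<Rightarrow> rmat" where
  "quantise L A = (\<lambda>i j. \<lfloor>L * A i j\<rfloor> / L)"

lemma quantise_error:
  assumes "L > 0"
  shows "quantise L A i j \<le> A i j" "A i j - quantise L A i j \<le> 1 / L"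
proof -
  have fl: "\<lfloor>L * A i j\<rfloor> \<le> L * A i j" "L * A i j \<le> \<lfloor>L * A i j\<rfloor> + 1" by linarith+
  show "quantise L A i j \<le> A i j"
    using assms fl(1) by (simp add: quantise_def pos_divide_le_eq mult.commute)
  have "A i j \<le> (\<lfloor>L * A i j\<rfloor> + 1) / L"
    using assms fl(2) by (simp add: pos_le_divide_eq mult.commute)
  then show "A i j - quantise L A i j \<le> 1 / L" by (simp add: quantise_def add_divide_distrib)
qed

text \<open>A cell is the set where the rounding takes the value \<open>q / L\<close>. It has no
  product structure, so the full square serves as its rectangle; there are \<open>L + 1\<close>
  values, each contributing \<open>2 * n\<close>.\<close>

lemma card_level_sets_quantise:
  assumes L: "L > 0" and A: "\<And>i j. 0 \<le> A i j" "\<And>i j. A i j \<le> 1"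
  shows "finite (level_sets m n (quantise L A))"
    and "card (level_sets m n (quantise L A)) \<le> 2 * 2 ^ (2 * (L + 1) * n)"
proof -
  let ?S = "\<lambda>q. {(i, j) \<in> off_diag n. \<lfloor>L * A i j\<rfloor> = int q}"
  have "(\<Union>q\<in>{0..L}. ?S q) = off_diag n"
  proof -
    have "(i, j) \<in> (\<Union>q\<in>{0..L}. ?S q)" if "(i, j) \<in> off_diag n" for i j
    proof (rule UN_I[of "nat \<lfloor>L * A i j\<rfloor>"])
      have "L * A i j \<le> real L * 1" using A by (intro mult_left_mono) auto
      then show "nat \<lfloor>L * A i j\<rfloor> \<in> {0..L}" by simp linarith
      have "0 \<le> L * A i j" using A by simp
      then show "(i, j) \<in> ?S (nat \<lfloor>L * A i j\<rfloor>)" using that by simp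
    qed
    then show ?thesis by auto
  qed
  moreover have "quantise L A i j = real q / real L" if "(i, j) \<in> ?S q" for q i j
    using that by (simp add: quantise_def)
  moreover have "?S q \<subseteq> {1..n} \<times> {1..n}" for q by (auto simp: off_diag_def)
  ultimately have *: "finite (level_sets m n (quantise L A)) \<and>
      card (level_sets m n (quantise L A)) \<le> 2 * 2 ^ (\<Sum>q\<in>{0..L}. card {1..n} + card {1..n})"
    by (intro conjI card_level_sets[where Q = "{0..L}" and S = ?S and C = "\<lambda>_. {1..n}" and D = "\<lambda>_. {1..n}"
          and v = "\<lambda>q. real q / real L"]) auto
  moreover have "(\<Sum>q\<in>{0..L}. card {1..n} + card {1..n}) = 2 * (L + 1) * n" by simp
  ultimately show "finite (level_sets m n (quantise L A))"
    "card (level_sets m n (quantise L A)) \<le> 2 * 2 ^ (2 * (L + 1) * n)" by metis+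
qed

text \<open>
  The centre of the level sets: the block matrix itself if \<open>k\<close> is small, and otherwise a rounding
  of it, which has few values and is close to it.
\<close>

lemma exists_centre:
  assumes k: "k \<in> {1..n}" and np: "1 \<le> x"
    and c: "\<And>i. i \<in> {1..n} \<Longrightarrow> c i \<in> {1..k}"
    and blk: "\<And>i j. (i, j) \<in> off_diag n \<Longrightarrow> A i j = B (c i) (c j)"
    and A: "\<And>i j. 0 \<le> A i j" "\<And>i j. A i j \<le> 1"
  obtains A' :: rmat where "\<And>i j. 0 \<le> A' i j" "\<And>i j. A' i j \<le> 1" "\<And>i j. \<bar>A i j - A' i j\<bar> \<le> 1 / x"
    "finite (level_sets m n A')" "card (level_sets m n A') \<le> 2 * exp (6 * n * min (real k) x)"
proof (cases "real k \<le> x")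
  case True
  have "card (level_sets m n A) \<le> 2 * 2 ^ (2 * k * n)"
    using card_level_sets_blocks(2)[of n c k A B m] c blk by blast
  then have "real (card (level_sets m n A)) \<le> real (2 * 2 ^ (2 * k * n))" by (simp only: of_nat_le_iff)
  also have "\<dots> = 2 * 2 ^ (2 * k * n)" by simp
  also have "\<dots> \<le> 2 * exp 1 ^ (2 * k * n)"
    using exp_ge_add_one_self[of 1] by (intro mult_left_mono power_mono) auto
  also have "\<dots> = 2 * exp (2 * k * n)" by (simp flip: exp_of_nat_mult)
  also have "\<dots> \<le> 2 * exp (6 * n * min (real k) x)" using True by simp
  finally have "card (level_sets m n A) \<le> 2 * exp (6 * n * min (real k) x)" .
  then show ?thesis using that[of A] A np card_level_sets_blocks(1)[of n c k A B m] c blk by simp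
next
  case False
  \<comment> \<open>Rounding \<open>x\<close> up keeps the rounding error at most
    \<open>1 / x\<close>, while \<open>L + 1 \<le> 3 * x\<close> because \<open>x \<ge> 1\<close>;
    this gives the 6 in the exponent.\<close>
  define L where "L = nat \<lceil>x\<rceil>"
  have L: "x \<le> L" "L \<le> x + 1" "L > 0" using np unfolding L_def by linarith+
  have "card (level_sets m n (quantise L A)) \<le> 2 * 2 ^ (2 * (L + 1) * n)"
    by (rule card_level_sets_quantise[OF L(3) A])
  then have "real (card (level_sets m n (quantise L A))) \<le> real (2 * 2 ^ (2 * (L + 1) * n))" by (simp only: of_nat_le_iff)
  also have "\<dots> = 2 * 2 ^ (2 * (L + 1) * n)" by simp
  also have "\<dots> \<le> 2 * exp 1 ^ (2 * (L + 1) * n)"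
    using exp_ge_add_one_self[of 1] by (intro mult_left_mono power_mono) auto
  also have "\<dots> = 2 * exp (2 * (real L + 1) * n)" by (simp flip: exp_of_nat_mult add: algebra_simps)
  also have "\<dots> \<le> 2 * exp (6 * n * min (real k) x)"
  proof -
    have "2 * (real L + 1) * n \<le> 2 * (3 * x) * n" using L np by (intro mult_right_mono mult_left_mono) auto
    then show ?thesis using False by (simp add: mult_ac)
  qed
  finally have card: "card (level_sets m n (quantise L A)) \<le> 2 * exp (6 * n * min (real k) x)" .
  have "1 / L \<le> 1 / x" using L np by (simp add: frac_le)
  show ?thesis
  proof (rule that[of "quantise L A"])
    fix i j
    show "0 \<le> quantise L A i j" using A L by (simp add: quantise_def)
    show "quantise L A i j \<le> 1" using quantise_error(1)[OF L(3), of A i j] A(2)[of i j] by linarith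
    show "\<bar>A i j - quantise L A i j\<bar> \<le> 1 / x"
      using quantise_error[OF L(3), of A i j] \<open>1 / L \<le> 1 / x\<close> by linarith
  qed (use card card_level_sets_quantise(1)[OF L(3) A] in auto)
qed

section \<open>The noise matrix\<close>

text \<open>The data matrix minus \<open>J / 2\<close> has expectation
  \<open>p * (\<theta> - J / 2)\<close>. Centring it before the division by the random
  \<open>p_hat\<close> leaves sums of independent variables.\<close>

definition noise :: "model \<Rightarrow> nat \<Rightarrow> rmat \<Rightarrow> real \<Rightarrow> sample \<Rightarrow> rmat" where
  "noise m n \<theta> p \<omega> = (\<lambda>i j. data_matrix m n \<omega> i j - J_mat n i j / 2 - p * (\<theta> i j - J_mat n i j / 2))"

fun reflect_sign :: "model \<Rightarrow> real" where
  "reflect_sign Tournament = - 1"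
| "reflect_sign Graph = 1"

lemma upper_pairs_sub: "upper_pairs n \<subseteq> off_diag n"
  by (auto simp: upper_pairs_def off_diag_def)

lemma finite_upper_pairs [simp]: "finite (upper_pairs n)"
  by (rule finite_subset[OF upper_pairs_sub finite_off_diag])

lemma sum_off_diag_upper:
  fixes h :: "nat \<times> nat \<Rightarrow> 'a::comm_monoid_add"
  shows "(\<Sum>e\<in>off_diag n. h e) = (\<Sum>e\<in>upper_pairs n. h e + h (prod.swap e))"
proof -
  have "off_diag n = upper_pairs n \<union> prod.swap ` upper_pairs n"
    by (force simp: off_diag_def upper_pairs_def image_iff)
  moreover have "upper_pairs n \<inter> prod.swap ` upper_pairs n = {}"
    by (auto simp: upper_pairs_def)
  ultimately have "(\<Sum>e\<in>off_diag n. h e) = (\<Sum>e\<in>upper_pairs n. h e) + (\<Sum>e\<in>prod.swap ` upper_pairs n. h e)"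
    by (simp add: sum.union_disjoint)
  also have "(\<Sum>e\<in>prod.swap ` upper_pairs n. h e) = (\<Sum>e\<in>upper_pairs n. h (prod.swap e))"
    by (subst sum.reindex) (auto simp: inj_on_def)
  finally show ?thesis by (simp add: sum.distrib)
qed

lemma card_upper_pairs: "card (upper_pairs n) = n choose 2"
proof -
  have "card (off_diag n) = 2 * card (upper_pairs n)"
    using sum_off_diag_upper[of "\<lambda>_. 1::nat" n] by simp
  moreover have "card (off_diag n) = n * (n - 1)"
  proof -
    have "off_diag n = Sigma {1..n} (\<lambda>i. {1..n} - {i})" by (auto simp: off_diag_def)
    then show ?thesis by simp
  qed
  ultimately show ?thesis by (simp add: choose_two)
qed

lemma noise_upper:
  assumes \<theta>: "\<theta> \<in> Theta m n" and e: "(i, j) \<in> upper_pairs n"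
  shows "noise m n \<theta> p \<omega> i j = entry_noise p (\<theta> i j) (\<omega> (i, j))"
    and "noise m n \<theta> p \<omega> j i = reflect_sign m * entry_noise p (\<theta> i j) (\<omega> (i, j))"
proof -
  have ij: "i \<in> {1..n}" "j \<in> {1..n}" "i < j" using e by (auto simp: upper_pairs_def)
  have ue: "upper_entry \<omega> i j = centred_obs (\<omega> (i, j)) + 1/2"
    by (simp add: upper_entry_def centred_obs_def)
  show "noise m n \<theta> p \<omega> i j = entry_noise p (\<theta> i j) (\<omega> (i, j))"
    using ij by (simp add: noise_def data_matrix_def J_mat_def entry_noise_def ue)
  have "\<theta> j i = reflect_entry m (\<theta> i j)"
    using ij by (intro ThetaD(4)[OF \<theta>]) (simp add: off_diag_def)
  then show "noise m n \<theta> p \<omega> j i = reflect_sign m * entry_noise p (\<theta> i j) (\<omega> (i, j))"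
    using ij by (cases m) (simp_all add: noise_def data_matrix_def J_mat_def entry_noise_def ue ring_distribs)
qed

lemma noise_diag: "\<theta> \<in> Theta m n \<Longrightarrow> noise m n \<theta> p \<omega> i i = 0"
  by (simp add: noise_def data_matrix_def J_mat_def ThetaD(3))

lemma noise_bound:
  assumes \<theta>: "\<theta> \<in> Theta m n" and p: "0 \<le> p" "p \<le> 1" and e: "(i, j) \<in> off_diag n"
  shows "\<bar>noise m n \<theta> p \<omega> i j\<bar> \<le> 1"
proof (cases "i < j")
  case True
  then have "(i, j) \<in> upper_pairs n" using e by (auto simp: upper_pairs_def off_diag_def)
  then show ?thesis using noise_upper(1)[OF \<theta>] entry_noise_bound[OF p ThetaD(1,2)[OF \<theta>]] by simp
next
  case False
  then have "(j, i) \<in> upper_pairs n" using e by (auto simp: upper_pairs_def off_diag_def)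
  then have "\<bar>noise m n \<theta> p \<omega> i j\<bar> = \<bar>entry_noise p (\<theta> j i) (\<omega> (j, i))\<bar>"
    using noise_upper(2)[OF \<theta>] by (cases m) simp_all
  then show ?thesis using entry_noise_bound[OF p ThetaD(1,2)[OF \<theta>]] by simp
qed

lemma sample_pmf_alt:
  "sample_pmf n \<theta> p = Pi_pmf (upper_pairs n) (False, False)
     (\<lambda>e. pair_pmf (bernoulli_pmf (\<theta> (fst e) (snd e))) (bernoulli_pmf p))"
  by (simp add: sample_pmf_def case_prod_unfold)

lemma finite_set_sample_pmf: "finite (set_pmf (sample_pmf n \<theta> p))"
  unfolding sample_pmf_alt by (rule finite_set_Pi_pmf) simp_all

lemma noise_tail_signed:
  fixes p H s :: real
  assumes \<theta>: "\<theta> \<in> Theta m n" and p: "0 \<le> p" "p \<le> 1" and H: "H > 0" and V: "V \<subseteq> off_diag n"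
    and s: "\<bar>s\<bar> = 1"
  shows "measure_pmf.prob (sample_pmf n \<theta> p)
      {\<omega>. 2 * sqrt (H * (p * real (card V))) + 4 * H < s * (\<Sum>(i, j)\<in>V. noise m n \<theta> p \<omega> i j)} \<le> exp (- H)"
proof -
  \<comment> \<open>An entry below the diagonal is plus or minus its mirror image. The sum over
    \<open>V\<close> is rewritten over the independent above-diagonal variables; a pair with both
    positions in \<open>V\<close> gets a weight of modulus 2 for graphs and 0 for
    tournaments.\<close>
  define c where "c e = s * (of_bool (e \<in> V) + reflect_sign m * of_bool (prod.swap e \<in> V))" for e
  define X where "X e = entry_noise p (\<theta> (fst e) (snd e))" for e
  have "s = 1 \<or> s = - 1" using s by linarith
    then have s2: "s\<^sup>2 = 1" by auto
  have sumV: "(\<Sum>e\<in>V. h e) = (\<Sum>e\<in>upper_pairs n. of_bool (e \<in> V) * h e + of_bool (prod.swap e \<in> V) * h (prod.swap e))"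
    for h :: "nat \<times> nat \<Rightarrow> real"
  proof -
    have "(\<Sum>e\<in>V. h e) = (\<Sum>e\<in>off_diag n. of_bool (e \<in> V) * h e)"
    proof -
      have "(\<Sum>e\<in>V. h e) = (\<Sum>e\<in>off_diag n \<inter> V. h e)" using V by (simp add: Int_absorb1)
      also have "\<dots> = (\<Sum>e\<in>off_diag n. if e \<in> V then h e else 0)"
        by (rule sum.inter_restrict) simp
      also have "\<dots> = (\<Sum>e\<in>off_diag n. of_bool (e \<in> V) * h e)" by (intro sum.cong) auto
      finally show ?thesis .
    qed
    then show ?thesis by (simp add: sum_off_diag_upper)
  qed
  have eq: "s * (\<Sum>(i, j)\<in>V. noise m n \<theta> p \<omega> i j) = (\<Sum>e\<in>upper_pairs n. c e * X e (\<omega> e))" for \<omega>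
    unfolding sumV sum_distrib_left
  proof (rule sum.cong[OF refl])
    fix e assume e: "e \<in> upper_pairs n"
    then show "s * (of_bool (e \<in> V) * (case e of (i, j) \<Rightarrow> noise m n \<theta> p \<omega> i j)
        + of_bool (prod.swap e \<in> V) * (case prod.swap e of (i, j) \<Rightarrow> noise m n \<theta> p \<omega> i j)) = c e * X e (\<omega> e)"
      using noise_upper[OF \<theta>, of "fst e" "snd e" p \<omega>]
      by (simp add: case_prod_unfold c_def X_def algebra_simps)
  qed
  \<comment> \<open>Doubled weights can double the sum of squares relative to \<open>card V\<close>;
    with variance bound \<open>p / 2\<close> the product is just \<open>p * card V\<close>.\<close>
  have "p / 2 * (\<Sum>e\<in>upper_pairs n. (c e)\<^sup>2) \<le> p / 2 * (2 * real (card V))"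
  proof (rule mult_left_mono)
    have "(\<Sum>e\<in>upper_pairs n. (c e)\<^sup>2) \<le> (\<Sum>e\<in>upper_pairs n. 2 * (of_bool (e \<in> V) * 1 + of_bool (prod.swap e \<in> V) * 1))"
    proof (rule sum_mono)
      fix e show "(c e)\<^sup>2 \<le> 2 * (of_bool (e \<in> V) * 1 + of_bool (prod.swap e \<in> V) * 1)"
        unfolding c_def power_mult_distrib s2 by (cases m) (auto simp: of_bool_def power2_eq_square)
    qed
    also have "\<dots> = 2 * (\<Sum>e\<in>V. 1)" unfolding sumV by (rule sum_distrib_left[symmetric])
    finally show "(\<Sum>e\<in>upper_pairs n. (c e)\<^sup>2) \<le> 2 * real (card V)" by simp
  qed (use p in auto)
  then have var: "p / 2 * (\<Sum>e\<in>upper_pairs n. (c e)\<^sup>2) \<le> p * real (card V)" by simp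
  have c2: "\<bar>c e\<bar> \<le> 2" for e
    unfolding c_def abs_mult s by (cases m) (auto simp: of_bool_def)
  show ?thesis
    unfolding eq sample_pmf_alt
  proof (rule tail_sum_Pi_pmf[where v = "p / 2" and c = c and X = X])
    fix e :: "nat \<times> nat"
    let ?q = "\<theta> (fst e) (snd e)"
    note q = p ThetaD(1,2)[OF \<theta>, of "fst e" "snd e"]
    show "\<bar>X e x\<bar> \<le> 1" for x unfolding X_def by (rule entry_noise_bound[OF q])
    show "measure_pmf.expectation (pair_pmf (bernoulli_pmf ?q) (bernoulli_pmf p)) (X e) = 0"
      unfolding X_def by (rule entry_noise_mean[OF q])
    show "measure_pmf.expectation (pair_pmf (bernoulli_pmf ?q) (bernoulli_pmf p)) (\<lambda>x. (X e x)\<^sup>2) \<le> p / 2"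
      unfolding X_def by (rule entry_noise_variance[OF q])
    show "finite (set_pmf (pair_pmf (bernoulli_pmf ?q) (bernoulli_pmf p)))" by simp
    show "\<bar>c e\<bar> \<le> 2" by (rule c2)
    show "p / 2 * (\<Sum>e\<in>upper_pairs n. (c e)\<^sup>2) \<le> p * real (card V)" by (rule var)
    show "0 \<le> p * real (card V)" using p(1) by simp
  qed (simp_all add: H)
qed

lemma noise_tail:
  fixes p H :: real
  assumes "\<theta> \<in> Theta m n" "0 \<le> p" "p \<le> 1" "H > 0" "V \<subseteq> off_diag n"
  shows "measure_pmf.prob (sample_pmf n \<theta> p)
      {\<omega>. 2 * sqrt (H * (p * real (card V))) + 4 * H < \<bar>\<Sum>(i, j)\<in>V. noise m n \<theta> p \<omega> i j\<bar>} \<le> 2 * exp (- H)"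
    (is "measure_pmf.prob ?P {\<omega>. ?b < \<bar>?S \<omega>\<bar>} \<le> _")
proof -
  have "measure_pmf.prob ?P {\<omega>. ?b < \<bar>?S \<omega>\<bar>}
      \<le> measure_pmf.prob ?P ({\<omega>. ?b < 1 * ?S \<omega>} \<union> {\<omega>. ?b < (- 1) * ?S \<omega>})"
    by (intro measure_pmf.finite_measure_mono) auto
  also have "\<dots> \<le> measure_pmf.prob ?P {\<omega>. ?b < 1 * ?S \<omega>} + measure_pmf.prob ?P {\<omega>. ?b < (- 1) * ?S \<omega>}"
    by (rule measure_Un_le) auto
  also have "\<dots> \<le> exp (- H) + exp (- H)"
    by (intro add_mono noise_tail_signed assms) auto
  finally show ?thesis by simp
qed

lemma noise_tail_family:
  fixes p H :: real
  assumes "\<theta> \<in> Theta m n" "0 \<le> p" "p \<le> 1" "H > 0"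
    and F: "finite F" "\<And>V. V \<in> F \<Longrightarrow> V \<subseteq> off_diag n"
  shows "measure_pmf.prob (sample_pmf n \<theta> p)
      {\<omega>. \<exists>V\<in>F. 2 * sqrt (H * (p * real (card V))) + 4 * H < \<bar>\<Sum>(i, j)\<in>V. noise m n \<theta> p \<omega> i j\<bar>}
      \<le> real (card F) * (2 * exp (- H))"
    (is "measure_pmf.prob ?P {\<omega>. \<exists>V\<in>F. ?b V < \<bar>?S V \<omega>\<bar>} \<le> _")
proof -
  have eq: "{\<omega>. \<exists>V\<in>F. ?b V < \<bar>?S V \<omega>\<bar>} = (\<Union>V\<in>F. {\<omega>. ?b V < \<bar>?S V \<omega>\<bar>})" by auto
  have "measure_pmf.prob ?P (\<Union>V\<in>F. {\<omega>. ?b V < \<bar>?S V \<omega>\<bar>})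
      \<le> (\<Sum>V\<in>F. measure_pmf.prob ?P {\<omega>. ?b V < \<bar>?S V \<omega>\<bar>})"
    by (rule measure_pmf.finite_measure_subadditive_finite[OF F(1)]) simp
  also have "\<dots> \<le> (\<Sum>V\<in>F. 2 * exp (- H))"
    by (rule sum_mono, rule noise_tail[OF assms(1-4) F(2)])
  also have "\<dots> = real (card F) * (2 * exp (- H))" by simp
  finally show ?thesis unfolding eq .
qed

lemma p_hat_tail:
  fixes p H :: real
  assumes \<theta>: "\<theta> \<in> Theta m n" and p: "0 \<le> p" "p \<le> 1" and H: "H > 0" and n: "n \<ge> 2"
  shows "measure_pmf.prob (sample_pmf n \<theta> p)
      {\<omega>. 2 * sqrt (H * (p * real (n choose 2))) + 4 * H < real (n choose 2) * \<bar>p_hat n \<omega> - p\<bar>} \<le> 2 * exp (- H)"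
    (is "measure_pmf.prob ?P {\<omega>. ?b < _} \<le> _")
proof -
  let ?S = "\<lambda>s \<omega>. \<Sum>e\<in>upper_pairs n. s * (of_bool (snd (\<omega> e)) - p)"
  have one: "measure_pmf.prob ?P {\<omega>. ?b < ?S s \<omega>} \<le> exp (- H)" if s: "\<bar>s\<bar> = 1" for s :: real
  proof -
    have "s = 1 \<or> s = - 1" using s by linarith
    then have s2: "s\<^sup>2 = 1" by auto
    show ?thesis
      unfolding sample_pmf_alt
    proof (rule tail_sum_Pi_pmf[where v = p and c = "\<lambda>_. s" and X = "\<lambda>_ x. of_bool (snd x) - p"])
      fix e :: "nat \<times> nat"
      let ?q = "\<theta> (fst e) (snd e)"
      note q = p ThetaD(1,2)[OF \<theta>, of "fst e" "snd e"]
      show "\<bar>of_bool (snd x) - p\<bar> \<le> 1" for x :: "bool \<times> bool" by (rule indicator_noise(3)[OF q])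
      show "measure_pmf.expectation (pair_pmf (bernoulli_pmf ?q) (bernoulli_pmf p)) (\<lambda>x. of_bool (snd x) - p) = 0"
        by (rule indicator_noise(1)[OF q])
      show "measure_pmf.expectation (pair_pmf (bernoulli_pmf ?q) (bernoulli_pmf p))
          (\<lambda>x. (of_bool (snd x) - p)\<^sup>2) \<le> p"
        by (rule indicator_noise(2)[OF q])
      show "finite (set_pmf (pair_pmf (bernoulli_pmf ?q) (bernoulli_pmf p)))" by simp
      show "\<bar>s\<bar> \<le> 2" using s by simp
      show "p * (\<Sum>e\<in>upper_pairs n. s\<^sup>2) \<le> p * real (n choose 2)"
        by (simp add: s2 card_upper_pairs)
      show "0 \<le> p * real (n choose 2)" using p(1) by simp
    qed (simp_all add: H)
  qed
  have eq: "real (n choose 2) * \<bar>p_hat n \<omega> - p\<bar> = \<bar>?S 1 \<omega>\<bar>" for \<omega>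
  proof -
    have N: "real (n choose 2) > 0" using n by simp
    have "?S 1 \<omega> = real (card {e \<in> upper_pairs n. snd (\<omega> e)}) - real (n choose 2) * p"
      by (simp add: sum_subtractf card_upper_pairs of_bool_def sum.If_cases Int_def)
    also have "\<dots> = real (n choose 2) * (p_hat n \<omega> - p)"
      using N by (simp add: p_hat_def field_simps)
    finally show ?thesis using N by (simp add: abs_mult)
  qed
  have neg: "?S (- 1) \<omega> = - ?S 1 \<omega>" for \<omega> by (simp add: sum_negf[symmetric])
  have "measure_pmf.prob ?P {\<omega>. ?b < real (n choose 2) * \<bar>p_hat n \<omega> - p\<bar>}
      \<le> measure_pmf.prob ?P ({\<omega>. ?b < ?S 1 \<omega>} \<union> {\<omega>. ?b < ?S (- 1) \<omega>})"
    unfolding eq neg by (intro measure_pmf.finite_measure_mono) auto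
  also have "\<dots> \<le> measure_pmf.prob ?P {\<omega>. ?b < ?S 1 \<omega>} + measure_pmf.prob ?P {\<omega>. ?b < ?S (- 1) \<omega>}"
    by (rule measure_Un_le) auto
  also have "\<dots> \<le> exp (- H) + exp (- H)" by (intro add_mono one) auto
  finally show ?thesis by simp
qed

section \<open>Noise and sorting error\<close>

lemma sum_square_off_diag:
  fixes h :: "nat \<Rightarrow> nat \<Rightarrow> real"
  assumes "\<And>i. h i i = 0"
  shows "(\<Sum>i=1..n. \<Sum>j=1..n. h i j) = (\<Sum>(i, j)\<in>off_diag n. h i j)"
proof -
  have "(\<Sum>i=1..n. \<Sum>j=1..n. h i j) = (\<Sum>(i, j)\<in>{1..n} \<times> {1..n}. h i j)"
    by (rule sum.cartesian_product)
  also have "\<dots> = (\<Sum>(i, j)\<in>off_diag n. h i j)"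
    using assms by (intro sum.mono_neutral_right) (auto simp: off_diag_def)
  finally show ?thesis .
qed

definition off_norm :: "nat \<Rightarrow> rmat \<Rightarrow> real" where
  "off_norm n A = L2_set (\<lambda>(i, j). A i j) (off_diag n)"

lemma frob_norm_nonneg [simp]: "0 \<le> frob_norm n A"
  by (simp add: frob_norm_def)

lemma frob_norm_triangle: "frob_norm n (\<lambda>i j. A i j + B i j) \<le> frob_norm n A + frob_norm n B"
  unfolding frob_norm_def
  using L2_set_triangle_ineq[of "\<lambda>(i, j). A i j" "\<lambda>(i, j). B i j" "{1..n} \<times> {1..n}"]
  by (simp add: case_prod_unfold)

lemma frob_norm_inner: "(\<Sum>i=1..n. \<Sum>j=1..n. A i j * B i j) \<le> frob_norm n A * frob_norm n B"
proof -
  have "(\<Sum>i=1..n. \<Sum>j=1..n. A i j * B i j) = (\<Sum>e\<in>{1..n} \<times> {1..n}. A (fst e) (snd e) * B (fst e) (snd e))"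
    by (simp add: sum.cartesian_product case_prod_unfold)
  also have "\<dots> \<le> (\<Sum>e\<in>{1..n} \<times> {1..n}. \<bar>A (fst e) (snd e)\<bar> * \<bar>B (fst e) (snd e)\<bar>)"
    by (intro sum_mono) (metis abs_ge_self abs_mult)
  also have "\<dots> \<le> frob_norm n A * frob_norm n B"
    unfolding frob_norm_def case_prod_unfold by (rule L2_set_mult_ineq)
  finally show ?thesis .
qed

lemma frob_norm_perm:
  assumes "\<sigma> permutes {1..n}"
  shows "frob_norm n (\<lambda>i j. A (\<sigma> i) (\<sigma> j)) = frob_norm n A"
proof -
  have "(\<Sum>i=1..n. \<Sum>j=1..n. (A (\<sigma> i) (\<sigma> j))\<^sup>2) = (\<Sum>i=1..n. \<Sum>j=1..n. (A (\<sigma> i) j)\<^sup>2)"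
    using sum.permute[OF assms, of "\<lambda>j. (A (\<sigma> _) j)\<^sup>2"] by (simp add: o_def)
  also have "\<dots> = (\<Sum>i=1..n. \<Sum>j=1..n. (A i j)\<^sup>2)"
    using sum.permute[OF assms, of "\<lambda>i. \<Sum>j=1..n. (A i j)\<^sup>2"] by (simp add: o_def)
  finally have "(frob_norm n (\<lambda>i j. A (\<sigma> i) (\<sigma> j)))\<^sup>2 = (frob_norm n A)\<^sup>2"
    by (simp only: frob_norm_sq)
  then show ?thesis by (rule power2_eq_imp_eq) simp_all
qed

lemma frob_norm_le_bound:
  assumes "\<And>i j. \<bar>A i j\<bar> \<le> c" "0 \<le> c"
  shows "frob_norm n A \<le> n * c"
proof -
  have "(frob_norm n A)\<^sup>2 \<le> (\<Sum>i=1..n. \<Sum>j=1..n. c\<^sup>2)"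
    unfolding frob_norm_sq using assms(1) by (intro sum_mono) (rule abs_le_square_iff[THEN iffD1], use assms in simp)
  also have "\<dots> = (n * c)\<^sup>2" by (simp add: power2_eq_square)
  finally show ?thesis by (rule power2_le_imp_le) (use assms in simp)
qed

lemma off_diag_perm:
  assumes \<sigma>: "\<sigma> permutes {1..n}" and "(i, j) \<in> off_diag n"
  shows "(\<sigma> i, \<sigma> j) \<in> off_diag n"
proof -
  have "\<sigma> i \<noteq> \<sigma> j" using assms(2) permutes_inj[OF \<sigma>] by (auto simp: off_diag_def inj_def)
  then show ?thesis using assms(2) permutes_in_image[OF \<sigma>] by (simp add: off_diag_def)
qed

text \<open>Sorting permutes the noise in a data-dependent way. Moving the permutation from the
  noise to the index set, and admitting all permutations, gives a fixed family of sets to which a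
  union bound applies.\<close>

definition perm_level_sets :: "model \<Rightarrow> nat \<Rightarrow> rmat \<Rightarrow> (nat \<times> nat) set set" where
  "perm_level_sets m n A =
     (\<lambda>(\<sigma>, U). map_prod \<sigma> \<sigma> ` U) ` ({\<sigma>. \<sigma> permutes {1..n}} \<times> level_sets m n A)"

lemma perm_level_sets_sub:
  assumes "V \<in> perm_level_sets m n A"
  shows "V \<subseteq> off_diag n"
proof -
  obtain \<sigma> U where \<sigma>: "\<sigma> permutes {1..n}" and U: "U \<in> level_sets m n A" and V: "V = map_prod \<sigma> \<sigma> ` U"
    using assms by (auto simp: perm_level_sets_def)
  have "U \<subseteq> off_diag n" using U by (auto simp: level_sets_def)
  then show ?thesis unfolding V using off_diag_perm[OF \<sigma>] by auto
qed

lemma card_perm_level_sets: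
  assumes "finite (level_sets m n A)"
  shows "finite (perm_level_sets m n A)"
    and "real (card (perm_level_sets m n A)) \<le> fact n * real (card (level_sets m n A))"
proof -
  have fin: "finite ({\<sigma>. \<sigma> permutes {1..n}} \<times> level_sets m n A)"
    using assms by (simp add: finite_permutations)
  then show "finite (perm_level_sets m n A)" unfolding perm_level_sets_def by (rule finite_imageI)
  have "card (perm_level_sets m n A) \<le> card ({\<sigma>. \<sigma> permutes {1..n}} \<times> level_sets m n A)"
    unfolding perm_level_sets_def using fin by (rule card_image_le)
  also have "\<dots> = fact n * card (level_sets m n A)"
    using card_permutations[of "{1..n}" n] by (simp add: card_cartesian_product)
  finally have "real (card (perm_level_sets m n A)) \<le> real (fact n * card (level_sets m n A))"
    by (simp only: of_nat_le_iff)
  then show "real (card (perm_level_sets m n A)) \<le> fact n * real (card (level_sets m n A))" by simp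
qed

lemma noise_inner_bound:
  fixes p H :: real
  assumes \<theta>: "\<theta> \<in> Theta m n" and p: "0 \<le> p" "p \<le> 1" and n: "n > 0" and H: "0 \<le> H"
    and \<sigma>: "\<sigma> permutes {1..n}" and M: "M \<in> ordered_matrices m n"
    and A': "\<And>i j. 0 \<le> A' i j" "\<And>i j. A' i j \<le> 1"
    and good: "\<And>V. V \<in> perm_level_sets m n A' \<Longrightarrow>
      \<bar>\<Sum>(i, j)\<in>V. noise m n \<theta> p \<omega> i j\<bar> \<le> 2 * sqrt (H * (p * real (card V))) + 4 * H"
  shows "\<bar>\<Sum>(i, j)\<in>off_diag n. noise m n \<theta> p \<omega> (\<sigma> i) (\<sigma> j) * (M i j - A' i j)\<bar>
    \<le> 4 * sqrt (H * p) * sqrt (1 + ln n) * off_norm n (\<lambda>i j. M i j - A' i j) + 8 * H + 2 * real n"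
proof -
  define z where "z e = noise m n \<theta> p \<omega> (\<sigma> (fst e)) (\<sigma> (snd e))" for e
  define d where "d e = M (fst e) (snd e) - A' (fst e) (snd e)" for e
  have lev: "\<bar>\<Sum>e\<in>U. z e\<bar> \<le> (2 * sqrt (H * p)) * sqrt (card U) + 4 * H" if U: "U \<in> level_sets m n A'" for U
  proof -
    let ?V = "map_prod \<sigma> \<sigma> ` U"
    have inj: "inj_on (map_prod \<sigma> \<sigma>) U"
      using permutes_inj[OF \<sigma>] by (auto simp: inj_on_def inj_def)
    have "?V \<in> perm_level_sets m n A'" unfolding perm_level_sets_def using \<sigma> U by force
    from good[OF this] have "\<bar>\<Sum>(i, j)\<in>?V. noise m n \<theta> p \<omega> i j\<bar> \<le> 2 * sqrt (H * (p * real (card U))) + 4 * H"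
      by (simp add: card_image[OF inj])
    moreover have "(\<Sum>(i, j)\<in>?V. noise m n \<theta> p \<omega> i j) = (\<Sum>e\<in>U. z e)"
      by (subst sum.reindex[OF inj]) (simp add: z_def case_prod_unfold)
    moreover have "sqrt (H * (p * real (card U))) = sqrt (H * p) * sqrt (card U)"
      by (simp add: mult.assoc flip: real_sqrt_mult)
    ultimately show ?thesis by simp
  qed
  have pos: "{e \<in> off_diag n. u \<le> d e} \<in> level_sets m n A'" for u
    unfolding level_sets_def d_def using M by (auto intro!: bexI[of _ M] exI[of _ u])
  have neg: "{e \<in> off_diag n. u \<le> - d e} \<in> level_sets m n A'" for u
    unfolding level_sets_def d_def using M by (auto intro!: bexI[of _ M] exI[of _ u])
  \<comment> \<open>Taking \<open>N = n\<close> levels makes the harmonic factor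
    \<open>1 + ln n\<close>, and the rounding costs at most \<open>2 * n\<close>.\<close>
  have "\<bar>\<Sum>e\<in>off_diag n. z e * d e\<bar> \<le> 2 * (2 * sqrt (H * p)) * sqrt (1 + ln n) * sqrt (\<Sum>e\<in>off_diag n. (d e)\<^sup>2)
      + 2 * (4 * H) + 2 * card (off_diag n) / n"
  proof (rule level_set_bound_signed[OF _ n])
    fix e :: "nat \<times> nat"
    show "\<bar>d e\<bar> \<le> 1"
      unfolding d_def using ordered_matricesD(2,3)[OF M, of "fst e" "snd e"] A'[of "fst e" "snd e"] by linarith
    assume e: "e \<in> off_diag n"
    have "(\<sigma> (fst e), \<sigma> (snd e)) \<in> off_diag n"
      using off_diag_perm[OF \<sigma>] e by simp
    then show "\<bar>z e\<bar> \<le> 1" unfolding z_def by (rule noise_bound[OF \<theta> p])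
  qed (use lev pos neg p H in auto)
  moreover have "sqrt (\<Sum>e\<in>off_diag n. (d e)\<^sup>2) = off_norm n (\<lambda>i j. M i j - A' i j)"
    by (simp add: off_norm_def L2_set_def d_def case_prod_unfold)
  moreover have "2 * card (off_diag n) / n \<le> 2 * real n"
    using card_off_diag_le[of n] n by (simp add: power2_eq_square divide_le_eq)
  ultimately show ?thesis by (simp add: z_def d_def case_prod_unfold)
qed


lemma row_sum_J: "i \<in> {1..n} \<Longrightarrow> row_sum n (J_mat n) i = real n - 1"
proof -
  assume i: "i \<in> {1..n}"
  have "row_sum n (J_mat n) i = (\<Sum>j\<in>{1..n} - {i}. 1)"
    unfolding row_sum_def using i by (intro sum.mono_neutral_cong_right) (auto simp: J_mat_def)
  then show ?thesis using i by (simp add: of_nat_diff)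
qed

lemma sorted_row_gap:
  fixes p x :: real
  assumes \<theta>\<^sub>0: "\<theta>\<^sub>0 \<in> ordered_matrices m n" and \<pi>: "\<pi> permutes {1..n}"
    and \<theta>: "\<theta> = \<theta>\<^sub>0 \<odot> \<pi>"
    and p: "0 < p" and \<sigma>: "\<sigma> \<in> sorting_perms n (data_matrix m n \<omega>)"
    and rows: "\<And>i. i \<in> {1..n} \<Longrightarrow> \<bar>row_sum n (noise m n \<theta> p \<omega>) i\<bar> \<le> x"
    and i: "i \<in> {1..n}"
  shows "\<bar>row_sum n \<theta> (\<sigma> i) - row_sum n \<theta> (inv \<pi> i)\<bar> \<le> 2 * x / p"
proof -
  let ?y = "data_matrix m n \<omega>"
  define f where "f a = row_sum n ?y a" for a
  \<comment> \<open>\<open>g\<close> is the expected row sum of the data: each of the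
    \<open>n - 1\<close> off-diagonal entries is missing with probability \<open>1 - p\<close> and
    then equals 1/2. It is sorted by \<open>inv \<pi>\<close> as \<open>f\<close> is by
    \<open>\<sigma>\<close>.\<close>
  define g where "g a = p * row_sum n \<theta> a + (1 - p) * (real n - 1) / 2" for a
  have \<sigma>': "\<sigma> permutes {1..n}" and fm: "mono_on {1..n} (\<lambda>i. f (\<sigma> i))"
    using \<sigma> by (auto simp: sorting_perms_def f_def)
  have \<tau>: "inv \<pi> permutes {1..n}" by (rule permutes_inv[OF \<pi>])
  have gm: "mono_on {1..n} (\<lambda>i. g (inv \<pi> i))"
  proof -
    have "row_sum n \<theta> (inv \<pi> i) = row_sum n \<theta>\<^sub>0 i" for i
      unfolding \<theta> row_sum_perm[OF \<pi>] by (simp add: permutes_inverses[OF \<pi>])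
    then show ?thesis
      using ordered_row_sum_mono[OF \<theta>\<^sub>0] p by (auto simp: g_def mono_on_def mult_left_mono)
  qed
  have fg: "\<bar>f a - g a\<bar> \<le> x" if a: "a \<in> {1..n}" for a
  proof -
    have "row_sum n (noise m n \<theta> p \<omega>) a = f a - row_sum n (J_mat n) a / 2 - p * (row_sum n \<theta> a - row_sum n (J_mat n) a / 2)"
      by (simp add: f_def row_sum_def noise_def sum_subtractf sum_divide_distrib flip: sum_distrib_left)
    also have "\<dots> = f a - g a"
      by (simp add: row_sum_J[OF a] g_def field_simps)
    finally show ?thesis using rows[OF a] by simp
  qed
  have fg': "g a \<le> f a + x" "f a \<le> g a + x" if "a \<in> {1..n}" for a
    using fg[OF that] by linarith+
  have "g (inv \<pi> i) \<le> f (\<sigma> i) + x"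
    by (rule sorted_compare[OF \<sigma>' \<tau> fm gm fg'(1) i])
  moreover have "f (\<sigma> i) \<le> g (inv \<pi> i) + x"
    by (rule sorted_compare[OF \<tau> \<sigma>' gm fm fg'(2) i])
  moreover have "\<bar>f (\<sigma> i) - g (\<sigma> i)\<bar> \<le> x"
    using i permutes_in_image[OF \<sigma>', of i] by (intro fg) simp
  ultimately have "\<bar>g (\<sigma> i) - g (inv \<pi> i)\<bar> \<le> 2 * x" by linarith
  also have "g (\<sigma> i) - g (inv \<pi> i) = p * (row_sum n \<theta> (\<sigma> i) - row_sum n \<theta> (inv \<pi> i))"
    by (simp add: g_def algebra_simps)
  finally have "p * \<bar>row_sum n \<theta> (\<sigma> i) - row_sum n \<theta> (inv \<pi> i)\<bar> \<le> 2 * x"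
    using p by (simp only: abs_mult abs_of_pos)
  then show ?thesis using p by (simp only: pos_le_divide_eq mult.commute)
qed

text \<open>The block permutation is absorbed into the labelling \<open>c\<close>, in the original
  coordinates, so that nothing later depends on how the blocks are placed.\<close>

lemma block_ThetaE:
  assumes "\<theta> \<in> block_Theta m n k" "k \<in> {1..n}"
  obtains B :: rmat and c :: "nat \<Rightarrow> nat"
  where "\<theta> \<in> Theta m n" "\<And>i j. (i, j) \<in> off_diag n \<Longrightarrow> \<theta> i j = B (c i) (c j)"
    "\<And>i. i \<in> {1..n} \<Longrightarrow> c i \<in> {1..k}"
    "\<And>j. j \<in> {1..n} \<Longrightarrow> real n / (2 * real k) \<le> card {i\<in>{1..n}. c i = c j}"
proof -
  define l where "l i = nat \<lceil>real k * real i / real n\<rceil>" for i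
  obtain B :: rmat and \<pi> where \<theta>: "\<theta> \<in> Theta m n" and \<pi>: "\<pi> permutes {1..n}"
    and B: "\<forall>i\<in>{1..n}. \<forall>j\<in>{1..n}. i \<noteq> j \<longrightarrow> (\<theta> \<odot> \<pi>) i j = B (l i) (l j)"
    using assms(1) unfolding block_Theta_def l_def by blast
  have \<tau>: "inv \<pi> permutes {1..n}" by (rule permutes_inv[OF \<pi>])
  have in\<tau>: "inv \<pi> i \<in> {1..n}" if "i \<in> {1..n}" for i using permutes_in_image[OF \<tau>] that by blast
  show ?thesis
  proof (rule that[of B "\<lambda>i. l (inv \<pi> i)"])
    show "\<theta> \<in> Theta m n" by (rule \<theta>)
  next
    fix i j assume "(i, j) \<in> off_diag n"
    then have "(inv \<pi> i, inv \<pi> j) \<in> off_diag n" by (rule off_diag_perm[OF \<tau>])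
    then have "(\<theta> \<odot> \<pi>) (inv \<pi> i) (inv \<pi> j) = B (l (inv \<pi> i)) (l (inv \<pi> j))"
      using B by (auto simp: off_diag_def)
    then show "\<theta> i j = B (l (inv \<pi> i)) (l (inv \<pi> j))"
      by (simp add: mat_perm_def permutes_inverses[OF \<pi>])
  next
    fix i assume "i \<in> {1..n}"
    then have i: "inv \<pi> i \<in> {1..n}" by (rule in\<tau>)
    have "0 < real k * real (inv \<pi> i) / real n" using i assms(2) by simp
    moreover have "real k * real (inv \<pi> i) / real n \<le> real k" using i assms(2) by (simp add: field_simps mult_left_mono)
    ultimately show "l (inv \<pi> i) \<in> {1..k}" unfolding l_def by simp linarith
  next
    fix j assume "j \<in> {1..n}"
    then have j: "inv \<pi> j \<in> {1..n}" by (rule in\<tau>)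
    have "real n / (2 * real k) \<le> card {i\<in>{1..n}. l i = l (inv \<pi> j)}"
      unfolding l_def by (rule block_size[OF assms(2) j])
    also have "card {i\<in>{1..n}. l i = l (inv \<pi> j)} \<le> card {i\<in>{1..n}. l (inv \<pi> i) = l (inv \<pi> j)}"
    proof (rule card_inj_on_le[of \<pi>])
      show "inj_on \<pi> {i\<in>{1..n}. l i = l (inv \<pi> j)}" by (rule permutes_inj_on[OF \<pi>])
      show "\<pi> ` {i\<in>{1..n}. l i = l (inv \<pi> j)} \<subseteq> {i\<in>{1..n}. l (inv \<pi> i) = l (inv \<pi> j)}"
      proof (rule image_subsetI)
        fix i assume "i \<in> {i\<in>{1..n}. l i = l (inv \<pi> j)}"
        then show "\<pi> i \<in> {i\<in>{1..n}. l (inv \<pi> i) = l (inv \<pi> j)}"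
          using permutes_in_image[OF \<pi>, of i] by (simp add: permutes_inverses[OF \<pi>])
      qed
    qed simp
    finally show "real n / (2 * real k) \<le> card {i\<in>{1..n}. l (inv \<pi> i) = l (inv \<pi> j)}" by simp
  qed
qed

text \<open>Here \<open>L\<close> stands for \<open>ln n\<close>, and \<open>q\<close> is the scale of the row sum noise.\<close>

lemma sorting_error:
  fixes p L q :: real
  assumes \<theta>: "\<theta> \<in> Theta m n" and \<sigma>: "\<sigma> permutes {1..n}" and \<tau>: "\<tau> permutes {1..n}"
    and k: "k > 0" and n: "n > 0" and p: "0 < p" "p \<le> 1"
    and l: "L \<ge> 1/2" "2 * L \<le> n * p" and q: "q = sqrt (n * p * L)"
    and blk: "\<And>i j. (i, j) \<in> off_diag n \<Longrightarrow> \<theta> i j = B (c i) (c j)"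
    and size: "\<And>j. j \<in> {1..n} \<Longrightarrow> real n / (2 * real k) \<le> card {i\<in>{1..n}. c i = c j}"
    and gap: "\<And>i. i \<in> {1..n} \<Longrightarrow> \<bar>row_sum n \<theta> (\<sigma> i) - row_sum n \<theta> (\<tau> i)\<bar> \<le> 18 * q / p"
  shows "(frob_norm n (\<lambda>i j. (\<theta> \<odot> \<sigma>) i j - (\<theta> \<odot> \<tau>) i j))\<^sup>2
    \<le> 9600 * (n * (min (real k) (sqrt (n * p)) + L) * L / p)"
proof -
  define \<kappa> where "\<kappa> = min (real k) (sqrt (n * p))"
  have q2: "q\<^sup>2 = n * p * L" using q p l by simp
  have "L * L \<le> n * p * L" using l by (intro mult_right_mono) auto
  then have "L\<^sup>2 \<le> q\<^sup>2" unfolding q2 by (simp add: power2_eq_square)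
  have q0: "0 \<le> q" unfolding q using p l by simp
  have lq: "L \<le> q" by (rule power2_le_imp_le[OF \<open>L\<^sup>2 \<le> q\<^sup>2\<close> q0])
  have "p \<le> 2 * q" using lq l(1) p(2) by linarith
  then have one: "1 \<le> 2 * q / p" using p(1) by (simp add: le_divide_eq)
  have g: "row_gap n \<theta> (\<sigma> i) (\<tau> i) \<le> 2400 * \<kappa> * L / p" if i: "i \<in> {1..n}" for i
  proof -
    have ab: "\<sigma> i \<in> {1..n}" "\<tau> i \<in> {1..n}"
      using i permutes_in_image[OF \<sigma>, of i] permutes_in_image[OF \<tau>, of i] by auto
    define s where "s = (\<Sum>j\<in>{1..n} - {\<sigma> i, \<tau> i}. \<bar>\<theta> (\<sigma> i) j - \<theta> (\<tau> i) j\<bar>)"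
    have s0: "0 \<le> s" unfolding s_def by (intro sum_nonneg) auto
    have s: "s \<le> 20 * q / p"
    proof -
      \<comment> \<open>The additive 1 of \<open>row_distance_l1\<close> is dominated by
        \<open>2 * q / p\<close>, because \<open>q \<ge> L \<ge> 1/2\<close> and
        \<open>p \<le> 1\<close>.\<close>
      have "s \<le> 18 * q / p + 2 * q / p"
        using row_distance_l1[OF \<theta> ab] gap[OF i] one unfolding s_def by linarith
      then show ?thesis by (simp add: add_divide_distrib[symmetric])
    qed
    \<comment> \<open>For few blocks the squared bound is of order
      \<open>k / n * (q / p)^2 = k * L / p\<close>; for many blocks the L1 bound is of order
      \<open>q / p = sqrt (n * p * L) / p\<close>. Up to powers of \<open>L\<close> the two meet at
      \<open>k = sqrt (n * p)\<close>.\<close>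
    show ?thesis
    proof (cases "real k \<le> sqrt (n * p)")
      case True
      have "row_gap n \<theta> (\<sigma> i) (\<tau> i) \<le> 6 * real k / n * s\<^sup>2"
        unfolding s_def by (rule row_gap_blocks[where \<theta> = \<theta> and B = B and c = c, OF k n blk size ab])
      also have "\<dots> \<le> 6 * real k / n * (20 * q / p)\<^sup>2"
        using s s0 by (intro mult_left_mono power_mono) auto
      also have "(20 * q / p)\<^sup>2 = 400 * (n * p * L) / p\<^sup>2"
        by (simp add: power_divide power_mult_distrib q2)
      also have "6 * real k / n * (400 * (n * p * L) / p\<^sup>2) = 2400 * \<kappa> * L / p"
        using True n p by (simp add: \<kappa>_def power2_eq_square)
      finally show ?thesis .
    next
      case False
      have "sqrt L \<le> 2 * L"
      proof (rule real_le_lsqrt)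
        have "1 * L \<le> (4 * L) * L" using l by (intro mult_right_mono) auto
        then show "L \<le> (2 * L)\<^sup>2" by (simp add: power2_eq_square)
      qed (use l in auto)
      then have "sqrt (n * p) * sqrt L \<le> sqrt (n * p) * (2 * L)"
        using p by (intro mult_left_mono) auto
      then have qk: "q \<le> 2 * \<kappa> * L" using False by (simp add: q \<kappa>_def real_sqrt_mult mult_ac)
      have "row_gap n \<theta> (\<sigma> i) (\<tau> i) \<le> s" unfolding s_def by (rule row_gap_le_l1[OF \<theta>])
      also have "s \<le> 2400 * \<kappa> * L / p"
      proof -
        have "0 \<le> \<kappa> * L" using l p by (simp add: \<kappa>_def)
        then have "20 * q \<le> 2400 * \<kappa> * L" using qk by argo
        then have "20 * q / p \<le> 2400 * \<kappa> * L / p" using p by (intro divide_right_mono) auto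
        then show ?thesis using s by linarith
      qed
      finally show ?thesis .
    qed
  qed
  have "(frob_norm n (\<lambda>i j. (\<theta> \<odot> \<sigma>) i j - (\<theta> \<odot> \<tau>) i j))\<^sup>2 \<le> 4 * real n * (2 + 2400 * \<kappa> * L / p)"
    by (rule perm_error_le_row_gap[OF \<theta> \<sigma> \<tau> g])
  \<comment> \<open>The 2 from the excluded columns is absorbed into the summand
    \<open>L * L / p\<close>, bounded below because \<open>L \<ge> 1/2\<close> and
    \<open>p \<le> 1\<close>.\<close>
  also have "\<dots> \<le> 4 * real n * (2400 * (\<kappa> + L) * L / p)"
  proof (rule mult_left_mono)
    have "(1/2) * (1/2) \<le> L * L" using l by (intro mult_mono) auto
    then have "2 * p \<le> 2400 * L * L" using p by (simp add: mult.assoc)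
    then have "2 \<le> 2400 * L * L / p" using p by (simp add: field_simps)
    then show "2 + 2400 * \<kappa> * L / p \<le> 2400 * (\<kappa> + L) * L / p"
      by (simp add: algebra_simps add_divide_distrib)
  qed simp
  also have "\<dots> = 9600 * (n * (\<kappa> + L) * L / p)" by simp
  finally show ?thesis unfolding \<kappa>_def .
qed

section \<open>The error on the good event\<close>

text \<open>Here \<open>a\<close> multiplies the distances of both the projection and
  \<open>\<theta>\<^sub>0\<close> to the centre, hence \<open>E + 2 * b\<close>. Each product with
  \<open>E\<close> is split so as to cost \<open>E^2 / 8\<close>; three of them leave more than half
  of \<open>E^2\<close> on the left.\<close>

lemma quadratic_absorb:
  fixes E a b c D S :: real
  assumes "E\<^sup>2 \<le> 16 * a * (E + 2 * b) + c + 2 * (D + S) * E"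
  shows "E\<^sup>2 \<le> 1056 * a\<^sup>2 + 32 * b\<^sup>2 + 16 * D\<^sup>2 + 16 * S\<^sup>2 + 2 * c"
proof -
  have "E\<^sup>2 \<le> 16 * (a * E) + 32 * (a * b) + c + 2 * (D * E) + 2 * (S * E)"
    using assms by (simp add: algebra_simps)
  moreover have "16 * (a * E) \<le> E\<^sup>2 / 8 + 512 * a\<^sup>2"
    using zero_le_power2[of "E - 64 * a"] by (simp add: power2_eq_square algebra_simps)
  moreover have "2 * (D * E) \<le> E\<^sup>2 / 8 + 8 * D\<^sup>2"
    using zero_le_power2[of "E - 8 * D"] by (simp add: power2_eq_square algebra_simps)
  moreover have "2 * (S * E) \<le> E\<^sup>2 / 8 + 8 * S\<^sup>2"
    using zero_le_power2[of "E - 8 * S"] by (simp add: power2_eq_square algebra_simps)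
  moreover have "32 * (a * b) \<le> 16 * a\<^sup>2 + 16 * b\<^sup>2"
    using zero_le_power2[of "a - b"] by (simp add: power2_eq_square algebra_simps)
  ultimately show ?thesis using zero_le_power2[of E] by linarith
qed

lemma off_norm_triangle: "off_norm n (\<lambda>i j. A i j + B i j) \<le> off_norm n A + off_norm n B"
  unfolding off_norm_def
  using L2_set_triangle_ineq[of "\<lambda>(i, j). A i j" "\<lambda>(i, j). B i j" "off_diag n"]
  by (simp add: case_prod_unfold)

lemma off_norm_le_frob: "off_norm n A \<le> frob_norm n A"
  unfolding off_norm_def frob_norm_def L2_set_def
  by (intro real_sqrt_le_mono sum_mono2) (auto simp: off_diag_def)

lemma proj_error:
  fixes p H h D :: real
  assumes \<theta>\<^sub>0: "\<theta>\<^sub>0 \<in> ordered_matrices m n" and \<pi>: "\<pi> permutes {1..n}" and \<theta>: "\<theta> = \<theta>\<^sub>0 \<odot> \<pi>"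
    and \<sigma>: "\<sigma> permutes {1..n}" and p: "0 < p" "p \<le> 1" and n: "n > 0" and H: "0 \<le> H"
    and h: "p / 2 \<le> h" and D: "real n * \<bar>p / h - 1\<bar> \<le> D"
    and A': "\<And>i j. 0 \<le> A' i j" "\<And>i j. A' i j \<le> 1"
    and good: "\<And>V. V \<in> perm_level_sets m n A' \<Longrightarrow>
      \<bar>\<Sum>(i, j)\<in>V. noise m n \<theta> p \<omega> i j\<bar> \<le> 2 * sqrt (H * (p * real (card V))) + 4 * H"
  defines "P \<equiv> proj n (ordered_matrices m n)
      ((\<lambda>i j. (data_matrix m n \<omega> i j - J_mat n i j / 2) / h + J_mat n i j / 2) \<odot> \<sigma>)"
  shows "(frob_norm n (\<lambda>i j. P i j - \<theta>\<^sub>0 i j))\<^sup>2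
    \<le> 1056 * (sqrt (H * p) * sqrt (1 + ln n) / p)\<^sup>2 + 32 * (off_norm n (\<lambda>i j. \<theta>\<^sub>0 i j - A' i j))\<^sup>2
      + 16 * D\<^sup>2 + 16 * (frob_norm n (\<lambda>i j. (\<theta> \<odot> \<sigma>) i j - \<theta>\<^sub>0 i j))\<^sup>2 + 2 * ((64 * H + 16 * real n) / p)"
proof -
  define Y where "Y = (\<lambda>i j. (data_matrix m n \<omega> i j - J_mat n i j / 2) / h + J_mat n i j / 2) \<odot> \<sigma>"
  define z where "z i j = noise m n \<theta> p \<omega> (\<sigma> i) (\<sigma> j)" for i j
  define w where "w i j = (p / h - 1) * (\<theta> (\<sigma> i) (\<sigma> j) - J_mat n (\<sigma> i) (\<sigma> j) / 2)" for i j
  define v where "v i j = (\<theta> \<odot> \<sigma>) i j - \<theta>\<^sub>0 i j" for i j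
  define d where "d i j = P i j - \<theta>\<^sub>0 i j" for i j
  define E where "E = frob_norm n d"
  define S where "S = frob_norm n v"
  define b where "b = off_norm n (\<lambda>i j. \<theta>\<^sub>0 i j - A' i j)"
  define r where "r = sqrt (H * p) * sqrt (1 + ln n)"
  have hp: "h > 0" using h p by linarith
  have r0: "0 \<le> r" using H p n by (simp add: r_def)
  have \<theta>T: "\<theta> \<in> Theta m n" using \<theta>\<^sub>0 \<pi> by (auto simp: Theta_def \<theta>)
  have P: "P \<in> ordered_matrices m n"
    "frob_norm n (\<lambda>i j. Y i j - P i j) \<le> frob_norm n (\<lambda>i j. Y i j - \<theta>\<^sub>0 i j)"
    unfolding P_def Y_def using proj_minimal[OF \<theta>\<^sub>0] by blast+
  have Yd: "Y i j - \<theta>\<^sub>0 i j = z i j / h + w i j + v i j" for i j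
    using hp by (simp add: Y_def z_def w_def v_def mat_perm_def noise_def field_simps)
  have diag: "d i i = 0" "z i i = 0" for i
    using ordered_matricesD(4)[OF P(1)] ordered_matricesD(4)[OF \<theta>\<^sub>0] noise_diag[OF \<theta>T]
    by (simp_all add: d_def z_def)
  have "E\<^sup>2 \<le> 2 * (\<Sum>i=1..n. \<Sum>j=1..n. (z i j / h + w i j + v i j) * d i j)"
    using frob_norm_minimal_ineq[OF P(2)] unfolding Yd E_def d_def .
  also have "(\<Sum>i=1..n. \<Sum>j=1..n. (z i j / h + w i j + v i j) * d i j)
      = (\<Sum>i=1..n. \<Sum>j=1..n. z i j * d i j) / h + (\<Sum>i=1..n. \<Sum>j=1..n. w i j * d i j)
        + (\<Sum>i=1..n. \<Sum>j=1..n. v i j * d i j)"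
    by (simp add: distrib_right sum.distrib sum_divide_distrib)
  finally have basic: "E\<^sup>2 \<le> 2 * ((\<Sum>i=1..n. \<Sum>j=1..n. z i j * d i j) / h
        + (\<Sum>i=1..n. \<Sum>j=1..n. w i j * d i j) + (\<Sum>i=1..n. \<Sum>j=1..n. v i j * d i j))" .
  have v: "(\<Sum>i=1..n. \<Sum>j=1..n. v i j * d i j) \<le> S * E"
    unfolding S_def E_def by (rule frob_norm_inner)
  have E0: "0 \<le> E" by (simp add: E_def)
  have w: "(\<Sum>i=1..n. \<Sum>j=1..n. w i j * d i j) \<le> D * E"
  proof -
    have "frob_norm n w \<le> real n * \<bar>p / h - 1\<bar>"
    proof (rule frob_norm_le_bound)
      fix i j
      have "\<bar>\<theta> (\<sigma> i) (\<sigma> j) - J_mat n (\<sigma> i) (\<sigma> j) / 2\<bar> \<le> 1"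
        using ThetaD(1,2)[OF \<theta>T, of "\<sigma> i" "\<sigma> j"] by (simp add: J_mat_def abs_le_iff)
      then show "\<bar>w i j\<bar> \<le> \<bar>p / h - 1\<bar>" unfolding w_def abs_mult by (simp add: mult_left_le)
    qed simp
    then have "frob_norm n w * E \<le> D * E" using D E0 by (intro mult_right_mono) auto
    then show ?thesis using frob_norm_inner[of w d n] by (simp add: E_def)
  qed
  have z: "(\<Sum>i=1..n. \<Sum>j=1..n. z i j * d i j) \<le> 4 * r * (E + 2 * b) + 16 * H + 4 * real n"
  proof -
    have inner: "\<bar>\<Sum>(i, j)\<in>off_diag n. z i j * (M i j - A' i j)\<bar>
        \<le> 4 * r * off_norm n (\<lambda>i j. M i j - A' i j) + 8 * H + 2 * real n" if "M \<in> ordered_matrices m n" for M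
      using noise_inner_bound[where A' = A', OF \<theta>T less_imp_le[OF p(1)] p(2) n H \<sigma> that A' good]
      by (simp only: z_def r_def mult.assoc)
    have "(\<Sum>i=1..n. \<Sum>j=1..n. z i j * d i j) = (\<Sum>(i, j)\<in>off_diag n. z i j * d i j)"
      using diag by (intro sum_square_off_diag) simp
    \<comment> \<open>Level sets are counted only relative to the centre \<open>A'\<close>, so the
      inner product with \<open>P - \<theta>\<^sub>0\<close> is split into those with
      \<open>P - A'\<close> and \<open>\<theta>\<^sub>0 - A'\<close>.\<close>
    also have "\<dots> = (\<Sum>(i, j)\<in>off_diag n. z i j * (P i j - A' i j)) - (\<Sum>(i, j)\<in>off_diag n. z i j * (\<theta>\<^sub>0 i j - A' i j))"
      by (simp add: d_def case_prod_unfold algebra_simps flip: sum_subtractf)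
    also have "\<dots> \<le> 4 * r * off_norm n (\<lambda>i j. P i j - A' i j) + 4 * r * b + 16 * H + 4 * real n"
      using inner[OF P(1)] inner[OF \<theta>\<^sub>0] unfolding b_def by linarith
    also have "4 * r * off_norm n (\<lambda>i j. P i j - A' i j) \<le> 4 * r * (E + b)"
      using off_norm_triangle[of n d "\<lambda>i j. \<theta>\<^sub>0 i j - A' i j"] off_norm_le_frob[of n d] r0
      by (intro mult_left_mono) (simp_all add: d_def E_def b_def)
    finally show ?thesis by (simp add: algebra_simps)
  qed
  have "(\<Sum>i=1..n. \<Sum>j=1..n. z i j * d i j) / h \<le> (4 * r * (E + 2 * b) + 16 * H + 4 * real n) / (p / 2)"
  proof (rule frac_le)
    have "0 \<le> b" by (simp add: b_def off_norm_def)
    then show "0 \<le> 4 * r * (E + 2 * b) + 16 * H + 4 * real n" using r0 E0 H by simp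
  qed (use z h p in auto)
  from order_trans[OF basic mult_left_mono[OF add_mono[OF add_mono[OF this w] v]]]
  have "E\<^sup>2 \<le> 2 * ((4 * r * (E + 2 * b) + 16 * H + 4 * real n) / (p / 2) + D * E + S * E)"
    by simp
  also have "\<dots> = 16 * (r / p) * (E + 2 * b) + (64 * H + 16 * real n) / p + 2 * (D + S) * E"
    using p by (simp add: field_simps)
  finally have "E\<^sup>2 \<le> 1056 * (r / p)\<^sup>2 + 32 * b\<^sup>2 + 16 * D\<^sup>2 + 16 * S\<^sup>2 + 2 * ((64 * H + 16 * real n) / p)"
    by (rule quadratic_absorb)
  then show ?thesis unfolding E_def d_def S_def v_def b_def r_def .
qed


lemma estimator_error:
  fixes p \<kappa> L H x :: real
  assumes \<theta>\<^sub>0: "\<theta>\<^sub>0 \<in> ordered_matrices m n" and \<pi>: "\<pi> permutes {1..n}" and \<theta>: "\<theta> = \<theta>\<^sub>0 \<odot> \<pi>"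
    and k: "k > 0" and p: "0 < p" "p \<le> 1" and n: "n \<ge> 2"
    and L: "L = ln n" "2 * L \<le> n * p" and \<kappa>: "\<kappa> = min (real k) (sqrt (n * p))"
    and H: "H = 2 * n * L + 6 * n * \<kappa>"
    and blk: "\<And>i j. (i, j) \<in> off_diag n \<Longrightarrow> \<theta> i j = B (c i) (c j)"
    and size: "\<And>j. j \<in> {1..n} \<Longrightarrow> real n / (2 * real k) \<le> card {i\<in>{1..n}. c i = c j}"
    and A': "\<And>i j. 0 \<le> A' i j" "\<And>i j. A' i j \<le> 1" "\<And>i j. \<bar>\<theta>\<^sub>0 i j - A' i j\<bar> \<le> 1 / sqrt (n * p)"
    and good: "\<And>V. V \<in> perm_level_sets m n A' \<Longrightarrow>
      \<bar>\<Sum>(i, j)\<in>V. noise m n \<theta> p \<omega> i j\<bar> \<le> 2 * sqrt (H * (p * real (card V))) + 4 * H"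
    and rows: "\<And>i. i \<in> {1..n} \<Longrightarrow> \<bar>row_sum n (noise m n \<theta> p \<omega>) i\<bar> \<le> 9 * sqrt (n * p * L)"
    and phat: "(p_hat n \<omega> - p)\<^sup>2 \<le> p * L / (8 * n)"
    and \<sigma>: "\<sigma> \<in> sorting_perms n (data_matrix m n \<omega>)"
  shows "(frob_norm n (\<lambda>i j. theta_hat m n \<omega> \<sigma> i j - \<theta> i j))\<^sup>2 \<le> 400000 * (real n * (\<kappa> + L) * L / p)"
proof -
  define Q where "Q = real n * (\<kappa> + L) * L / p"
  define h where "h = p_hat n \<omega>"
  define P where "P = proj n (ordered_matrices m n)
      ((\<lambda>i j. (data_matrix m n \<omega> i j - J_mat n i j / 2) / h + J_mat n i j / 2) \<odot> \<sigma>)"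
  define b where "b = off_norm n (\<lambda>i j. \<theta>\<^sub>0 i j - A' i j)"
  define E where "E = frob_norm n (\<lambda>i j. P i j - \<theta>\<^sub>0 i j)"
  define S where "S = frob_norm n (\<lambda>i j. (\<theta> \<odot> \<sigma>) i j - \<theta>\<^sub>0 i j)"
  define D where "D = real n * (2 / p * \<bar>h - p\<bar>)"
  have L23: "L \<ge> 2/3"
  proof -
    have "ln 2 \<le> L" using n by (simp add: L)
    then show ?thesis using ln2_ge_two_thirds by linarith
  qed
  have \<kappa>0: "0 \<le> \<kappa>" using p by (simp add: \<kappa>)
  have np: "1 \<le> n * p" "0 < n * p" using L(2) L23 by linarith+
  have \<sigma>': "\<sigma> permutes {1..n}" using \<sigma> by (simp add: sorting_perms_def)
  have \<tau>: "inv \<pi> permutes {1..n}" by (rule permutes_inv[OF \<pi>])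
  have \<theta>T: "\<theta> \<in> Theta m n" using \<theta>\<^sub>0 \<pi> by (auto simp: Theta_def \<theta>)
  have \<theta>\<tau>: "\<theta> \<odot> inv \<pi> = \<theta>\<^sub>0"
    by (simp add: \<theta> mat_perm_def permutes_inverses[OF \<pi>])
  have H0: "0 \<le> H" using \<kappa>0 L23 by (simp add: H)
  have hp: "\<bar>h - p\<bar> \<le> p / 4"
  proof -
    \<comment> \<open>The 8 in \<open>phat\<close> is made for this:
      \<open>L \<le> n * p / 2\<close> turns \<open>p * L / (8 * n)\<close> into
      \<open>p^2 / 16\<close>.\<close>
    have "p * L / (8 * n) \<le> (p / 4)\<^sup>2"
      using L(2) p n by (simp add: power2_eq_square field_simps)
    then have "(h - p)\<^sup>2 \<le> (p / 4)\<^sup>2" using phat by (simp add: h_def)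
    then show ?thesis using p by (simp add: abs_le_square_iff[symmetric])
  qed
  have h: "p / 2 \<le> h" "0 < h" using hp p by linarith+
  \<comment> \<open>The estimator projects only if \<open>p_hat \<ge> 1 / n\<close>. The relative
    error 1/4 together with \<open>n * p \<ge> 4/3\<close> puts the present case in that
    branch.\<close>
  have h1: "1 / n \<le> h"
  proof -
    have "4/3 \<le> n * p" using L(2) L23 by linarith
    then have "1 / n \<le> 3 / 4 * p" using n by (simp add: field_simps)
    then show ?thesis using hp by linarith
  qed
  have DD: "real n * \<bar>p / h - 1\<bar> \<le> D"
  proof -
    have "p / h - 1 = - (h - p) / h" using h by (simp add: field_simps)
    then have "\<bar>p / h - 1\<bar> = \<bar>h - p\<bar> / h" using h by (simp add: abs_divide)
    also have "\<dots> \<le> \<bar>h - p\<bar> / (p / 2)" using h p by (intro divide_left_mono) auto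
    finally show ?thesis unfolding D_def by (intro mult_left_mono) (simp_all add: mult.commute)
  qed
  have Q1: "real n * L\<^sup>2 / p \<le> Q"
    unfolding Q_def power2_eq_square using p \<kappa>0 L23 by (intro divide_right_mono) (auto simp: algebra_simps)
  \<comment> \<open>Since \<open>L\<close> is bounded away from 0, lower powers of it can be raised
    at the price of a constant, so that every error term becomes a multiple of
    \<open>Q\<close>.\<close>
  have LL: "L \<le> 2 * L\<^sup>2" "1 \<le> 4 * L\<^sup>2"
  proof -
    have "(2/3) * L \<le> L * L" using L23 by (intro mult_right_mono) auto
    then show "L \<le> 2 * L\<^sup>2" "1 \<le> 4 * L\<^sup>2" using L23 unfolding power2_eq_square by linarith+
  qed
  have nQ: "real n / p \<le> 4 * Q"
  proof -
    have "real n * 1 / p \<le> real n * (4 * L\<^sup>2) / p" using LL p by (intro divide_right_mono mult_left_mono) auto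
    also have "\<dots> = 4 * (real n * L\<^sup>2 / p)" by simp
    finally show ?thesis using Q1 by simp
  qed
  have HLQ: "H * L / p \<le> 6 * Q"
  proof -
    have "H * L \<le> 6 * (real n * (\<kappa> + L) * L)"
    proof -
      have "0 \<le> real n * L * L" using L23 by simp
      then show ?thesis by (simp add: H algebra_simps)
    qed
    then have "H * L / p \<le> 6 * (real n * (\<kappa> + L) * L) / p" using p by (intro divide_right_mono) auto
    then show ?thesis by (simp add: Q_def)
  qed
  have HQ: "H / p \<le> 12 * Q"
  proof -
    have "H * 1 \<le> H * (2 * L)" using H0 L23 by (intro mult_left_mono) auto
    then have "H * 1 / p \<le> H * (2 * L) / p" using p by (intro divide_right_mono) auto
    also have "\<dots> = 2 * (H * L / p)" by simp
    finally show ?thesis using HLQ by simp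
  qed
  have aQ: "(sqrt (H * p) * sqrt (1 + ln n) / p)\<^sup>2 \<le> 18 * Q"
  proof -
    have "(sqrt (H * p) * sqrt (1 + ln n) / p)\<^sup>2 = H * p * (1 + L) / p\<^sup>2"
      using H0 p L23 by (simp add: power_divide power_mult_distrib L(1)[symmetric])
    also have "\<dots> = H * (1 + L) / p" using p by (simp add: power2_eq_square)
    also have "\<dots> \<le> H * (3 * L) / p" using H0 L23 p by (intro divide_right_mono mult_left_mono) auto
    also have "\<dots> = 3 * (H * L / p)" by simp
    finally show ?thesis using HLQ by linarith
  qed
  have bQ: "b\<^sup>2 \<le> 4 * Q"
  proof -
    have "b \<le> frob_norm n (\<lambda>i j. \<theta>\<^sub>0 i j - A' i j)" unfolding b_def by (rule off_norm_le_frob)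
    also have "\<dots> \<le> real n * (1 / sqrt (n * p))" using np by (intro frob_norm_le_bound A') simp
    finally have "b\<^sup>2 \<le> (real n * (1 / sqrt (n * p)))\<^sup>2"
      by (intro power_mono) (simp_all add: b_def off_norm_def)
    also have "\<dots> = real n / p" using np n by (simp add: power_mult_distrib power_divide power2_eq_square)
    finally show ?thesis using nQ by linarith
  qed
  have DQ: "D\<^sup>2 \<le> Q"
  proof -
    have "D\<^sup>2 = (real n)\<^sup>2 * (4 / p\<^sup>2) * (h - p)\<^sup>2" by (simp add: D_def power_mult_distrib power_divide)
    also have "\<dots> \<le> (real n)\<^sup>2 * (4 / p\<^sup>2) * (p * L / (8 * n))"
      using phat unfolding h_def by (intro mult_left_mono) auto
    also have "\<dots> = real n * L / (2 * p)" using p n by (simp add: power2_eq_square)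
    also have "\<dots> \<le> real n * (2 * L\<^sup>2) / (2 * p)" using LL p by (intro divide_right_mono mult_left_mono) auto
    also have "\<dots> = real n * L\<^sup>2 / p" by simp
    finally show ?thesis using Q1 by simp
  qed
  have SQ: "S\<^sup>2 \<le> 9600 * Q"
  proof -
    have gap: "\<bar>row_sum n \<theta> (\<sigma> i) - row_sum n \<theta> (inv \<pi> i)\<bar> \<le> 18 * sqrt (n * p * L) / p" if "i \<in> {1..n}" for i
      using sorted_row_gap[OF \<theta>\<^sub>0 \<pi> \<theta> p(1) \<sigma> rows that] by simp
    show ?thesis
      using sorting_error[where c = c and B = B and k = k, OF \<theta>T \<sigma>' \<tau> k _ p _ L(2) refl blk size gap] n L23
      unfolding S_def Q_def \<kappa> \<theta>\<tau> by simp
  qed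
  have "E\<^sup>2 \<le> 1056 * (sqrt (H * p) * sqrt (1 + ln n) / p)\<^sup>2 + 32 * b\<^sup>2 + 16 * D\<^sup>2 + 16 * S\<^sup>2
      + 2 * ((64 * H + 16 * real n) / p)"
    unfolding E_def P_def b_def S_def
    by (rule proj_error[where A' = A', OF \<theta>\<^sub>0 \<pi> \<theta> \<sigma>' p _ H0 h(1) DD A'(1,2) good]) (use n in simp)
  also have "\<dots> \<le> 1056 * (18 * Q) + 32 * (4 * Q) + 16 * Q + 16 * (9600 * Q) + 2 * (64 * (12 * Q) + 16 * (4 * Q))"
    using aQ bQ DQ SQ HQ nQ by (simp add: add_divide_distrib)
  also have "\<dots> = 174416 * Q" by simp
  finally have EQ: "E\<^sup>2 \<le> 174416 * Q" .
  \<comment> \<open>The Frobenius norm is invariant under relabelling, so the comparison is made in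
    sorted coordinates, where the estimator is \<open>P\<close> and the target is
    \<open>\<theta> \<odot> \<sigma>\<close>, at distance \<open>S\<close> from
    \<open>\<theta>\<^sub>0\<close>.\<close>
  have "frob_norm n (\<lambda>i j. theta_hat m n \<omega> \<sigma> i j - \<theta> i j)
      = frob_norm n (\<lambda>i j. theta_hat m n \<omega> \<sigma> (\<sigma> i) (\<sigma> j) - \<theta> (\<sigma> i) (\<sigma> j))"
    using frob_norm_perm[OF \<sigma>', of "\<lambda>i j. theta_hat m n \<omega> \<sigma> i j - \<theta> i j"] by simp
  also have "\<dots> = frob_norm n (\<lambda>i j. (P i j - \<theta>\<^sub>0 i j) + (\<theta>\<^sub>0 i j - (\<theta> \<odot> \<sigma>) i j))"
    using h1 by (simp add: theta_hat_def h_def P_def mat_perm_def permutes_inverses[OF \<sigma>'])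
  also have "\<dots> \<le> E + frob_norm n (\<lambda>i j. \<theta>\<^sub>0 i j - (\<theta> \<odot> \<sigma>) i j)"
    unfolding E_def by (rule frob_norm_triangle)
  also have "frob_norm n (\<lambda>i j. \<theta>\<^sub>0 i j - (\<theta> \<odot> \<sigma>) i j) = S"
    by (simp add: S_def frob_norm_def L2_set_def case_prod_unfold power2_commute)
  finally have "(frob_norm n (\<lambda>i j. theta_hat m n \<omega> \<sigma> i j - \<theta> i j))\<^sup>2 \<le> (E + S)\<^sup>2"
    by (intro power_mono) simp_all
  also have "\<dots> \<le> 2 * E\<^sup>2 + 2 * S\<^sup>2"
    using zero_le_power2[of "E - S"] by (simp add: power2_eq_square algebra_simps)
  also have "\<dots> \<le> 400000 * Q" using EQ SQ order_trans[OF zero_le_power2 DQ] by linarith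
  finally show ?thesis unfolding Q_def .
qed

section \<open>The risk\<close>

text \<open>The uniform distribution on a set has its intended meaning only for finite nonempty
  sets. A sorted list of the indices supplies an element; lists start at 0, hence the shift by
  1.\<close>

lemma sorting_perms_nonempty: "sorting_perms n y \<noteq> {}"
proof -
  define f where "f = row_sum n y"
  define xs where "xs = sort_key f [1..<Suc n]"
  define \<sigma> where "\<sigma> i = (if i \<in> {1..n} then xs ! (i - 1) else i)" for i
  have xs: "length xs = n" "set xs = {1..n}" "distinct xs" "sorted (map f xs)"
    by (auto simp: xs_def)
  have "bij_betw (\<lambda>i. i - 1) {1..n} {..<n}"
    by (rule bij_betw_byWitness[where f' = Suc]) auto
  moreover have "bij_betw ((!) xs) {..<n} {1..n}"
    by (rule bij_betw_nth) (simp_all add: xs)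
  ultimately have "bij_betw ((!) xs \<circ> (\<lambda>i. i - 1)) {1..n} {1..n}" by (rule bij_betw_trans)
  then have "bij_betw \<sigma> {1..n} {1..n}"
    by (subst bij_betw_cong[where g = "(!) xs \<circ> (\<lambda>i. i - 1)"]) (simp_all add: \<sigma>_def)
  then have "\<sigma> permutes {1..n}" by (rule bij_imp_permutes) (auto simp: \<sigma>_def)
  moreover have "mono_on {1..n} (\<lambda>i. f (\<sigma> i))"
  proof (rule mono_onI)
    fix i j assume ij: "i \<in> {1..n}" "j \<in> {1..n}" "i \<le> j"
    then have "map f xs ! (i - 1) \<le> map f xs ! (j - 1)"
      by (intro sorted_nth_mono xs(4)) (auto simp: xs(1))
    then show "f (\<sigma> i) \<le> f (\<sigma> j)" using ij by (simp add: \<sigma>_def xs(1))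
  qed
  ultimately have "\<sigma> \<in> sorting_perms n y" by (simp add: sorting_perms_def f_def)
  then show ?thesis by blast
qed

lemma finite_sorting_perms: "finite (sorting_perms n y)"
  by (rule finite_subset[OF _ finite_permutations[of "{1..n}"]]) (auto simp: sorting_perms_def)

lemma theta_hat_range: "0 \<le> theta_hat m n \<omega> \<sigma> i j \<and> theta_hat m n \<omega> \<sigma> i j \<le> 1"
proof -
  have ne: "ordered_matrices m n \<noteq> {}"
  proof -
    have "(\<lambda>i j. J_mat n i j / 2) \<in> ordered_matrices m n"
      by (cases m) (auto simp: tournament_matrices_def graph_matrices_def unit_matrices_def J_mat_def)
    then show ?thesis by blast
  qed
  then obtain B where "B \<in> ordered_matrices m n" by blast
  from ordered_matricesD(2,3)[OF proj_minimal(1)[OF this]] show ?thesis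
    by (simp add: theta_hat_def mat_perm_def J_mat_def)
qed

text \<open>The good bound is assumed for every sorting permutation, so averaging over ties
  preserves it. On \<open>A\<close> all entries of estimator and target lie in the unit interval,
  whence the trivial error \<open>n^2\<close>.\<close>

lemma risk_le:
  fixes R \<beta> :: real
  assumes \<theta>: "\<theta> \<in> Theta m n" and R: "0 \<le> R"
    and good: "\<And>\<omega> \<sigma>. \<omega> \<notin> A \<Longrightarrow> \<sigma> \<in> sorting_perms n (data_matrix m n \<omega>) \<Longrightarrow>
      (frob_norm n (\<lambda>i j. theta_hat m n \<omega> \<sigma> i j - \<theta> i j))\<^sup>2 \<le> R"
    and bad: "measure_pmf.prob (sample_pmf n \<theta> p) A \<le> \<beta>"
  shows "risk m n \<theta> p \<le> R + (real n)\<^sup>2 * \<beta>"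
proof -
  let ?P = "sample_pmf n \<theta> p"
  let ?g = "\<lambda>\<theta>'. (frob_norm n (\<lambda>i j. \<theta>' i j - \<theta> i j))\<^sup>2"
  let ?f = "\<lambda>\<omega>. map_pmf (theta_hat m n \<omega>) (pmf_of_set (sorting_perms n (data_matrix m n \<omega>)))"
  have set_f: "set_pmf (?f \<omega>) = theta_hat m n \<omega> ` sorting_perms n (data_matrix m n \<omega>)" for \<omega>
    using sorting_perms_nonempty finite_sorting_perms by simp
  have finf: "finite (set_pmf (?f \<omega>))" for \<omega>
    unfolding set_f using finite_sorting_perms by simp
  have le: "measure_pmf.expectation (?f \<omega>) ?g \<le> R + (real n)\<^sup>2 * indicator A \<omega>" for \<omega>
  proof (rule measure_pmf.integral_le_const)
    show "integrable (measure_pmf (?f \<omega>)) ?g" by (rule integrable_measure_pmf_finite[OF finf])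
    show "AE \<theta>' in measure_pmf (?f \<omega>). ?g \<theta>' \<le> R + (real n)\<^sup>2 * indicator A \<omega>"
    proof (rule AE_pmfI)
      fix \<theta>' assume "\<theta>' \<in> set_pmf (?f \<omega>)"
      then obtain \<sigma> where \<sigma>: "\<sigma> \<in> sorting_perms n (data_matrix m n \<omega>)" and e: "\<theta>' = theta_hat m n \<omega> \<sigma>"
        unfolding set_f by blast
      show "?g \<theta>' \<le> R + (real n)\<^sup>2 * indicator A \<omega>"
      proof (cases "\<omega> \<in> A")
        case False
        then show ?thesis using good[OF False \<sigma>] by (simp add: e)
      next
        case True
        have "frob_norm n (\<lambda>i j. \<theta>' i j - \<theta> i j) \<le> real n * 1"
        proof (rule frob_norm_le_bound)
          fix i j
          show "\<bar>\<theta>' i j - \<theta> i j\<bar> \<le> 1"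
            using theta_hat_range[of m n \<omega> \<sigma> i j] ThetaD(1,2)[OF \<theta>, of i j] unfolding e by linarith
        qed simp
        then have "?g \<theta>' \<le> (real n)\<^sup>2" by (intro power_mono) simp_all
        moreover have "indicator A \<omega> = (1 :: real)" using True by simp
        ultimately show ?thesis using R by (simp only: mult_1_right)
      qed
    qed
  qed
  have "risk m n \<theta> p = (\<Sum>\<omega>\<in>set_pmf ?P. pmf ?P \<omega> *\<^sub>R measure_pmf.expectation (?f \<omega>) ?g)"
    unfolding risk_def estimator_pmf_def
    by (rule pmf_expectation_bind[OF finite_set_sample_pmf finf order_refl])
  also have "\<dots> \<le> (\<Sum>\<omega>\<in>set_pmf ?P. pmf ?P \<omega> *\<^sub>R (R + (real n)\<^sup>2 * indicator A \<omega>))"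
    by (intro sum_mono scaleR_left_mono le) simp
  also have "\<dots> = measure_pmf.expectation ?P (\<lambda>\<omega>. R + (real n)\<^sup>2 * indicator A \<omega>)"
    by (subst integral_measure_pmf[OF finite_set_sample_pmf]) auto
  also have "\<dots> = R + (real n)\<^sup>2 * measure_pmf.prob ?P A"
    by (subst Bochner_Integration.integral_add)
       (auto intro!: integrable_measure_pmf_finite finite_set_sample_pmf)
  also have "\<dots> \<le> R + (real n)\<^sup>2 * \<beta>" using bad by (intro add_left_mono mult_left_mono) auto
  finally show ?thesis .
qed

section \<open>Deviation levels on the good event\<close>

lemma row_noise_level:
  fixes p L :: real
  assumes "0 \<le> p" "0 \<le> L" "2 * L \<le> n * p" "v \<le> n"
  shows "2 * sqrt (2 * L * (p * real v)) + 4 * (2 * L) \<le> 9 * sqrt (n * p * L)"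
proof -
  \<comment> \<open>The bounds \<open>sqrt 2 \<le> 3/2\<close> and
    \<open>sqrt (1/2) \<le> 3/4\<close> turn the two parts into \<open>3 * q\<close> and
    \<open>6 * q\<close>, the latter through \<open>L \<le> n * p / 2\<close>.\<close>
  define q where "q = sqrt (n * p * L)"
  have q: "0 \<le> q" "q\<^sup>2 = n * p * L" using assms by (simp_all add: q_def)
  have "2 * L * (p * real v) \<le> 2 * L * (p * n)" using assms by (intro mult_left_mono) auto
  also have "\<dots> \<le> (3/2 * q)\<^sup>2"
    unfolding power_mult_distrib q(2) using assms by (simp add: power2_eq_square)
  finally have "sqrt (2 * L * (p * real v)) \<le> 3/2 * q" using q by (intro real_le_lsqrt) simp_all
  moreover have "L \<le> 3/4 * q"
  proof (rule power2_le_imp_le)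
    have "2 * L * L \<le> n * p * L" using assms by (intro mult_right_mono) auto
    moreover have "0 \<le> L * L" by simp
    ultimately have "16 * (L * L) \<le> 9 * (n * p * L)" by linarith
    then show "L\<^sup>2 \<le> (3/4 * q)\<^sup>2"
      unfolding power_mult_distrib q(2) by (simp add: power2_eq_square)
  qed (use q in simp)
  ultimately show ?thesis unfolding q_def by linarith
qed

text \<open>\<open>N\<close> stands for the number of pairs. The linear part is dominated once
  \<open>N\<close> is a large multiple of \<open>n\<close>, leaving
  \<open>N * t^2 \<le> 9 * L * p\<close>; the factor 128 then brings \<open>9 / 128\<close> below
  \<open>1 / 8\<close>.\<close>

lemma p_hat_level:
  fixes p L N t :: real
  assumes p: "0 < p" and L: "0 \<le> L" "2 * L \<le> n * p" and N: "128 * real n \<le> N" and n: "n > 0"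
    and t: "0 \<le> t" "N * t \<le> 2 * sqrt (L * (p * N)) + 4 * L"
  shows "t\<^sup>2 \<le> p * L / (8 * n)"
proof -
  have N0: "N > 0" using N n by simp
  define u where "u = L * p * N"
  have u: "(sqrt (L * (p * N)))\<^sup>2 = u" using p L N0 by (simp add: u_def)
  have "(N * t)\<^sup>2 \<le> (2 * sqrt (L * (p * N)) + 4 * L)\<^sup>2"
    using t N0 by (intro power_mono) auto
  also have "\<dots> \<le> 2 * (2 * sqrt (L * (p * N)))\<^sup>2 + 2 * (4 * L)\<^sup>2"
    using zero_le_power2[of "2 * sqrt (L * (p * N)) - 4 * L"] by (simp add: power2_eq_square algebra_simps)
  also have "\<dots> = 8 * u + 32 * L\<^sup>2" by (simp add: power_mult_distrib u)
  also have "32 * L\<^sup>2 \<le> u"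
  proof -
    have "32 * L\<^sup>2 = 16 * L * (2 * L)" by (simp add: power2_eq_square)
    also have "\<dots> \<le> 16 * L * (n * p)" using L by (intro mult_left_mono) auto
    also have "\<dots> = L * p * (16 * n)" by simp
    also have "\<dots> \<le> L * p * N" using L p N by (intro mult_left_mono) auto
    finally show ?thesis by (simp add: u_def)
  qed
  finally have "N * (N * t\<^sup>2) \<le> N * (9 * (L * p))" by (simp add: u_def power2_eq_square mult_ac)
  then have Nt: "N * t\<^sup>2 \<le> 9 * (L * p)" using N0 by simp
  have "128 * real n * t\<^sup>2 \<le> N * t\<^sup>2" using N by (intro mult_right_mono) auto
  then have "128 * real n * t\<^sup>2 \<le> 9 * (L * p)" using Nt by linarith
  moreover have "0 \<le> L * p" using L p by simp
  ultimately have "8 * real n * t\<^sup>2 \<le> L * p" by linarith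
  then show ?thesis using n by (simp add: field_simps)
qed

lemma fact_le_exp: "n > 0 \<Longrightarrow> (fact n :: real) \<le> exp (n * ln n)"
proof -
  assume n: "n > 0"
  have "(fact n :: real) \<le> real (n ^ n)" by (rule fact_le_power)
  also have "\<dots> = exp (n * ln n)" using n by (simp add: exp_of_nat_mult)
  finally show ?thesis by simp
qed

lemma risk_bound_large:
  assumes n: "n \<ge> 1000" and k: "k \<in> {1..n}" and p: "0 \<le> p" "p \<le> 1" "p \<ge> 2 * ln (real n) / real n"
    and \<theta>: "\<theta> \<in> block_Theta m n k"
  shows "risk m n \<theta> p \<le> 400032 * (real n * (min (real k) (sqrt (real n * p)) + ln n) * ln n / p)"
proof -
  define L where "L = ln (real n)"
  define \<kappa> where "\<kappa> = min (real k) (sqrt (real n * p))"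
  \<comment> \<open>One \<open>n * L\<close> pays for the permutations and
    \<open>6 * n * \<kappa>\<close> for the level sets; the other \<open>n * L\<close> leaves a
    failure probability of at most \<open>4 / n\<close>.\<close>
  define H where "H = 2 * real n * L + 6 * real n * \<kappa>"
  define Q where "Q = real n * (\<kappa> + L) * L / p"
  have n0: "n > 0" "n \<ge> 2" using n by simp_all
  have L23: "L \<ge> 2/3"
  proof -
    have "ln 2 \<le> L" using n by (simp add: L_def)
    then show ?thesis using ln2_ge_two_thirds by linarith
  qed
  have expL: "exp (- L) = 1 / n" using n0 by (simp add: L_def exp_minus inverse_eq_divide)
  have Lp: "2 * L \<le> real n * p" using p(3) n0 by (simp add: L_def field_simps)
  have p0: "0 < p"
  proof (rule ccontr)
    assume "\<not> 0 < p"
    then have "p = 0" using p by simp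
    then show False using Lp L23 by simp
  qed
  have \<kappa>0: "0 \<le> \<kappa>" using p by (simp add: \<kappa>_def)
  have H0: "H > 0" using L23 \<kappa>0 n0 by (simp add: H_def add_pos_nonneg)
  obtain B c where \<theta>T: "\<theta> \<in> Theta m n" and blk: "\<And>i j. (i, j) \<in> off_diag n \<Longrightarrow> \<theta> i j = B (c i) (c j)"
    and ck: "\<And>i. i \<in> {1..n} \<Longrightarrow> c i \<in> {1..k}"
    and size: "\<And>j. j \<in> {1..n} \<Longrightarrow> real n / (2 * real k) \<le> card {i\<in>{1..n}. c i = c j}"
    using block_ThetaE[OF \<theta> k] by blast
  obtain \<theta>\<^sub>0 \<pi> where \<theta>\<^sub>0: "\<theta>\<^sub>0 \<in> ordered_matrices m n" and \<pi>: "\<pi> permutes {1..n}" and e: "\<theta> = \<theta>\<^sub>0 \<odot> \<pi>"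
    using \<theta>T by (rule ThetaE)
  have \<tau>: "inv \<pi> permutes {1..n}" by (rule permutes_inv[OF \<pi>])
  have c': "c (inv \<pi> i) \<in> {1..k}" if "i \<in> {1..n}" for i
    using permutes_in_image[OF \<tau>, of i] that by (intro ck) blast
  have blk': "\<theta>\<^sub>0 i j = B (c (inv \<pi> i)) (c (inv \<pi> j))" if "(i, j) \<in> off_diag n" for i j
    using blk[OF off_diag_perm[OF \<tau> that]] by (simp add: e mat_perm_def permutes_inverses[OF \<pi>])
  have np: "1 \<le> sqrt (real n * p)" using Lp L23 by simp
  obtain A' :: rmat where A': "\<And>i j. 0 \<le> A' i j" "\<And>i j. A' i j \<le> 1" "\<And>i j. \<bar>\<theta>\<^sub>0 i j - A' i j\<bar> \<le> 1 / sqrt (real n * p)"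
    and finA: "finite (level_sets m n A')" and cardA: "card (level_sets m n A') \<le> 2 * exp (6 * real n * \<kappa>)"
    by (rule exists_centre[where c = "\<lambda>i. c (inv \<pi> i)" and B = B and A = \<theta>\<^sub>0 and m = m, OF k np c' blk' ordered_matricesD(2,3)[OF \<theta>\<^sub>0], folded \<kappa>_def]) (assumption, assumption, (rule that; blast))
  define F where "F = perm_level_sets m n A'"
  \<comment> \<open>Row sums are sums over subsets of \<open>off_diag n\<close> too, so the same
    tail bound serves. With only \<open>n\<close> rows the exponent \<open>2 * L\<close> is enough,
    and the sorting step relies on its being this small.\<close>
  define R where "R = (\<lambda>i. {i} \<times> ({1..n} - {i})) ` {1..n}"
  define N where "N = real (n choose 2)"
  let ?P = "sample_pmf n \<theta> p"
  let ?S = "\<lambda>V \<omega>. \<bar>\<Sum>(i, j)\<in>V. noise m n \<theta> p \<omega> i j\<bar>"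
  define A1 where "A1 = {\<omega>. \<exists>V\<in>F. 2 * sqrt (H * (p * real (card V))) + 4 * H < ?S V \<omega>}"
  define A2 where "A2 = {\<omega>. \<exists>V\<in>R. 2 * sqrt (2 * L * (p * real (card V))) + 4 * (2 * L) < ?S V \<omega>}"
  define A3 where "A3 = {\<omega>. 2 * sqrt (L * (p * N)) + 4 * L < N * \<bar>p_hat n \<omega> - p\<bar>}"
  have P1: "measure_pmf.prob ?P A1 \<le> 4 / n"
  proof -
    have "measure_pmf.prob ?P A1 \<le> real (card F) * (2 * exp (- H))"
      unfolding A1_def F_def
      by (rule noise_tail_family[OF \<theta>T p(1,2) H0 card_perm_level_sets(1)[OF finA] perm_level_sets_sub])
    also have "\<dots> \<le> (exp (n * L) * (2 * exp (6 * real n * \<kappa>))) * (2 * exp (- H))"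
    proof (rule mult_right_mono)
      have "real (card F) \<le> fact n * real (card (level_sets m n A'))"
        unfolding F_def by (rule card_perm_level_sets(2)[OF finA])
      also have "\<dots> \<le> exp (n * L) * (2 * exp (6 * real n * \<kappa>))"
        unfolding L_def by (intro mult_mono fact_le_exp n0(1) cardA) simp_all
      finally show "real (card F) \<le> exp (n * L) * (2 * exp (6 * real n * \<kappa>))" .
    qed simp
    also have "\<dots> = 4 * exp (n * L + 6 * real n * \<kappa> - H)" by (simp add: exp_add exp_diff exp_minus divide_inverse)
    also have "n * L + 6 * real n * \<kappa> - H = - (n * L)" by (simp add: H_def)
    also have "4 * exp (- (n * L)) \<le> 4 * exp (- L)"
    proof -
      have "1 * L \<le> n * L" using n0 L23 by (intro mult_right_mono) auto
      then show ?thesis by simp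
    qed
    finally show ?thesis by (simp add: expL)
  qed
  have P2: "measure_pmf.prob ?P A2 \<le> 2 / n"
  proof -
    have "measure_pmf.prob ?P A2 \<le> real (card R) * (2 * exp (- (2 * L)))"
      unfolding A2_def
      by (rule noise_tail_family[OF \<theta>T p(1,2)]) (use L23 in \<open>auto simp: R_def off_diag_def\<close>)
    also have "\<dots> \<le> real n * (2 * exp (- (2 * L)))"
    proof (rule mult_right_mono)
      have "card R \<le> card {1..n}" unfolding R_def by (rule card_image_le) simp
      then show "real (card R) \<le> real n" by simp
    qed simp
    also have "exp (- (2 * L)) = (1 / n) * (1 / n)"
      unfolding expL[symmetric] by (simp flip: exp_add)
    finally show ?thesis using n0 by simp
  qed
  have P3: "measure_pmf.prob ?P A3 \<le> 2 / n"
    unfolding A3_def N_def using p_hat_tail[OF \<theta>T p(1,2) _ n0(2), of L] L23 by (simp add: expL)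
  have "measure_pmf.prob ?P (A1 \<union> A2 \<union> A3) \<le> measure_pmf.prob ?P (A1 \<union> A2) + measure_pmf.prob ?P A3"
    by (rule measure_Un_le) auto
  moreover have "measure_pmf.prob ?P (A1 \<union> A2) \<le> measure_pmf.prob ?P A1 + measure_pmf.prob ?P A2"
    by (rule measure_Un_le) auto
  ultimately have PA: "measure_pmf.prob ?P (A1 \<union> A2 \<union> A3) \<le> 8 / n"
    using P1 P2 P3 by (simp add: add_divide_distrib[symmetric])
  \<comment> \<open>This is the place where \<open>n\<close> has to be large: the argument takes
    \<open>n - 1 \<ge> 256\<close>.\<close>
  have N128: "128 * real n \<le> N"
  proof -
    have "even (n * (n - 1))" by (cases "even n") auto
    then have "2 * (n choose 2) = n * (n - 1)" unfolding choose_two by (rule dvd_mult_div_cancel)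
    then have "2 * N = real (n * (n - 1))" unfolding N_def by (metis of_nat_mult of_nat_numeral)
    moreover have "n * 256 \<le> n * (n - 1)" using n by (intro mult_le_mono2) simp
    then have "real (n * 256) \<le> real (n * (n - 1))" by (simp only: of_nat_le_iff)
    ultimately show ?thesis by simp
  qed
  have good: "(frob_norm n (\<lambda>i j. theta_hat m n \<omega> \<sigma> i j - \<theta> i j))\<^sup>2 \<le> 400000 * Q"
    if \<omega>: "\<omega> \<notin> A1 \<union> A2 \<union> A3" and \<sigma>: "\<sigma> \<in> sorting_perms n (data_matrix m n \<omega>)" for \<omega> \<sigma>
    unfolding Q_def
  proof (rule estimator_error[where c = c and B = B and A' = A' and k = k and H = H,
        OF \<theta>\<^sub>0 \<pi> e _ p0 p(2) n0(2) L_def Lp \<kappa>_def H_def blk size A' _ _ _ \<sigma>])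
    show "0 < k" using k by simp
    show "\<bar>\<Sum>(i, j)\<in>V. noise m n \<theta> p \<omega> i j\<bar> \<le> 2 * sqrt (H * (p * real (card V))) + 4 * H"
      if "V \<in> perm_level_sets m n A'" for V
      using \<omega> that by (auto simp: A1_def F_def not_less)
    show "\<bar>row_sum n (noise m n \<theta> p \<omega>) i\<bar> \<le> 9 * sqrt (real n * p * L)" if i: "i \<in> {1..n}" for i
    proof -
      let ?V = "{i} \<times> ({1..n} - {i})"
      have "?V \<in> R" using i by (auto simp: R_def)
      then have "?S ?V \<omega> \<le> 2 * sqrt (2 * L * (p * real (card ?V))) + 4 * (2 * L)"
        using \<omega> by (auto simp: A2_def not_less)
      also have "\<dots> \<le> 9 * sqrt (real n * p * L)"
        using p L23 Lp i by (intro row_noise_level) auto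
      also have "(\<Sum>(i, j)\<in>?V. noise m n \<theta> p \<omega> i j) = row_sum n (noise m n \<theta> p \<omega>) i"
      proof -
        have "(\<Sum>(i, j)\<in>?V. noise m n \<theta> p \<omega> i j) = (\<Sum>j\<in>{1..n} - {i}. noise m n \<theta> p \<omega> i j)"
          by (simp flip: sum.cartesian_product)
        also have "\<dots> = row_sum n (noise m n \<theta> p \<omega>) i"
          unfolding row_sum_def using noise_diag[OF \<theta>T] by (intro sum.mono_neutral_left) auto
        finally show ?thesis .
      qed
      finally show ?thesis .
    qed
    have "N * \<bar>p_hat n \<omega> - p\<bar> \<le> 2 * sqrt (L * (p * N)) + 4 * L"
      using \<omega> by (simp add: A3_def not_less)
    then have "\<bar>p_hat n \<omega> - p\<bar>\<^sup>2 \<le> p * L / (8 * real n)"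
      using L23 by (intro p_hat_level[OF p0 _ Lp N128 n0(1)]) auto
    then show "(p_hat n \<omega> - p)\<^sup>2 \<le> p * L / (8 * real n)" by simp
  qed
  have Q0: "0 \<le> Q" using \<kappa>0 L23 p0 by (simp add: Q_def)
  have "risk m n \<theta> p \<le> 400000 * Q + (real n)\<^sup>2 * (8 / n)"
    by (rule risk_le[OF \<theta>T _ good PA]) (use Q0 in auto)
  also have "(real n)\<^sup>2 * (8 / n) = 8 * real n" by (simp add: power2_eq_square)
  \<comment> \<open>The bad event, of probability at most \<open>8 / n\<close>, costs
    \<open>8 * n\<close>; this is below the target because
    \<open>(\<kappa> + L) * L \<ge> 1/4\<close> and \<open>p \<le> 1\<close>.\<close>
  also have "8 * real n \<le> 32 * Q"
  proof -
    have "(1/2) * (1/2) \<le> (\<kappa> + L) * L" using L23 \<kappa>0 by (intro mult_mono) auto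
    then have "real n * (1/4) \<le> real n * ((\<kappa> + L) * L)" by (intro mult_left_mono) auto
    also have "\<dots> \<le> real n * ((\<kappa> + L) * L) / p"
    proof -
      have "0 \<le> real n * ((\<kappa> + L) * L)" using L23 \<kappa>0 by simp
      then show ?thesis using p0 p(2) by (simp add: le_divide_eq mult_left_le)
    qed
    finally show ?thesis by (simp add: Q_def mult.assoc)
  qed
  finally have "risk m n \<theta> p \<le> 400032 * Q" by simp
  then show ?thesis unfolding Q_def \<kappa>_def L_def .
qed

theorem corollary2p2:
  shows "\<exists>C::real. \<forall>(m::model) (n::nat) (k::nat) (p::real).
           n \<ge> 2 \<longrightarrow> k \<in> {1..n} \<longrightarrow> p \<in> {0..1} \<longrightarrow> p \<ge> 2 * ln (real n) / real n \<longrightarrow>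
           (SUP \<theta>\<in>block_Theta m n k. ereal (1 / (real n)\<^sup>2 * risk m n \<theta> p))
             \<le> ereal (C * (min (real k) (sqrt (real n * p)) * ln (real n) / (real n * p)
                            + (ln (real n))\<^sup>2 / (real n * p)))"
proof (intro exI[of _ 1000000] allI impI SUP_least)
  fix m n k p \<theta>
  assume n: "n \<ge> 2" and k: "k \<in> {1..n}" and p: "p \<in> {0..1}" "p \<ge> 2 * ln (real n) / real n"
    and \<theta>: "\<theta> \<in> block_Theta m n k"
  define L where "L = ln (real n)"
  define \<kappa> where "\<kappa> = min (real k) (sqrt (real n * p))"
  have L23: "L \<ge> 2/3"
  proof -
    have "ln 2 \<le> L" using n by (simp add: L_def)
    then show ?thesis using ln2_ge_two_thirds by linarith
  qed
  have "0 < 2 * L / real n" using L23 n by simp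
  then have p0: "0 < p" using p(2) by (simp add: L_def)
  have \<kappa>0: "0 \<le> \<kappa>" using p by (simp add: \<kappa>_def)
  have n0: "real n > 0" using n by simp
  have "1 / (real n)\<^sup>2 * risk m n \<theta> p \<le> 1000000 * ((\<kappa> + L) * L / (real n * p))"
  proof (cases "n \<ge> 1000")
    case True
    have "risk m n \<theta> p \<le> 400032 * (real n * (\<kappa> + L) * L / p)"
      using risk_bound_large[OF True k _ _ p(2) \<theta>] p by (simp add: \<kappa>_def L_def)
    then have "1 / (real n)\<^sup>2 * risk m n \<theta> p \<le> 1 / (real n)\<^sup>2 * (400032 * (real n * (\<kappa> + L) * L / p))"
      by (intro mult_left_mono) auto
    also have "\<dots> = 400032 * ((\<kappa> + L) * L / (real n * p))"
      using n0 p0 by (simp add: power2_eq_square)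
    also have "\<dots> \<le> 1000000 * ((\<kappa> + L) * L / (real n * p))"
      using n0 p0 \<kappa>0 L23 by (intro mult_right_mono) auto
    finally show ?thesis .
  next
    case False
    have \<theta>T: "\<theta> \<in> Theta m n" using \<theta> by (simp add: block_Theta_def)
    \<comment> \<open>For \<open>n < 1000\<close> every sample is declared bad. The resulting bound
      \<open>n^2\<close> suffices: as \<open>n * p \<le> 1000\<close> and
      \<open>(\<kappa> + L) * L \<ge> 1/4\<close>, any constant from 4000 on covers it.\<close>
    have "risk m n \<theta> p \<le> 0 + (real n)\<^sup>2 * 1"
      by (rule risk_le[OF \<theta>T, of 0 UNIV]) auto
    then have "1 / (real n)\<^sup>2 * risk m n \<theta> p \<le> 1" using n0 by (simp add: field_simps)
    also have "\<dots> \<le> 1000000 * ((\<kappa> + L) * L / (real n * p))"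
    proof -
      have "(1/2) * (1/2) \<le> (\<kappa> + L) * L" using L23 \<kappa>0 by (intro mult_mono) auto
      moreover have "real n * p \<le> 1000 * 1" using False p by (intro mult_mono) auto
      ultimately have "real n * p \<le> 1000000 * ((\<kappa> + L) * L)" by linarith
      then show ?thesis using n0 p0 by (simp add: le_divide_eq)
    qed
    finally show ?thesis .
  qed
  also have "(\<kappa> + L) * L / (real n * p) = \<kappa> * L / (real n * p) + L\<^sup>2 / (real n * p)"
    by (simp add: distrib_right add_divide_distrib power2_eq_square)
  finally show "ereal (1 / (real n)\<^sup>2 * risk m n \<theta> p)
      \<le> ereal (1000000 * (min (real k) (sqrt (real n * p)) * ln (real n) / (real n * p)
                            + (ln (real n))\<^sup>2 / (real n * p)))"
    by (simp only: ereal_less_eq \<kappa>_def L_def)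
qed

end
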